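(* Let $m\ge 0$ and $\theta\in(-\frac{\pi}{2},\frac{\pi}{2})$. For $n\in\mathbb{N}$ let $\mathbb{P}_n^{\pm}$ denote the spectral projectors of $H_\theta$ onto the eigenspaces of the eigenvalues $\pm\sqrt{2n+m^2}$. Then, for each choice of the sign, $$\lim_{n\to\infty}\frac{\log\|\mathbb{P}_n^{\pm}\|}{n}=\log\sqrt{\frac{1+|\sin\theta|}{1-|\sin\theta|}}\,.$$
   Context: Pauli matrices: $\sigma_1=\begin{pmatrix}0&1\\1&0\end{pmatrix}$, $\sigma_2=\begin{pmatrix}0&-i\\i&0\end{pmatrix}$, $\sigma_3=\begin{pmatrix}1&0\\0&-1\end{pmatrix}$; Dirac matrices $\alpha_k=\begin{pmatrix}0&\sigma_k\\\sigma_k&0\end{pmatrix}$, $k=1,2,3$. For $m\ge0$ and $|\theta|<\frac{\pi}{2}$, the operator $H_\theta$ acts in $L^2(\mathbb{R})^4=L^2(\mathbb{R};\mathbb{C}^4)$ by $$H_\theta=-i\alpha_1e^{-i\theta/2}\partial_x-\alpha_2e^{i\theta/2}x+m\alpha_3,\qquad \mathsf{D}(H_\theta)=\mathcal{D}^4,\quad \mathcal{D}=H^1(\mathbb{R})\cap L^2(\mathbb{R},x^2\,dx).$$ It is closed with compact resolvent, its spectrum is $\{\pm\sqrt{2n+m^2}: n\in\mathbb{N}\}$ (with $0\in\mathbb{N}$), and each eigenvalue has equal algebraic and geometric multiplicity. The spectral projector onto the eigenspace of an isolated eigenvalue $\lambda$ is the (generally non-orthogonal) Riesz projection of $H_\theta$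 associated with $\lambda$; $\|\cdot\|$ is the operator norm on $L^2(\mathbb{R})^4$. *)

theory Defs
  imports "HOL-Complex_Analysis.Contour_Integration"
begin

section \<open>Complex normed spaces\<close>

class complex_normed_vector = real_normed_vector +
  fixes scaleC :: "complex \<Rightarrow> 'a \<Rightarrow> 'a"  (infixr \<open>*\<^sub>C\<close> 75)
  assumes scaleC_add_right: "c *\<^sub>C (x + y) = c *\<^sub>C x + c *\<^sub>C y"
    and scaleC_add_left: "(c + d) *\<^sub>C x = c *\<^sub>C x + d *\<^sub>C x"
    and scaleC_scaleC: "c *\<^sub>C (d *\<^sub>C x) = (c * d) *\<^sub>C x"
    and scaleC_of_real: "of_real r *\<^sub>C x = r *\<^sub>R x"
    and norm_scaleC: "norm (c *\<^sub>C x) = cmod c * norm x"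

lemma bounded_linear_scaleC:
  "bounded_linear (\<lambda>x::'a::complex_normed_vector. c *\<^sub>C x)"
proof (rule bounded_linear_intro[where K = "cmod c"])
  show "c *\<^sub>C (r *\<^sub>R x) = r *\<^sub>R (c *\<^sub>C x)" for r and x :: 'a
    by (simp add: scaleC_of_real[symmetric] scaleC_scaleC mult.commute)
qed (simp_all add: scaleC_add_right norm_scaleC mult.commute)

instantiation vec :: (complex_normed_vector, finite) complex_normed_vector
begin

definition scaleC_vec :: "complex \<Rightarrow> 'a ^ 'b \<Rightarrow> 'a ^ 'b"
  where "scaleC_vec c x = (\<chi> i. c *\<^sub>C (x $ i))"

instance
proof
  fix c d :: complex and r :: real and x y :: "'a ^ 'b"
  show "c *\<^sub>C (x + y) = c *\<^sub>C x + c *\<^sub>C y"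
    by (simp add: scaleC_vec_def vec_eq_iff scaleC_add_right)
  show "(c + d) *\<^sub>C x = c *\<^sub>C x + d *\<^sub>C x"
    by (simp add: scaleC_vec_def vec_eq_iff scaleC_add_left)
  show "c *\<^sub>C (d *\<^sub>C x) = (c * d) *\<^sub>C x"
    by (simp add: scaleC_vec_def vec_eq_iff scaleC_scaleC)
  show "of_real r *\<^sub>C x = r *\<^sub>R x"
    by (simp add: scaleC_vec_def vec_eq_iff scaleC_of_real)
  show "norm (c *\<^sub>C x) = cmod c * norm x"
    by (simp add: scaleC_vec_def norm_vec_def norm_scaleC L2_set_right_distrib)
qed

end

instantiation blinfun :: (real_normed_vector, complex_normed_vector) complex_normed_vector
begin

lift_definition scaleC_blinfun :: "complex \<Rightarrow> ('a \<Rightarrow>\<^sub>L 'b) \<Rightarrow> 'a \<Rightarrow>\<^sub>L 'b"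
  is "\<lambda>c f x. c *\<^sub>C f x"
  by (rule bounded_linear_compose[OF bounded_linear_scaleC])

instance
proof
  fix c d :: complex and r :: real and f g :: "'a \<Rightarrow>\<^sub>L 'b"
  show "c *\<^sub>C (f + g) = c *\<^sub>C f + c *\<^sub>C g"
    by transfer (simp add: scaleC_add_right)
  show "(c + d) *\<^sub>C f = c *\<^sub>C f + d *\<^sub>C f"
    by transfer (simp add: scaleC_add_left)
  show scale: "c *\<^sub>C (d *\<^sub>C f) = (c * d) *\<^sub>C f" for c d and f :: "'a \<Rightarrow>\<^sub>L 'b"
    by transfer (simp add: scaleC_scaleC)
  show of_real: "of_real r *\<^sub>C f = r *\<^sub>R f" for r and f :: "'a \<Rightarrow>\<^sub>L 'b"
    by transfer (simp add: scaleC_of_real)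
  have le: "norm (c *\<^sub>C f) \<le> cmod c * norm f" for c and f :: "'a \<Rightarrow>\<^sub>L 'b"
  proof (rule norm_blinfun_bound)
    fix x
    have "cmod c * norm (blinfun_apply f x) \<le> cmod c * (norm f * norm x)"
      by (intro mult_left_mono norm_blinfun) simp
    then show "norm (blinfun_apply (c *\<^sub>C f) x) \<le> cmod c * norm f * norm x"
      by (simp add: scaleC_blinfun.rep_eq norm_scaleC mult.assoc)
  qed simp
  show "norm (c *\<^sub>C f) = cmod c * norm f"
  proof (cases "c = 0")
    case True
    then show ?thesis using of_real[of 0 f] by simp
  next
    case False
    have "f = inverse c *\<^sub>C (c *\<^sub>C f)"
      using False of_real[of 1 f] by (simp add: scale)
    then have "norm f \<le> cmod (inverse c) * norm (c *\<^sub>C f)"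
      using le[of "inverse c" "c *\<^sub>C f"] by simp
    then have "cmod c * norm f \<le> norm (c *\<^sub>C f)"
      using False by (simp add: norm_inverse norm_divide field_simps)
    then show ?thesis using le[of c f] by simp
  qed
qed

end


section \<open>Spectrum and Riesz projections of unbounded operators\<close>

text \<open>
  An unbounded operator is given by its domain \<open>D\<close> and a map \<open>A\<close>; the values of \<open>A\<close>
  outside \<open>D\<close> are irrelevant. The inverse of \<open>z - A\<close> is only required to be real-linear
  (the type of bounded operators), but it is automatically complex-linear when \<open>A\<close> is.
\<close>

definition is_resolvent ::
    "'a::complex_normed_vector set \<Rightarrow> ('a \<Rightarrow> 'a) \<Rightarrow> complex \<Rightarrow> ('a \<Rightarrow>\<^sub>L 'a) \<Rightarrow> bool" where
  "is_resolvent D A z R \<longleftrightarrow>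
     (\<forall>u. blinfun_apply R u \<in> D \<and> z *\<^sub>C blinfun_apply R u - A (blinfun_apply R u) = u) \<and>
     (\<forall>u\<in>D. blinfun_apply R (z *\<^sub>C u - A u) = u)"

lemma is_resolvent_unique:
  assumes "is_resolvent D A z R" and "is_resolvent D A z S"
  shows "R = S"
  using assms unfolding is_resolvent_def by (metis blinfun_eqI)

definition resolvent ::
    "'a::complex_normed_vector set \<Rightarrow> ('a \<Rightarrow> 'a) \<Rightarrow> complex \<Rightarrow> ('a \<Rightarrow>\<^sub>L 'a)" where
  "resolvent D A z = (THE R. is_resolvent D A z R)"

definition spectrum :: "'a::complex_normed_vector set \<Rightarrow> ('a \<Rightarrow> 'a) \<Rightarrow> complex set" where
  "spectrum D A = {z. \<nexists>R. is_resolvent D A z R}"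

text \<open>
  The library's contour integral is for complex-valued integrands only; this is its
  vector-valued counterpart.
\<close>

definition contour_integral_vec ::
    "(real \<Rightarrow> complex) \<Rightarrow> (complex \<Rightarrow> 'b::complex_normed_vector) \<Rightarrow> 'b" where
  "contour_integral_vec g F =
     integral {0..1} (\<lambda>t. vector_derivative g (at t within {0..1}) *\<^sub>C F (g t))"

text \<open>
  For an isolated point \<open>\<mu>\<close> of the spectrum, the circle is any one enclosing no other
  spectral point; the integral does not depend on its radius.
\<close>

definition riesz_projection ::
    "'a::complex_normed_vector set \<Rightarrow> ('a \<Rightarrow> 'a) \<Rightarrow> complex \<Rightarrow> ('a \<Rightarrow>\<^sub>L 'a)" where
  "riesz_projection D A \<mu> =
     (let r = (SOME r. 0 < r \<and> cball \<mu> r \<inter> spectrum D A \<subseteq> {\<mu>})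
      in (1 / (2 * of_real pi * \<i>)) *\<^sub>C contour_integral_vec (circlepath \<mu> r) (resolvent D A))"


section \<open>The Hilbert space \<open>L\<^sup>2(\<real>)\<close>\<close>

definition square_integrable :: "(real \<Rightarrow> complex) \<Rightarrow> bool" where
  "square_integrable f \<longleftrightarrow>
     f \<in> borel_measurable lborel \<and> integrable lborel (\<lambda>x. (cmod (f x))\<^sup>2)"

definition l2_eq :: "(real \<Rightarrow> complex) \<Rightarrow> (real \<Rightarrow> complex) \<Rightarrow> bool" where
  "l2_eq f g \<longleftrightarrow> square_integrable f \<and> square_integrable g \<and> (AE x in lborel. f x = g x)"

lemma square_integrable_zero: "square_integrable (\<lambda>_. 0)"
  by (simp add: square_integrable_def)

lemma square_integrable_add:
  assumes "square_integrable f" "square_integrable g"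
  shows "square_integrable (\<lambda>x. f x + g x)"
proof -
  have [measurable]: "f \<in> borel_measurable lborel" "g \<in> borel_measurable lborel"
    using assms by (auto simp: square_integrable_def)
  have "integrable lborel (\<lambda>x. 2 * (cmod (f x))\<^sup>2 + 2 * (cmod (g x))\<^sup>2)"
    using assms by (simp add: square_integrable_def)
  then have "integrable lborel (\<lambda>x. (cmod (f x + g x))\<^sup>2)"
  proof (rule Bochner_Integration.integrable_bound)
    have "(cmod (f x + g x))\<^sup>2 \<le> 2 * (cmod (f x))\<^sup>2 + 2 * (cmod (g x))\<^sup>2" for x
    proof -
      have "(cmod (f x + g x))\<^sup>2 \<le> (cmod (f x) + cmod (g x))\<^sup>2"
        by (intro power_mono norm_triangle_ineq) simp
      also have "\<dots> \<le> 2 * (cmod (f x))\<^sup>2 + 2 * (cmod (g x))\<^sup>2"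
        using zero_le_power2[of "cmod (f x) - cmod (g x)"]
        by (simp add: power2_eq_square algebra_simps)
      finally show ?thesis .
    qed
    then show "AE x in lborel. norm ((cmod (f x + g x))\<^sup>2)
        \<le> norm (2 * (cmod (f x))\<^sup>2 + 2 * (cmod (g x))\<^sup>2)"
      by simp
  qed simp
  then show ?thesis by (simp add: square_integrable_def)
qed

lemma square_integrable_cmult:
  "square_integrable f \<Longrightarrow> square_integrable (\<lambda>x. c * f x)"
  by (auto simp: square_integrable_def norm_mult power_mult_distrib
      intro!: borel_measurable_times)

lemma square_integrable_inner:
  assumes "square_integrable f" "square_integrable g"
  shows "integrable lborel (\<lambda>x. f x \<bullet> g x)"
proof -
  have [measurable]: "f \<in> borel_measurable lborel" "g \<in> borel_measurable lborel"
    using assms by (auto simp: square_integrable_def)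
  have "integrable lborel (\<lambda>x. (cmod (f x))\<^sup>2 + (cmod (g x))\<^sup>2)"
    using assms by (simp add: square_integrable_def)
  then show ?thesis
  proof (rule Bochner_Integration.integrable_bound)
    have "\<bar>f x \<bullet> g x\<bar> \<le> (cmod (f x))\<^sup>2 + (cmod (g x))\<^sup>2" for x
    proof -
      have "0 \<le> (cmod (f x))\<^sup>2 + (cmod (g x))\<^sup>2 - 2 * (cmod (f x) * cmod (g x))"
        using zero_le_power2[of "cmod (f x) - cmod (g x)"]
        by (simp add: power2_eq_square algebra_simps)
      moreover have "\<bar>f x \<bullet> g x\<bar> \<le> cmod (f x) * cmod (g x)"
        by (rule Cauchy_Schwarz_ineq2)
      moreover have "0 \<le> cmod (f x) * cmod (g x)" by simp
      ultimately show ?thesis by linarith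
    qed
    then show "AE x in lborel. norm (f x \<bullet> g x) \<le> norm ((cmod (f x))\<^sup>2 + (cmod (g x))\<^sup>2)"
      by simp
  qed simp
qed

quotient_type l2 = "real \<Rightarrow> complex" / partial: l2_eq
proof (rule part_equivpI)
  show "\<exists>f. l2_eq f f"
    using square_integrable_zero by (auto simp: l2_eq_def)
  show "symp l2_eq"
    by (rule sympI) (auto simp: l2_eq_def)
  show "transp l2_eq"
  proof (rule transpI)
    fix f g h assume "l2_eq f g" "l2_eq g h"
    moreover from this have "AE x in lborel. f x = g x" "AE x in lborel. g x = h x"
      by (simp_all add: l2_eq_def)
    then have "AE x in lborel. f x = h x"
      by eventually_elim simp
    ultimately show "l2_eq f h"
      by (simp add: l2_eq_def)
  qed
qed

instantiation l2 :: real_inner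
begin

lift_definition zero_l2 :: l2 is "\<lambda>_. 0"
  by (simp add: l2_eq_def square_integrable_zero)

lift_definition plus_l2 :: "l2 \<Rightarrow> l2 \<Rightarrow> l2" is "\<lambda>f g x. f x + g x"
  by (auto simp: l2_eq_def square_integrable_add)

lift_definition uminus_l2 :: "l2 \<Rightarrow> l2" is "\<lambda>f x. - f x"
  using square_integrable_cmult[of _ "-1"] by (auto simp: l2_eq_def)

definition minus_l2 :: "l2 \<Rightarrow> l2 \<Rightarrow> l2" where "minus_l2 f g = f + (- g)"

lift_definition scaleR_l2 :: "real \<Rightarrow> l2 \<Rightarrow> l2" is "\<lambda>r f x. complex_of_real r * f x"
  by (auto simp: l2_eq_def square_integrable_cmult)

text \<open>
  For complex numbers \<open>a \<bullet> b = Re (cnj a * b)\<close>, so this is the real part of the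
  usual inner product and induces the usual norm.
\<close>

lift_definition inner_l2 :: "l2 \<Rightarrow> l2 \<Rightarrow> real" is "\<lambda>f g. \<integral>x. f x \<bullet> g x \<partial>lborel"
proof -
  fix f f' g g' assume "l2_eq f f'" "l2_eq g g'"
  then have [measurable]: "f \<in> borel_measurable lborel" "g \<in> borel_measurable lborel"
      "f' \<in> borel_measurable lborel" "g' \<in> borel_measurable lborel"
    and ae: "AE x in lborel. f x = f' x" "AE x in lborel. g x = g' x"
    by (auto simp: l2_eq_def square_integrable_def)
  show "(\<integral>x. f x \<bullet> g x \<partial>lborel) = (\<integral>x. f' x \<bullet> g' x \<partial>lborel)"
    by (rule integral_cong_AE) (use ae in auto)
qed

definition norm_l2 :: "l2 \<Rightarrow> real" where "norm_l2 f = sqrt (f \<bullet> f)"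
definition sgn_l2 :: "l2 \<Rightarrow> l2" where "sgn_l2 f = inverse (norm f) *\<^sub>R f"
definition dist_l2 :: "l2 \<Rightarrow> l2 \<Rightarrow> real" where "dist_l2 f g = norm (f - g)"
definition uniformity_l2 :: "(l2 \<times> l2) filter"
  where "uniformity_l2 = (INF e\<in>{0<..}. principal {(f, g). dist f g < e})"
definition open_l2 :: "l2 set \<Rightarrow> bool"
  where "open_l2 U = (\<forall>f\<in>U. eventually (\<lambda>(f', g). f' = f \<longrightarrow> g \<in> U) uniformity)"

instance
proof
  fix f g h :: l2 and r s :: real and U :: "l2 set"
  show "f + g + h = f + (g + h)"
    by transfer (auto simp: l2_eq_def add.assoc intro!: square_integrable_add)
  show "f + g = g + f"
    by transfer (auto simp: l2_eq_def add.commute intro!: square_integrable_add)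
  show "0 + f = f"
    by transfer (auto simp: l2_eq_def)
  show "- f + f = 0"
    by transfer (auto simp: l2_eq_def square_integrable_zero)
  show "f - g = f + - g"
    by (rule minus_l2_def)
  show "r *\<^sub>R (f + g) = r *\<^sub>R f + r *\<^sub>R g"
    by transfer (auto simp: l2_eq_def distrib_left
        intro!: square_integrable_add square_integrable_cmult)
  show "(r + s) *\<^sub>R f = r *\<^sub>R f + s *\<^sub>R f"
    by transfer (auto simp: l2_eq_def distrib_right
        intro!: square_integrable_add square_integrable_cmult)
  show "r *\<^sub>R s *\<^sub>R f = (r * s) *\<^sub>R f"
    by transfer (auto simp: l2_eq_def mult.assoc intro!: square_integrable_cmult)
  show "1 *\<^sub>R f = f"
    by transfer (auto simp: l2_eq_def)
  show "dist f g = norm (f - g)"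
    by (rule dist_l2_def)
  show "sgn f = inverse (norm f) *\<^sub>R f"
    by (rule sgn_l2_def)
  show "uniformity = (INF e\<in>{0<..}. principal {(f :: l2, g). dist f g < e})"
    by (rule uniformity_l2_def)
  show "open U = (\<forall>f\<in>U. eventually (\<lambda>(f', g). f' = f \<longrightarrow> g \<in> U) uniformity)"
    by (rule open_l2_def)
  show "f \<bullet> g = g \<bullet> f"
    by transfer (simp add: inner_commute)
  show "(f + g) \<bullet> h = f \<bullet> h + g \<bullet> h"
    by transfer
      (auto simp: l2_eq_def inner_add_left square_integrable_inner Bochner_Integration.integral_add)
  show "(r *\<^sub>R f) \<bullet> g = r * (f \<bullet> g)"
    by transfer (simp add: scaleR_conv_of_real[symmetric])
  show "0 \<le> f \<bullet> f"
    by transfer simp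
  show "f \<bullet> f = 0 \<longleftrightarrow> f = 0"
  proof transfer
    fix f assume "l2_eq f f"
    then have sq: "square_integrable f" by (simp add: l2_eq_def)
    have "(\<integral>x. f x \<bullet> f x \<partial>lborel) = 0 \<longleftrightarrow> (AE x in lborel. f x \<bullet> f x = 0)"
      by (rule integral_nonneg_eq_0_iff_AE) (use sq square_integrable_inner in auto)
    then show "(\<integral>x. f x \<bullet> f x \<partial>lborel) = 0 \<longleftrightarrow> l2_eq f (\<lambda>_. 0)"
      using sq by (simp add: l2_eq_def square_integrable_zero)
  qed
  show "norm f = sqrt (f \<bullet> f)"
    by (rule norm_l2_def)
qed

end

instantiation l2 :: complex_normed_vector
begin

lift_definition scaleC_l2 :: "complex \<Rightarrow> l2 \<Rightarrow> l2" is "\<lambda>c f x. c * f x"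
  by (auto simp: l2_eq_def square_integrable_cmult)

instance
proof
  fix c d :: complex and r :: real and f g :: l2
  show "c *\<^sub>C (f + g) = c *\<^sub>C f + c *\<^sub>C g"
    by transfer (auto simp: l2_eq_def distrib_left
        intro!: square_integrable_add square_integrable_cmult)
  show "(c + d) *\<^sub>C f = c *\<^sub>C f + d *\<^sub>C f"
    by transfer (auto simp: l2_eq_def distrib_right
        intro!: square_integrable_add square_integrable_cmult)
  show "c *\<^sub>C (d *\<^sub>C f) = (c * d) *\<^sub>C f"
    by transfer (auto simp: l2_eq_def mult.assoc intro!: square_integrable_cmult)
  show "of_real r *\<^sub>C f = r *\<^sub>R f"
    by transfer (auto simp: l2_eq_def intro!: square_integrable_cmult)
  have "(c *\<^sub>C f) \<bullet> (c *\<^sub>C f) = (cmod c)\<^sup>2 * (f \<bullet> f)"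
    by transfer (simp add: power2_norm_eq_inner[symmetric] norm_mult power_mult_distrib)
  then show "norm (c *\<^sub>C f) = cmod c * norm f"
    by (simp add: norm_l2_def real_sqrt_mult)
qed

end


section \<open>The space \<open>H\<^sup>1(\<real>) \<inter> L\<^sup>2(\<real>, x\<^sup>2 dx)\<close>\<close>

text \<open>
  Real-valued test functions suffice: the complex ones are their complex linear combinations.
\<close>

definition test_function :: "(real \<Rightarrow> real) \<Rightarrow> bool" where
  "test_function \<phi> \<longleftrightarrow>
     (\<forall>k x. ((deriv ^^ k) \<phi>) differentiable (at x)) \<and> (\<exists>b. \<forall>x. b < \<bar>x\<bar> \<longrightarrow> \<phi> x = 0)"

lemma test_function_measurable:
  assumes "test_function \<phi>"
  shows "\<phi> \<in> borel_measurable lborel" "deriv \<phi> \<in> borel_measurable lborel"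
proof -
  have "((deriv ^^ k) \<phi>) \<in> borel_measurable borel" for k
    using assms unfolding test_function_def
    by (intro borel_measurable_continuous_onI continuous_at_imp_continuous_on)
      (auto intro: differentiable_imp_continuous_within)
  from this[of 0] this[of 1]
  show "\<phi> \<in> borel_measurable lborel" "deriv \<phi> \<in> borel_measurable lborel" by simp_all
qed

lift_definition has_weak_derivative :: "l2 \<Rightarrow> l2 \<Rightarrow> bool"  (infix \<open>has'_weak'_derivative\<close> 50)
  is "\<lambda>f g. \<forall>\<phi>. test_function \<phi> \<longrightarrow>
    (\<integral>x. deriv \<phi> x *\<^sub>R f x \<partial>lborel) = - (\<integral>x. \<phi> x *\<^sub>R g x \<partial>lborel)"
proof -
  have cong: "(\<integral>x. u x *\<^sub>R f x \<partial>lborel) = (\<integral>x. u x *\<^sub>R f' x \<partial>lborel)"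
    if "l2_eq f f'" and [measurable]: "u \<in> borel_measurable lborel"
    for f f' and u :: "real \<Rightarrow> real"
  proof -
    have [measurable]: "f \<in> borel_measurable lborel" "f' \<in> borel_measurable lborel"
      and "AE x in lborel. f x = f' x"
      using that by (auto simp: l2_eq_def square_integrable_def)
    then show ?thesis by (intro integral_cong_AE) auto
  qed
  fix f f' g g' assume eq: "l2_eq f f'" "l2_eq g g'"
  show "(\<forall>\<phi>. test_function \<phi> \<longrightarrow>
        (\<integral>x. deriv \<phi> x *\<^sub>R f x \<partial>lborel) = - (\<integral>x. \<phi> x *\<^sub>R g x \<partial>lborel)) \<longleftrightarrow>
      (\<forall>\<phi>. test_function \<phi> \<longrightarrow>
        (\<integral>x. deriv \<phi> x *\<^sub>R f' x \<partial>lborel) = - (\<integral>x. \<phi> x *\<^sub>R g' x \<partial>lborel))"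
    by (intro iff_allI imp_cong refl)
      (simp only: cong[OF eq(1) test_function_measurable(2)]
        cong[OF eq(2) test_function_measurable(1)])
qed

definition sobolev_H1 :: "l2 set" where
  "sobolev_H1 = {f. \<exists>g. f has_weak_derivative g}"

definition weak_derivative :: "l2 \<Rightarrow> l2" where
  "weak_derivative f = (THE g. f has_weak_derivative g)"

lift_definition in_weighted_l2 :: "l2 \<Rightarrow> bool"
  is "\<lambda>f. integrable lborel (\<lambda>x. x\<^sup>2 * (cmod (f x))\<^sup>2)"
proof -
  fix f g assume "l2_eq f g"
  then have [measurable]: "f \<in> borel_measurable lborel" "g \<in> borel_measurable lborel"
    and "AE x in lborel. f x = g x"
    by (auto simp: l2_eq_def square_integrable_def)
  then show "integrable lborel (\<lambda>x. x\<^sup>2 * (cmod (f x))\<^sup>2) \<longleftrightarrow>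
      integrable lborel (\<lambda>x. x\<^sup>2 * (cmod (g x))\<^sup>2)"
    by (intro integrable_cong_AE) auto
qed

lift_definition multiply_by_x :: "l2 \<Rightarrow> l2"
  is "\<lambda>f. if integrable lborel (\<lambda>x. x\<^sup>2 * (cmod (f x))\<^sup>2) then (\<lambda>x. of_real x * f x) else (\<lambda>_. 0)"
proof -
  fix f g assume "l2_eq f g"
  then have [measurable]: "f \<in> borel_measurable lborel" "g \<in> borel_measurable lborel"
    and ae: "AE x in lborel. f x = g x"
    by (auto simp: l2_eq_def square_integrable_def)
  then have iff: "integrable lborel (\<lambda>x. x\<^sup>2 * (cmod (f x))\<^sup>2) \<longleftrightarrow>
      integrable lborel (\<lambda>x. x\<^sup>2 * (cmod (g x))\<^sup>2)"
    by (intro integrable_cong_AE) auto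
  show "l2_eq
      (if integrable lborel (\<lambda>x. x\<^sup>2 * (cmod (f x))\<^sup>2) then (\<lambda>x. of_real x * f x) else (\<lambda>_. 0))
      (if integrable lborel (\<lambda>x. x\<^sup>2 * (cmod (g x))\<^sup>2) then (\<lambda>x. of_real x * g x) else (\<lambda>_. 0))"
  proof (cases "integrable lborel (\<lambda>x. x\<^sup>2 * (cmod (f x))\<^sup>2)")
    case True
    moreover from this have "integrable lborel (\<lambda>x. x\<^sup>2 * (cmod (g x))\<^sup>2)"
      by (rule iff[THEN iffD1])
    moreover have "AE x in lborel. of_real x * f x = of_real x * g x"
      using ae by eventually_elim simp
    ultimately show ?thesis
      by (simp add: l2_eq_def square_integrable_def norm_mult power_mult_distrib)
  next
    case False
    moreover from this have "\<not> integrable lborel (\<lambda>x. x\<^sup>2 * (cmod (g x))\<^sup>2)"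
      by (simp only: iff not_False_eq_True)
    ultimately show ?thesis
      by (simp add: l2_eq_def square_integrable_zero)
  qed
qed

definition domain_D :: "l2 set" where
  "domain_D = sobolev_H1 \<inter> {f. in_weighted_l2 f}"


section \<open>The operator\<close>

definition pauli1 :: "complex ^ 2 ^ 2" where
  "pauli1 = vector [vector [0, 1], vector [1, 0]]"

definition pauli2 :: "complex ^ 2 ^ 2" where
  "pauli2 = vector [vector [0, - \<i>], vector [\<i>, 0]]"

definition pauli3 :: "complex ^ 2 ^ 2" where
  "pauli3 = vector [vector [1, 0], vector [0, - 1]]"

definition off_diagonal_blocks :: "complex ^ 2 ^ 2 \<Rightarrow> complex ^ 4 ^ 4" where
  "off_diagonal_blocks S = vector
     [vector [0, 0, S $ 1 $ 1, S $ 1 $ 2],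
      vector [0, 0, S $ 2 $ 1, S $ 2 $ 2],
      vector [S $ 1 $ 1, S $ 1 $ 2, 0, 0],
      vector [S $ 2 $ 1, S $ 2 $ 2, 0, 0]]"

definition "dirac_alpha1 = off_diagonal_blocks pauli1"
definition "dirac_alpha2 = off_diagonal_blocks pauli2"
definition "dirac_alpha3 = off_diagonal_blocks pauli3"

definition matrix_apply :: "complex ^ 4 ^ 4 \<Rightarrow> l2 ^ 4 \<Rightarrow> l2 ^ 4" where
  "matrix_apply M \<psi> = (\<chi> i. \<Sum>j\<in>UNIV. (M $ i $ j) *\<^sub>C (\<psi> $ j))"

text \<open>
  The library's norm on \<^typ>\<open>l2 ^ 4\<close> is the Euclidean combination of the component norms,
  so this type is the Hilbert space \<open>L\<^sup>2(\<real>)\<^sup>4\<close>.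
\<close>

definition H_domain :: "(l2 ^ 4) set" where
  "H_domain = {\<psi>. \<forall>i. \<psi> $ i \<in> domain_D}"

definition H_op :: "real \<Rightarrow> real \<Rightarrow> l2 ^ 4 \<Rightarrow> l2 ^ 4" where
  "H_op m \<theta> \<psi> =
     (- \<i> * exp (- (\<i> * of_real \<theta> / 2))) *\<^sub>C
       matrix_apply dirac_alpha1 (\<chi> j. weak_derivative (\<psi> $ j))
     - exp (\<i> * of_real \<theta> / 2) *\<^sub>C
       matrix_apply dirac_alpha2 (\<chi> j. multiply_by_x (\<psi> $ j))
     + of_real m *\<^sub>C matrix_apply dirac_alpha3 \<psi>"

text \<open>
  The sign \<open>s\<close> is \<open>1\<close> or \<open>-1\<close>.
\<close>

definition H_eigenvalue :: "real \<Rightarrow> real \<Rightarrow> nat \<Rightarrow> complex" where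
  "H_eigenvalue m s n = of_real (s * sqrt (2 * real n + m\<^sup>2))"

definition spectral_projector :: "real \<Rightarrow> real \<Rightarrow> real \<Rightarrow> nat \<Rightarrow> (l2 ^ 4) \<Rightarrow>\<^sub>L (l2 ^ 4)" where
  "spectral_projector m \<theta> s n = riesz_projection H_domain (H_op m \<theta>) (H_eigenvalue m s n)"

end

theory Submission
  imports Defs "HOL-Probability.Distributions" "HOL-Complex_Analysis.Conformal_Mappings"
    "HOL-Real_Asymp.Real_Asymp"
begin

text \<open>
  With \<open>a = e\<^bsup>i\<theta>/2\<^esup> x + e\<^bsup>-i\<theta>/2\<^esup> \<partial>\<close> and \<open>b = e\<^bsup>i\<theta>/2\<^esup> x - e\<^bsup>-i\<theta>/2\<^esup> \<partial>\<close> one has \<open>a b - b a = 2\<close>, and the square of the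
  Dirac operator is the diagonal matrix \<open>m\<^sup>2 + diag (b a, a b, b a, a b)\<close>. The eigenvectors of \<open>b a\<close> are
  \<open>\<phi>\<^sub>n = b\<^sup>n \<phi>\<^sub>0\<close> with \<open>\<phi>\<^sub>0 = exp (- e\<^bsup>i\<theta>\<^esup> x\<^sup>2 / 2)\<close>, and its spectral projections are
  \<open>f \<mapsto> (\<integral> \<phi>\<^sub>n f / \<integral> \<phi>\<^sub>n\<^sup>2) \<phi>\<^sub>n\<close>, of norm \<open>q\<^sub>n = \<parallel>\<phi>\<^sub>n\<parallel>\<^sup>2 / \<bar>\<integral> \<phi>\<^sub>n\<^sup>2\<bar>\<close>; up to factors polynomial in \<open>n\<close>,
  the projections of the Dirac operator have the same norm. Explicit integral operators invert \<open>a\<close> on the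
  right and \<open>b\<close> on the left; they yield a reduced resolvent at each eigenvalue by a ladder recursion,
  hence the resolvent near the eigenvalue by a Neumann series, and the Riesz integral is evaluated by
  Cauchy's formula. Finally, the Hilbert space adjoint of \<open>a\<close> is \<open>cos \<theta> b - i sin \<theta> a\<close>, so the inner
  products of the \<open>\<phi>\<^sub>n\<close> satisfy a positive linear recursion whose dominant eigenvalue is
  \<open>(1 + \<bar>sin \<theta>\<bar>) / cos \<theta>\<close>.
\<close>

section \<open>Test functions and the fundamental lemma of the calculus of variations\<close>

text \<open>Two obstacles shape the argument. For \<theta> \<noteq> 0 the eigenvectors are not
  orthogonal, so the complex bilinear form \<open>bil\<close> takes over the role of the inner
  product, and each injectivity statement is drawn from the solvability of a transposed equation.
  Vectors of the domain carry only one derivative and one power of x, so the commutation relation is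
  stated as an identity of forms and becomes an identity of vectors only after a regularity argument
  by duality. The work stays local at one eigenvalue: a projection and a reduced resolvent for the
  square of the operator exhibit a simple pole of the resolvent, and the radius of the contour is
  absorbed by a removable singularity. The rate comes from the inner products with index pairs (n,
  n) and (n, n + 2), which form a closed system. Once a factor i sin \<theta> is removed, its
  coefficients are nonnegative, and its limit matrix has rows (1, 1) and (sin^2 \<theta>, 1),
  divided by cos \<theta>; the eigenvalues are (1 \<plusminus> |sin \<theta>|) / cos \<theta>. Since
  cos^2 \<theta> = (1 - |sin \<theta>|) (1 + |sin \<theta>|), the larger one is the stated square
  root.\<close>

definition smooth :: "(real \<Rightarrow> real) \<Rightarrow> bool" where
  "smooth f \<longleftrightarrow> (\<forall>k x. ((deriv ^^ k) f) differentiable (at x))"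

text \<open>A coinduction principle: \<open>P\<close> is an invariant that survives differentiation.
  Each smoothness proof below amounts to finding a class of functions closed under
  \<open>deriv\<close>.\<close>

lemma smoothI:
  assumes "P f" and "\<And>f. P f \<Longrightarrow> (\<forall>x. f differentiable (at x)) \<and> P (deriv f)"
  shows "smooth f"
proof -
  have "P ((deriv ^^ k) f)" for k by (induction k) (use assms in auto)
  then show ?thesis unfolding smooth_def using assms(2) by blast
qed

lemma smooth_differentiable: "smooth f \<Longrightarrow> f differentiable (at x)"
  unfolding smooth_def by (metis funpow_0)

lemma smooth_deriv: "smooth f \<Longrightarrow> smooth (deriv f)"
  unfolding smooth_def by (metis comp_apply funpow_Suc_right)

lemma smooth_has_derivative: "smooth f \<Longrightarrow> (f has_real_derivative deriv f x) (at x)"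
  using smooth_differentiable[of f x] by (simp add: DERIV_deriv_iff_real_differentiable)

lemma smooth_continuous: "smooth f \<Longrightarrow> continuous_on A f"
  by (meson smooth_differentiable continuous_at_imp_continuous_on differentiable_imp_continuous_within)

lemma smooth_antiderivative:
  assumes "\<And>x. (f has_real_derivative g x) (at x)" and "smooth g"
  shows "smooth f"
  unfolding smooth_def
proof (intro allI)
  fix k x
  have "deriv f = g" using assms(1) by (intro ext DERIV_imp_deriv)
  then show "((deriv ^^ k) f) differentiable (at x)"
    using assms unfolding smooth_def
    by (cases k) (auto simp: funpow_Suc_right real_differentiable_def simp del: funpow.simps)
qed

text \<open>Products alone are not closed under differentiation; their finite sums are, by the
  Leibniz rule. This is the invariant for \<open>smooth_mult\<close>.\<close>

inductive sum_of_smooth_products :: "(real \<Rightarrow> real) \<Rightarrow> bool" where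
  prod: "smooth f \<Longrightarrow> smooth g \<Longrightarrow> sum_of_smooth_products (\<lambda>x. f x * g x)"
| add: "sum_of_smooth_products u \<Longrightarrow> sum_of_smooth_products v \<Longrightarrow> sum_of_smooth_products (\<lambda>x. u x + v x)"

lemma smooth_mult:
  assumes "smooth f" "smooth g"
  shows "smooth (\<lambda>x. f x * g x)"
proof (rule smoothI[where P = sum_of_smooth_products])
  show "sum_of_smooth_products (\<lambda>x. f x * g x)" using assms by (rule prod)
  fix u assume "sum_of_smooth_products u"
  then have "\<exists>u'. (\<forall>x. (u has_real_derivative u' x) (at x)) \<and> sum_of_smooth_products u'"
  proof induction
    case (prod f g)
    have "sum_of_smooth_products (\<lambda>x. f x * deriv g x + deriv f x * g x)"
      using prod by (intro sum_of_smooth_products.intros smooth_deriv)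
    moreover have "\<forall>x. ((\<lambda>x. f x * g x) has_real_derivative (f x * deriv g x + deriv f x * g x)) (at x)"
      using prod by (auto intro!: derivative_eq_intros smooth_has_derivative simp: algebra_simps)
    ultimately show ?case by (intro exI[of _ "\<lambda>x. f x * deriv g x + deriv f x * g x"]) blast
  next
    case (add u v)
    then obtain u' v' where
      "\<forall>x. (u has_real_derivative u' x) (at x)" "sum_of_smooth_products u'"
      "\<forall>x. (v has_real_derivative v' x) (at x)" "sum_of_smooth_products v'" by blast
    then show ?case
      by (intro exI[of _ "\<lambda>x. u' x + v' x"]) (auto intro!: sum_of_smooth_products.intros derivative_intros)
  qed
  then obtain u' where u': "\<And>x. (u has_real_derivative u' x) (at x)" "sum_of_smooth_products u'" by blast
  moreover from this have "deriv u = u'" by (intro ext DERIV_imp_deriv)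
  ultimately show "(\<forall>x. u differentiable (at x)) \<and> sum_of_smooth_products (deriv u)"
    by (auto simp: real_differentiable_def)
qed

lemma smooth_affine:
  assumes "smooth f"
  shows "smooth (\<lambda>x. f (\<alpha> * x + \<beta>))"
\<comment> \<open>The constant \<open>c\<close> collects the powers of \<alpha> that the chain rule
  produces.\<close>
proof (rule smoothI[where P = "\<lambda>h. \<exists>f c. smooth f \<and> h = (\<lambda>x. c * f (\<alpha> * x + \<beta>))"])
  show "\<exists>g c. smooth g \<and> (\<lambda>x. f (\<alpha> * x + \<beta>)) = (\<lambda>x. c * g (\<alpha> * x + \<beta>))"
    using assms by (intro exI[of _ f] exI[of _ 1]) auto
  fix h assume "\<exists>f c. smooth f \<and> h = (\<lambda>x. c * f (\<alpha> * x + \<beta>))"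
  then obtain f c where f: "smooth f" "h = (\<lambda>x. c * f (\<alpha> * x + \<beta>))" by blast
  have d: "(h has_real_derivative (c * \<alpha>) * deriv f (\<alpha> * x + \<beta>)) (at x)" for x
  proof -
    have "((\<lambda>x. f (\<alpha> * x + \<beta>)) has_real_derivative deriv f (\<alpha> * x + \<beta>) * \<alpha>) (at x)"
      by (rule DERIV_chain2[OF smooth_has_derivative[OF f(1)]]) (auto intro!: derivative_eq_intros)
    then show ?thesis unfolding f(2) by (auto intro!: derivative_eq_intros)
  qed
  then have "deriv h = (\<lambda>x. (c * \<alpha>) * deriv f (\<alpha> * x + \<beta>))" by (intro ext DERIV_imp_deriv)
  with d f(1) show "(\<forall>x. h differentiable (at x)) \<and>
      (\<exists>f c. smooth f \<and> deriv h = (\<lambda>x. c * f (\<alpha> * x + \<beta>)))"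
    using smooth_deriv real_differentiable_def by blast
qed

lemma smooth_linear_combination:
  assumes "smooth f" "smooth g"
  shows "smooth (\<lambda>x. f x + c * g x)"
proof (rule smoothI[where P = "\<lambda>h. \<exists>f g. smooth f \<and> smooth g \<and> h = (\<lambda>x. f x + c * g x)"])
  show "\<exists>f' g'. smooth f' \<and> smooth g' \<and> (\<lambda>x. f x + c * g x) = (\<lambda>x. f' x + c * g' x)"
    using assms by blast
  fix h assume "\<exists>f g. smooth f \<and> smooth g \<and> h = (\<lambda>x. f x + c * g x)"
  then obtain f g where f: "smooth f" "smooth g" "h = (\<lambda>x. f x + c * g x)" by blast
  have d: "(h has_real_derivative deriv f x + c * deriv g x) (at x)" for x
    unfolding f(3) using f by (auto intro!: derivative_eq_intros smooth_has_derivative)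
  then have "deriv h = (\<lambda>x. deriv f x + c * deriv g x)" by (intro ext DERIV_imp_deriv)
  with d f show "(\<forall>x. h differentiable (at x)) \<and>
      (\<exists>f g. smooth f \<and> smooth g \<and> deriv h = (\<lambda>x. f x + c * g x))"
    using smooth_deriv real_differentiable_def by blast
qed

section \<open>Smooth bump functions approximating indicators of intervals\<close>

definition flat :: "real \<Rightarrow> real" where
  "flat x = (if 0 < x then exp (- 1 / x) else 0)"

text \<open>The free power \<open>t ^ k\<close> absorbs the shift by one degree in each
  \<open>pCons\<close> step of the induction.\<close>

lemma poly_div_exp_tendsto_0: "((\<lambda>t::real. t ^ k * poly p t / exp t) \<longlongrightarrow> 0) at_top"
proof (induction p arbitrary: k)
  case (pCons a p)
  have "((\<lambda>t. a * (t ^ k / exp t) + t ^ Suc k * poly p t / exp t) \<longlongrightarrow> a * 0 + 0) at_top"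
    by (intro tendsto_intros tendsto_power_div_exp_0 pCons)
  then show ?case by (simp add: field_simps)
qed simp

lemma smooth_flat: "smooth flat"
proof (rule smoothI[where P = "\<lambda>h. \<exists>p. h = (\<lambda>x. if 0 < x then poly p (1 / x) * exp (- 1 / x) else 0)"])
  show "\<exists>p. flat = (\<lambda>x. if 0 < x then poly p (1 / x) * exp (- 1 / x) else 0)"
    by (intro exI[of _ 1]) (auto simp: flat_def)
  fix h :: "real \<Rightarrow> real"
  assume "\<exists>p. h = (\<lambda>x. if 0 < x then poly p (1 / x) * exp (- 1 / x) else 0)"
  then obtain p where h: "h = (\<lambda>x. if 0 < x then poly p (1 / x) * exp (- 1 / x) else 0)" by blast
  \<comment> \<open>With t = 1/x, the derivative of p(t) exp(-t) with respect to x is t^2 (p(t) -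
    p'(t)) exp(-t).\<close>
  define q where "q = [:0, 0, 1:] * (p - pderiv p)"
  have d: "(h has_real_derivative (if 0 < x then poly q (1 / x) * exp (- 1 / x) else 0)) (at x)" for x
  proof (cases x "0::real" rule: linorder_cases)
    case less
    have "((\<lambda>_. 0) has_real_derivative 0) (at x)" by simp
    then have "(h has_real_derivative 0) (at x)"
      by (rule has_field_derivative_transform_within_open[where S = "{..<0}"]) (use less h in auto)
    then show ?thesis using less by simp
  next
    case greater
    have "((\<lambda>x. poly p (1 / x) * exp (- 1 / x)) has_real_derivative
        (poly (pderiv p) (1 / x) * (- 1 / (x * x))) * exp (- 1 / x)
        + poly p (1 / x) * (exp (- 1 / x) * (1 / (x * x)))) (at x)"
      using greater by (auto intro!: derivative_eq_intros simp: field_simps)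
    also have "(poly (pderiv p) (1 / x) * (- 1 / (x * x))) * exp (- 1 / x)
        + poly p (1 / x) * (exp (- 1 / x) * (1 / (x * x))) = poly q (1 / x) * exp (- 1 / x)"
      using greater by (simp add: q_def field_simps)
    finally have "(h has_real_derivative poly q (1 / x) * exp (- 1 / x)) (at x)"
      by (rule has_field_derivative_transform_within_open[where S = "{0<..}"]) (use greater h in auto)
    then show ?thesis using greater by simp
  next
    case equal
    have "((\<lambda>y. h y / y) \<longlongrightarrow> 0) (at_left 0)"
      by (rule tendsto_eventually) (auto simp: h eventually_at_left_field intro!: exI[of _ "-1"])
    moreover have "((\<lambda>y. h y / y) \<longlongrightarrow> 0) (at_right 0)"
    proof -
      \<comment> \<open>Under t = 1/y the difference quotient h(y)/y at 0 becomes t p(t) / exp(t),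
        which tends to 0.\<close>
      have "((\<lambda>t. t ^ 1 * poly p t / exp t) \<longlongrightarrow> 0) at_top"
        by (rule poly_div_exp_tendsto_0)
      then have "((\<lambda>y. (inverse y) ^ 1 * poly p (inverse y) / exp (inverse y)) \<longlongrightarrow> 0) (at_right 0)"
        by (rule filterlim_compose[OF _ filterlim_inverse_at_top_right])
      then show ?thesis
        by (rule tendsto_cong[THEN iffD1, rotated])
          (auto simp: h eventually_at_right_field exp_minus field_simps intro!: exI[of _ 1])
    qed
    ultimately have "((\<lambda>y. h y / y) \<longlongrightarrow> 0) (at 0)"
      by (rule filterlim_split_at)
    then have "(h has_real_derivative 0) (at 0)"
      by (simp add: has_field_derivative_iff h)
    then show ?thesis using equal by simp
  qed
  then have "deriv h = (\<lambda>x. if 0 < x then poly q (1 / x) * exp (- 1 / x) else 0)"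
    by (intro ext DERIV_imp_deriv)
  with d show "(\<forall>x. h differentiable (at x)) \<and>
      (\<exists>p. deriv h = (\<lambda>x. if 0 < x then poly p (1 / x) * exp (- 1 / x) else 0))"
    using real_differentiable_def by blast
qed

text \<open>The parameter \<open>k\<close> steepens the flanks: for k \<rightarrow> \<infinity> both
  factors tend to 1 inside (a, b), while the support stays in [a, b].\<close>

definition bump :: "real \<Rightarrow> real \<Rightarrow> real \<Rightarrow> real \<Rightarrow> real" where
  "bump k a b x = flat (k * (x - a)) * flat (k * (b - x))"

lemma test_function_bump: "0 < k \<Longrightarrow> test_function (bump k a b)"
proof -
  assume "0 < k"
  have "smooth (\<lambda>x. flat (k * x + (- k * a)) * flat ((- k) * x + k * b))"
    by (intro smooth_mult smooth_affine smooth_flat)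
  moreover have "bump k a b = (\<lambda>x. flat (k * x + (- k * a)) * flat ((- k) * x + k * b))"
    by (auto simp: bump_def algebra_simps)
  moreover have "\<forall>x. \<bar>a\<bar> + \<bar>b\<bar> < \<bar>x\<bar> \<longrightarrow> bump k a b x = 0"
    using \<open>0 < k\<close> by (auto simp: bump_def flat_def zero_less_mult_iff)
  ultimately show ?thesis unfolding test_function_def smooth_def by metis
qed

lemma bump_nonneg: "0 \<le> bump k a b x"
  by (simp add: bump_def flat_def)

lemma bump_le_indicator: "0 < k \<Longrightarrow> bump k a b x \<le> indicator {a<..<b} x"
  by (auto simp: bump_def flat_def indicator_def zero_less_mult_iff mult_le_one)

lemma bump_tendsto: "(\<lambda>n. bump (real (Suc n)) a b x) \<longlonglongrightarrow> indicator {a<..<b} x"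
proof (cases "a < x \<and> x < b")
  case True
  have "(\<lambda>n. exp (- (1 / (x - a)) * (1 / real (Suc n))) * exp (- (1 / (b - x)) * (1 / real (Suc n))))
      \<longlonglongrightarrow> exp (- (1 / (x - a)) * 0) * exp (- (1 / (b - x)) * 0)"
    by (intro tendsto_intros LIMSEQ_Suc[OF lim_1_over_n])
  moreover have "bump (real (Suc n)) a b x =
      exp (- (1 / (x - a)) * (1 / real (Suc n))) * exp (- (1 / (b - x)) * (1 / real (Suc n)))" for n
  proof -
    have "0 < real (Suc n) * (x - a)" "0 < real (Suc n) * (b - x)" using True by simp_all
    then show ?thesis by (simp add: bump_def flat_def mult.commute)
  qed
  ultimately show ?thesis using True by simp
next
  case False
  then have "bump (real (Suc n)) a b x = 0" for n
    by (auto simp: bump_def flat_def zero_less_mult_iff)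
  moreover have "indicator {a<..<b} x = (0::real)" using False by auto
  ultimately show ?thesis by simp
qed

lemma test_function_smooth: "test_function \<phi> \<longleftrightarrow> smooth \<phi> \<and> (\<exists>b. \<forall>x. b < \<bar>x\<bar> \<longrightarrow> \<phi> x = 0)"
  by (simp add: test_function_def smooth_def)

lemma test_function_bounded:
  assumes "test_function \<phi>"
  obtains K b where "0 < b" "\<And>x. \<bar>\<phi> x\<bar> \<le> K * indicator {- b..b} x"
proof -
  obtain b0 where b0: "\<And>x. b0 < \<bar>x\<bar> \<Longrightarrow> \<phi> x = 0" and s: "smooth \<phi>"
    using assms by (auto simp: test_function_smooth)
  define b where "b = max b0 1"
  have "bounded (\<phi> ` {- b..b})"
    by (intro compact_imp_bounded compact_continuous_image smooth_continuous s) simp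
  then obtain K where K: "\<And>x. x \<in> {- b..b} \<Longrightarrow> \<bar>\<phi> x\<bar> \<le> K"
    unfolding bounded_iff by (metis image_eqI real_norm_def)
  show thesis
  proof (rule that[of b K])
    show "0 < b" by (simp add: b_def)
    show "\<bar>\<phi> x\<bar> \<le> K * indicator {- b..b} x" for x
      using K[of x] b0[of x] by (auto simp: indicator_def b_def)
  qed
qed

section \<open>Locally integrable functions that vanish against test functions\<close>

definition locally_integrable :: "(real \<Rightarrow> complex) \<Rightarrow> bool" where
  "locally_integrable h \<longleftrightarrow> (\<forall>a b. set_integrable lborel {a..b} h)"

lemma locally_integrable_measurable:
  assumes "locally_integrable h" shows "h \<in> borel_measurable borel"
proof -
  have "(\<lambda>x. indicator {- real n..real n} x *\<^sub>R h x) \<in> borel_measurable borel" for n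
    using assms borel_measurable_integrable[of lborel "\<lambda>x. indicator {- real n..real n} x *\<^sub>R h x"]
    unfolding locally_integrable_def set_integrable_def by simp
  then show ?thesis
  proof (rule borel_measurable_LIMSEQ_metric)
    fix x :: real
    obtain N where "\<bar>x\<bar> \<le> real N" using real_arch_simple by blast
    then have "\<forall>\<^sub>F n in sequentially. indicator {- real n..real n} x *\<^sub>R h x = h x"
      by (intro eventually_sequentiallyI[of N]) (auto simp: indicator_def)
    then show "(\<lambda>n. indicator {- real n..real n} x *\<^sub>R h x) \<longlonglongrightarrow> h x"
      by (rule tendsto_eventually)
  qed
qed

lemma integrable_test_function_scaleR:
  assumes "test_function \<phi>" and h: "locally_integrable h"
  shows "integrable lborel (\<lambda>x. \<phi> x *\<^sub>R h x)"
proof -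
  obtain K b where K: "\<And>x. \<bar>\<phi> x\<bar> \<le> K * indicator {- b..b} x"
    using test_function_bounded[OF assms(1)] by metis
  note [measurable] = test_function_measurable(1)[OF assms(1)] locally_integrable_measurable[OF h]
  have "integrable lborel (\<lambda>x. K *\<^sub>R (indicator {- b..b} x *\<^sub>R h x))"
    using h unfolding locally_integrable_def set_integrable_def by (intro integrable_scaleR_right) blast
  then show ?thesis
  proof (rule Bochner_Integration.integrable_bound)
    show "AE x in lborel. norm (\<phi> x *\<^sub>R h x) \<le> norm (K *\<^sub>R (indicator {- b..b} x *\<^sub>R h x))"
    proof (rule AE_I2)
      fix x
      have "\<bar>\<phi> x\<bar> \<le> \<bar>K * indicator {- b..b} x\<bar>" using K[of x] by linarith
      then show "norm (\<phi> x *\<^sub>R h x) \<le> norm (K *\<^sub>R (indicator {- b..b} x *\<^sub>R h x))"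
        by (simp add: mult_right_mono abs_mult mult.assoc[symmetric])
    qed
  qed simp
qed

text \<open>Open intervals form an intersection-stable generator of the Borel sets, so the vanishing
  of the integrals extends to all Borel sets by a Dynkin argument. It is run on each window (-n, n),
  where \<open>h\<close> is integrable.\<close>

lemma AE_zero_if_interval_integrals_zero:
  fixes h :: "real \<Rightarrow> complex"
  assumes h: "locally_integrable h"
    and zero: "\<And>a b. (\<integral>x. indicator {a<..<b} x *\<^sub>R h x \<partial>lborel) = 0"
  shows "AE x in lborel. h x = 0"
proof -
  have "AE x in lborel. indicator {- real n<..<real n} x *\<^sub>R h x = 0" for n
  proof (rule sigma_finite_measure.density_zero[OF lborel.sigma_finite_measure_axioms])
    define g where "g x = indicator {- real n<..<real n} x *\<^sub>R h x" for x
    have int: "integrable lborel g"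
      using set_integrable_subset[of lborel "{- real n..real n}" h "{- real n<..<real n}"] h
      unfolding locally_integrable_def g_def set_integrable_def[symmetric]
      by (auto simp: greaterThanLessThan_subseteq_atLeastAtMost_iff)
    then show "integrable lborel (\<lambda>x. indicator {- real n<..<real n} x *\<^sub>R h x)" unfolding g_def .
    note [measurable] = borel_measurable_integrable[OF int]
    have sint: "set_integrable lborel A g" if "A \<in> sets borel" for A
      unfolding set_integrable_def using that by (intro integrable_mult_indicator int) simp
    have z: "(\<integral>x. g x \<partial>lborel) = 0" using zero by (simp add: g_def)
    have gen: "sets borel = sigma_sets UNIV (range (\<lambda>(a, b). {a<..<b::real}))"
      by (subst borel_eq_box) (simp add: sets_measure_of_conv split_def)
    fix A :: "real set" assume "A \<in> sets lborel"
    then have "A \<in> sigma_sets UNIV (range (\<lambda>(a, b). {a<..<b::real}))"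
      using gen by simp
    then have "A \<in> sets borel \<and> (LINT x:A|lborel. g x) = 0"
    proof (rule sigma_sets_induct_disjoint[rotated 2])
      show "Int_stable (range (\<lambda>(a, b). {a<..<b::real}))"
      proof (rule Int_stableI)
        fix A B :: "real set"
        assume "A \<in> range (\<lambda>(a, b). {a<..<b})" "B \<in> range (\<lambda>(a, b). {a<..<b})"
        then obtain a b c d where "A = {a<..<b}" "B = {c<..<d}" by auto
        then have "A \<inter> B = (\<lambda>(a, b). {a<..<b}) (max a c, min b d)" by auto
        then show "A \<inter> B \<in> range (\<lambda>(a, b). {a<..<b})" by (metis rangeI)
      qed
      show "range (\<lambda>(a, b). {a<..<b::real}) \<subseteq> Pow UNIV" by simp
      show "{} \<in> sets borel \<and> (LINT x:{}|lborel. g x) = 0"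
        by (simp add: set_lebesgue_integral_def)
    next
      fix B :: "real set" assume "B \<in> range (\<lambda>(a, b). {a<..<b})"
      then obtain a b where B: "B = {a<..<b}" by auto
      have "(LINT x:B|lborel. g x)
          = (\<integral>x. indicator {max a (- real n)<..<min b (real n)} x *\<^sub>R h x \<partial>lborel)"
        unfolding set_lebesgue_integral_def
        by (rule Bochner_Integration.integral_cong) (auto simp: B g_def indicator_def)
      then show "B \<in> sets borel \<and> (LINT x:B|lborel. g x) = 0"
        by (simp add: zero B)
    next
      fix B :: "real set" assume B: "B \<in> sets borel \<and> (LINT x:B|lborel. g x) = 0"
      \<comment> \<open>Complements are covered because the integral of \<open>g\<close> over the
        whole line also vanishes.\<close>
      have "(LINT x:(UNIV - B) \<union> B|lborel. g x) = (LINT x:UNIV - B|lborel. g x) + (LINT x:B|lborel. g x)"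
        by (rule set_integral_Un) (use B sint in auto)
      moreover have "(LINT x:(UNIV - B) \<union> B|lborel. g x) = 0"
        using z by (simp add: set_lebesgue_integral_def)
      ultimately show "UNIV - B \<in> sets borel \<and> (LINT x:UNIV - B|lborel. g x) = 0"
        using B by auto
    next
      fix F :: "nat \<Rightarrow> real set"
      assume F: "disjoint_family F" "\<And>i. F i \<in> sets borel \<and> (LINT x:F i|lborel. g x) = 0"
      have "(LINT x:(\<Union>i. F i)|lborel. g x) = (\<Sum>i. LINT x:F i|lborel. g x)"
        by (rule lebesgue_integral_countable_add)
          (use F in \<open>auto simp: disjoint_family_on_def intro!: sint sets.countable_UN'\<close>)
      then show "\<Union> (range F) \<in> sets borel \<and> (LINT x:\<Union> (range F)|lborel. g x) = 0"
        using F by auto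
    qed
    then show "(LINT x:A|lborel. indicator {- real n<..<real n} x *\<^sub>R h x) = 0"
      by (simp add: g_def)
  qed
  then have "AE x in lborel. \<forall>n. indicator {- real n<..<real n} x *\<^sub>R h x = 0"
    unfolding AE_all_countable by blast
  then show ?thesis
  proof eventually_elim
    case (elim x)
    obtain n where "\<bar>x\<bar> < real n" using reals_Archimedean2 by blast
    then show ?case using elim[rule_format, of n] by (auto simp: indicator_def split: if_splits)
  qed
qed

text \<open>The bumps converge pointwise to the indicator of (a, b) and are dominated by that of
  [a, b], which reduces test functions to intervals.\<close>

lemma AE_zero_if_test_integrals_zero:
  fixes h :: "real \<Rightarrow> complex"
  assumes h: "locally_integrable h"
    and zero: "\<And>\<phi>. test_function \<phi> \<Longrightarrow> (\<integral>x. \<phi> x *\<^sub>R h x \<partial>lborel) = 0"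
  shows "AE x in lborel. h x = 0"
proof (rule AE_zero_if_interval_integrals_zero[OF h])
  fix a b :: real
  have [measurable]: "h \<in> borel_measurable borel" by (rule locally_integrable_measurable[OF h])
  have [measurable]: "bump (real (Suc n)) a b \<in> borel_measurable borel" for n
    using test_function_measurable(1)[OF test_function_bump, of "real (Suc n)" a b] by simp
  have "(\<lambda>n. \<integral>x. bump (real (Suc n)) a b x *\<^sub>R h x \<partial>lborel)
      \<longlonglongrightarrow> (\<integral>x. indicator {a<..<b} x *\<^sub>R h x \<partial>lborel)"
  proof (rule integral_dominated_convergence)
    show "integrable lborel (\<lambda>x. norm (indicator {a..b} x *\<^sub>R h x))"
      using h unfolding locally_integrable_def set_integrable_def by (intro integrable_norm) blast
    show "AE x in lborel. (\<lambda>n. bump (real (Suc n)) a b x *\<^sub>R h x) \<longlonglongrightarrow> indicator {a<..<b} x *\<^sub>R h x"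
      by (intro AE_I2 tendsto_scaleR bump_tendsto tendsto_const)
    fix n
    have "\<bar>bump (real (Suc n)) a b x\<bar> \<le> indicator {a..b} x" for x
      using bump_le_indicator[of "real (Suc n)" a b x] bump_nonneg[of "real (Suc n)" a b x]
        indicator_le_1[of "{a<..<b}" x, where 'a = real]
      by (cases "a < x \<and> x < b"; cases "a \<le> x \<and> x \<le> b") simp_all
    then show "AE x in lborel. norm (bump (real (Suc n)) a b x *\<^sub>R h x) \<le> norm (indicator {a..b} x *\<^sub>R h x)"
      by (intro AE_I2) (simp add: mult_right_mono)
  qed (simp_all del: of_nat_Suc)
  moreover have "(\<integral>x. bump (real (Suc n)) a b x *\<^sub>R h x \<partial>lborel) = 0" for n
    by (intro zero test_function_bump) simp
  ultimately show "(\<integral>x. indicator {a<..<b} x *\<^sub>R h x \<partial>lborel) = 0"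
    by (simp add: LIMSEQ_const_iff)
qed

text \<open>The primitive that starts left of the support vanishes right of it exactly because the
  total integral is 0.\<close>

lemma test_function_antiderivative:
  assumes "test_function g" and "(\<integral>x. g x \<partial>lborel) = 0"
  obtains \<phi> where "test_function \<phi>" "deriv \<phi> = g"
proof -
  obtain b0 where b0: "\<And>x. b0 < \<bar>x\<bar> \<Longrightarrow> g x = 0" and s: "smooth g"
    using assms by (auto simp: test_function_smooth)
  define b where "b = max b0 0"
  have b: "g x = 0" if "b < \<bar>x\<bar>" for x using b0[of x] that by (simp add: b_def)
  have "0 \<le> b" by (simp add: b_def)
  \<comment> \<open>Starting one unit left of the support makes every x \<ge> - b an interior point
    of the interval on which the fundamental theorem is applied.\<close>
  define \<phi> where "\<phi> x = integral {- b - 1..x} g" for x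
  have low: "\<phi> x = 0" if "x < - b" for x
  proof -
    have "\<phi> x = integral {- b - 1..x} (\<lambda>_. 0)" unfolding \<phi>_def
      by (rule Henstock_Kurzweil_Integration.integral_cong) (use that b in auto)
    then show ?thesis by simp
  qed
  have high: "\<phi> x = 0" if "b < x" for x
  proof -
    have "set_integrable lborel {- b - 1..x} g"
      unfolding set_integrable_def by (intro borel_integrable_compact smooth_continuous s) simp
    then have "\<phi> x = (LINT y:{- b - 1..x}|lborel. g y)"
      unfolding \<phi>_def by (simp add: set_borel_integral_eq_integral)
    also have "\<dots> = (\<integral>y. g y \<partial>lborel)"
      unfolding set_lebesgue_integral_def
    proof (rule Bochner_Integration.integral_cong)
      fix y
      show "indicator {- b - 1..x} y *\<^sub>R g y = g y"
      proof (cases "b < \<bar>y\<bar>")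
        case False
        then have "y \<in> {- b - 1..x}" using that by auto
        then show ?thesis by simp
      qed (simp add: b)
    qed simp
    finally show ?thesis using assms(2) by simp
  qed
  have d: "(\<phi> has_real_derivative g x) (at x)" for x
  proof (cases "x < - b")
    case True
    have "((\<lambda>_. 0) has_real_derivative 0) (at x)" by simp
    then have "(\<phi> has_real_derivative 0) (at x)"
      by (rule has_field_derivative_transform_within_open[where S = "{..< - b}"])
        (use True low in auto)
    then show ?thesis using True b[of x] \<open>0 \<le> b\<close> by simp
  next
    case False
    have "(\<phi> has_real_derivative g x) (at x within {- b - 1..x + 1})"
      unfolding \<phi>_def using False
      by (intro integral_has_real_derivative smooth_continuous s) auto
    moreover have "x \<in> interior {- b - 1..x + 1}" using False by simp
    ultimately show ?thesis by (metis at_within_interior)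
  qed
  have "smooth \<phi>" by (rule smooth_antiderivative[OF d s])
  moreover have "\<forall>x. b < \<bar>x\<bar> \<longrightarrow> \<phi> x = 0" using low high by (auto simp: abs_real_def)
  ultimately have "test_function \<phi>" by (auto simp: test_function_smooth)
  moreover have "deriv \<phi> = g" using d by (intro ext DERIV_imp_deriv)
  ultimately show thesis by (rule that)
qed

lemma integrable_test_function:
  assumes "test_function \<phi>" shows "integrable lborel \<phi>"
proof -
  have "locally_integrable (\<lambda>_. 1)"
    unfolding locally_integrable_def set_integrable_def
    by (intro allI borel_integrable_compact) auto
  then have "integrable lborel (\<lambda>x. \<phi> x *\<^sub>R (1::complex))"
    by (rule integrable_test_function_scaleR[OF assms])
  then have "integrable lborel (\<lambda>x. Re (\<phi> x *\<^sub>R (1::complex)))" by (rule integrable_Re)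
  then show ?thesis by simp
qed

text \<open>Test functions with integral 0 are derivatives of test functions. Subtracting from
  \<psi> a suitable multiple of a fixed bump \<eta> therefore gives a function that \<open>h\<close>
  annihilates, and the constant is the \<eta>-average of \<open>h\<close>.\<close>

lemma du_bois_reymond:
  fixes h :: "real \<Rightarrow> complex"
  assumes h: "locally_integrable h"
    and zero: "\<And>\<phi>. test_function \<phi> \<Longrightarrow> (\<integral>x. deriv \<phi> x *\<^sub>R h x \<partial>lborel) = 0"
  obtains C where "AE x in lborel. h x = C"
proof -
  define \<eta> where "\<eta> = bump 1 0 1"
  have \<eta>: "test_function \<eta>" unfolding \<eta>_def by (rule test_function_bump) simp
  define N where "N = (\<integral>x. \<eta> x \<partial>lborel)"
  have "N \<noteq> 0"
  proof
    assume "N = 0"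
    then have "AE x in lborel. \<eta> x = 0"
      unfolding N_def using integral_nonneg_eq_0_iff_AE[OF integrable_test_function[OF \<eta>]]
      by (simp add: \<eta>_def bump_nonneg)
    moreover have "\<eta> x \<noteq> 0" if "x \<in> {0<..<1}" for x
      using that by (simp add: \<eta>_def bump_def flat_def)
    ultimately have "AE x in lborel. x \<notin> {0<..<1::real}"
      by (auto elim: eventually_mono)
    then have "{0<..<1::real} \<in> null_sets lborel"
      by (subst AE_iff_null_sets) auto
    then show False by (simp add: null_sets_def)
  qed
  define C where "C = (\<integral>x. \<eta> x *\<^sub>R h x \<partial>lborel) / complex_of_real N"
  have const: "locally_integrable (\<lambda>_. C)"
    unfolding locally_integrable_def set_integrable_def
    by (intro allI borel_integrable_compact) auto
  have "AE x in lborel. h x - C = 0"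
  proof (rule AE_zero_if_test_integrals_zero)
    show "locally_integrable (\<lambda>x. h x - C)"
      using h const unfolding locally_integrable_def by (auto intro: set_integral_diff)
    fix \<psi> assume \<psi>: "test_function \<psi>"
    define r where "r = (\<integral>x. \<psi> x \<partial>lborel) / N"
    define g where "g x = \<psi> x + (- r) * \<eta> x" for x
    note int = integrable_test_function[OF \<psi>] integrable_test_function[OF \<eta>]
      integrable_test_function_scaleR[OF \<psi> h] integrable_test_function_scaleR[OF \<eta> h]
    have "test_function g"
    proof -
      obtain b1 b2 where "\<forall>x. b1 < \<bar>x\<bar> \<longrightarrow> \<psi> x = 0" "\<forall>x. b2 < \<bar>x\<bar> \<longrightarrow> \<eta> x = 0"
        using \<psi> \<eta> by (auto simp: test_function_smooth)
      then have "\<forall>x. max b1 b2 < \<bar>x\<bar> \<longrightarrow> g x = 0" by (simp add: g_def)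
      moreover have "smooth g"
        unfolding g_def using \<psi> \<eta> by (intro smooth_linear_combination) (auto simp: test_function_smooth)
      ultimately show ?thesis unfolding test_function_smooth by blast
    qed
    moreover have "(\<integral>x. g x \<partial>lborel) = 0"
      using int \<open>N \<noteq> 0\<close> by (simp add: g_def r_def N_def[symmetric])
    ultimately obtain \<phi> where "test_function \<phi>" "deriv \<phi> = g"
      using test_function_antiderivative by blast
    then have "(\<integral>x. g x *\<^sub>R h x \<partial>lborel) = 0" using zero by metis
    moreover have "(\<integral>x. g x *\<^sub>R h x \<partial>lborel)
        = (\<integral>x. \<psi> x *\<^sub>R h x - r *\<^sub>R (\<eta> x *\<^sub>R h x) \<partial>lborel)"
      by (rule Bochner_Integration.integral_cong) (auto simp: g_def algebra_simps scaleR_add_left)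
    moreover have "\<dots> = (\<integral>x. \<psi> x *\<^sub>R h x \<partial>lborel) - r *\<^sub>R (\<integral>x. \<eta> x *\<^sub>R h x \<partial>lborel)"
      using int by (simp del: scaleR_scaleR)
    ultimately have "(\<integral>x. \<psi> x *\<^sub>R h x \<partial>lborel) = r *\<^sub>R (\<integral>x. \<eta> x *\<^sub>R h x \<partial>lborel)"
      by simp
    also have "\<dots> = (\<integral>x. \<psi> x *\<^sub>R C \<partial>lborel)"
      using int \<open>N \<noteq> 0\<close> by (simp add: C_def r_def scaleR_conv_of_real)
    finally show "(\<integral>x. \<psi> x *\<^sub>R (h x - C) \<partial>lborel) = 0"
      using int integrable_test_function_scaleR[OF \<psi> const]
      by (simp add: scaleR_diff_right)
  qed
  then show thesis by (intro that[of C]) simp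
qed

section \<open>Absolutely continuous functions\<close>

text \<open>Local absolute continuity, encoded by the fundamental theorem instead of
  differentiability almost everywhere: \<open>f\<close> is a primitive of the locally integrable
  \<open>g\<close>. These are the good representatives of weakly differentiable classes.\<close>

definition ac_deriv :: "(real \<Rightarrow> complex) \<Rightarrow> (real \<Rightarrow> complex) \<Rightarrow> bool" where
  "ac_deriv f g \<longleftrightarrow> locally_integrable g \<and> (\<forall>a b. a \<le> b \<longrightarrow> f b - f a = (LINT x:{a..b}|lborel. g x))"

lemma ac_deriv_eq: "ac_deriv f g \<Longrightarrow> a \<le> b \<Longrightarrow> (LINT x:{a..b}|lborel. g x) = f b - f a"
  by (simp add: ac_deriv_def)

lemma ac_deriv_locally_integrable: "ac_deriv f g \<Longrightarrow> locally_integrable g"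
  by (simp add: ac_deriv_def)

lemma ac_deriv_continuous: 
  assumes "ac_deriv f g" shows "continuous_on A f"
proof (rule continuous_at_imp_continuous_on, rule ballI)
  fix x
  have int: "set_integrable lborel {x - 1..y} g" for y
    using assms by (simp add: ac_deriv_def locally_integrable_def)
  have "continuous_on {x - 1..x + 1} (\<lambda>y. f (x - 1) + integral {x - 1..y} g)"
    using int[of "x + 1"]
    by (intro continuous_intros indefinite_integral_continuous_1 set_borel_integral_eq_integral(1))
  moreover have "f (x - 1) + integral {x - 1..y} g = f y" if "y \<in> {x - 1..x + 1}" for y
    using ac_deriv_eq[OF assms, of "x - 1" y] that int[of y]
    by (simp add: set_borel_integral_eq_integral)
  ultimately have "continuous_on {x - 1..x + 1} f" by (rule continuous_on_eq)
  then show "isCont f x"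
    by (rule continuous_on_interior) simp
qed

lemma ac_deriv_measurable:
  "ac_deriv f g \<Longrightarrow> f \<in> borel_measurable borel" "ac_deriv f g \<Longrightarrow> g \<in> borel_measurable borel"
  by (simp_all add: borel_measurable_continuous_onI ac_deriv_continuous
      locally_integrable_measurable ac_deriv_locally_integrable)

lemma locally_integrable_continuous: "continuous_on UNIV f \<Longrightarrow> locally_integrable f"
  unfolding locally_integrable_def set_integrable_def
  by (intro allI borel_integrable_compact) (auto intro: continuous_on_subset)

lemma locally_integrable_mult_continuous:
  assumes f: "continuous_on UNIV f" and g: "locally_integrable g"
  shows "locally_integrable (\<lambda>x. f x * g x)"
  unfolding locally_integrable_def
proof (intro allI)
  fix a b
  have [measurable]: "f \<in> borel_measurable borel" using f by (rule borel_measurable_continuous_onI)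
  note [measurable] = locally_integrable_measurable[OF g]
  have "bounded (f ` {a..b})"
    using f by (intro compact_imp_bounded compact_continuous_image) (auto intro: continuous_on_subset)
  then obtain K where K: "\<And>x. x \<in> {a..b} \<Longrightarrow> norm (f x) \<le> K"
    unfolding bounded_iff by (metis image_eqI)
  have "set_integrable lborel {a..b} (\<lambda>x. K *\<^sub>R g x)"
    using g by (simp add: locally_integrable_def)
  then show "set_integrable lborel {a..b} (\<lambda>x. f x * g x)"
  proof (rule set_integrable_bound)
    show "AE x in lborel. x \<in> {a..b} \<longrightarrow> norm (f x * g x) \<le> norm (K *\<^sub>R g x)"
    proof (intro AE_I2 impI)
      fix x assume "x \<in> {a..b}"
      then have "norm (f x) \<le> \<bar>K\<bar>" using K[of x] by linarith
      then show "norm (f x * g x) \<le> norm (K *\<^sub>R g x)" by (simp add: norm_mult mult_right_mono)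
    qed
  qed (simp_all add: set_borel_measurable_def)
qed

lemma locally_integrable_add:
  "locally_integrable f \<Longrightarrow> locally_integrable g \<Longrightarrow> locally_integrable (\<lambda>x. f x + g x)"
  unfolding locally_integrable_def by (auto intro: set_integral_add)

text \<open>Fubini on the triangle a \<le> y \<le> x \<le> b for g(x) k(y): the inner integral over
  y gives h(x) - h(a), the one over x gives f(b) - f(y). This is integration by parts, from which
  the product rule follows by expanding both sides.\<close>

lemma ac_deriv_exchange:
  assumes f: "ac_deriv f g" and h: "ac_deriv h k" and "a \<le> b"
  shows "(LINT x:{a..b}|lborel. g x * (h x - h a)) = (LINT y:{a..b}|lborel. (f b - f y) * k y)"
proof -
  define g' where "g' x = indicator {a..b} x *\<^sub>R g x" for x
  define k' where "k' x = indicator {a..b} x *\<^sub>R k x" for x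
  define P where "P x y = indicator {..x} y *\<^sub>R (g' x * k' y)" for x y :: real
  have g': "integrable lborel g'" and k': "integrable lborel k'"
    using f h unfolding g'_def[abs_def] k'_def[abs_def] ac_deriv_def locally_integrable_def set_integrable_def
    by blast+
  note [measurable] = borel_measurable_integrable[OF g'] borel_measurable_integrable[OF k']
  have Pm: "(\<lambda>(x, y). P x y) \<in> borel_measurable (lborel \<Otimes>\<^sub>M lborel)"
  proof -
    have "(\<lambda>(x, y). P x y) = (\<lambda>p. (if snd p \<le> fst p then 1 else 0) *\<^sub>R (g' (fst p) * k' (snd p)))"
      by (auto simp: P_def indicator_def)
    then show ?thesis by simp
  qed
  have int: "integrable (lborel \<Otimes>\<^sub>M lborel) (\<lambda>(x, y). P x y)"
  proof (rule lborel_pair.Fubini_integrable)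
    show "AE x in lborel. integrable lborel (\<lambda>y. case (x, y) of (x, y) \<Rightarrow> P x y)"
      unfolding P_def prod.case
      by (intro AE_I2 integrable_mult_indicator integrable_mult_right k') simp
    show "integrable lborel (\<lambda>x. \<integral>y. norm (case (x, y) of (x, y) \<Rightarrow> P x y) \<partial>lborel)"
    proof (rule Bochner_Integration.integrable_bound)
      show "integrable lborel (\<lambda>x. norm (g' x) * (\<integral>y. norm (k' y) \<partial>lborel))"
        using g' by (intro integrable_mult_left integrable_norm)
      show "(\<lambda>x. \<integral>y. norm (case (x, y) of (x, y) \<Rightarrow> P x y) \<partial>lborel) \<in> borel_measurable lborel"
        using Pm by (intro lborel.borel_measurable_lebesgue_integral) (simp add: split_def)
      have "norm (\<integral>y. norm (P x y) \<partial>lborel) \<le> norm (g' x) * (\<integral>y. norm (k' y) \<partial>lborel)" for x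
      proof -
        have "(\<integral>y. norm (P x y) \<partial>lborel) \<le> (\<integral>y. norm (g' x) * norm (k' y) \<partial>lborel)"
          unfolding P_def using k'
          by (intro integral_mono integrable_norm integrable_mult_indicator integrable_mult_right)
            (auto simp: norm_mult indicator_def)
        moreover have "0 \<le> (\<integral>y. norm (P x y) \<partial>lborel)" by (rule Bochner_Integration.integral_nonneg) simp
        ultimately show ?thesis by simp
      qed
      then show "AE x in lborel. norm (\<integral>y. norm (case (x, y) of (x, y) \<Rightarrow> P x y) \<partial>lborel)
          \<le> norm (norm (g' x) * (\<integral>y. norm (k' y) \<partial>lborel))"
        by (auto simp: abs_mult)
    qed
  qed (rule Pm)
  have 1: "(\<integral>y. P x y \<partial>lborel) = indicator {a..b} x *\<^sub>R (g x * (h x - h a))" for x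
  proof (cases "x \<in> {a..b}")
    case True
    then have "P x y = g x * (indicator {a..x} y *\<^sub>R k y)" for y
      by (auto simp: P_def g'_def k'_def indicator_def)
    then have "(\<integral>y. P x y \<partial>lborel) = g x * (\<integral>y. indicator {a..x} y *\<^sub>R k y \<partial>lborel)"
      by (simp only: integral_mult_right_zero)
    then show ?thesis
      using True ac_deriv_eq[OF h, of a x] by (simp add: set_lebesgue_integral_def)
  qed (auto simp: P_def g'_def)
  have 2: "(\<integral>x. P x y \<partial>lborel) = indicator {a..b} y *\<^sub>R ((f b - f y) * k y)" for y
  proof (cases "y \<in> {a..b}")
    case True
    then have "P x y = (indicator {y..b} x *\<^sub>R g x) * k y" for x
      by (auto simp: P_def g'_def k'_def indicator_def)
    then have "(\<integral>x. P x y \<partial>lborel) = (\<integral>x. indicator {y..b} x *\<^sub>R g x \<partial>lborel) * k y"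
      by (simp only: integral_mult_left_zero)
    then show ?thesis
      using True ac_deriv_eq[OF f, of y b] by (simp add: set_lebesgue_integral_def)
  qed (auto simp: P_def k'_def)
  have "(\<integral>y. (\<integral>x. P x y \<partial>lborel) \<partial>lborel) = (\<integral>x. (\<integral>y. P x y \<partial>lborel) \<partial>lborel)"
    using int by (rule lborel_pair.Fubini_integral)
  then show ?thesis unfolding 1 2 set_lebesgue_integral_def by simp
qed

lemma ac_deriv_mult:
  assumes f: "ac_deriv f g" and h: "ac_deriv h k"
  shows "ac_deriv (\<lambda>x. f x * h x) (\<lambda>x. f x * k x + h x * g x)"
  unfolding ac_deriv_def
proof (intro conjI allI impI)
  have fk: "locally_integrable (\<lambda>x. f x * k x)" and hg: "locally_integrable (\<lambda>x. h x * g x)"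
    using f h by (auto intro!: locally_integrable_mult_continuous ac_deriv_continuous
        dest: ac_deriv_locally_integrable)
  then show "locally_integrable (\<lambda>x. f x * k x + h x * g x)" by (rule locally_integrable_add)
  fix a b :: real assume "a \<le> b"
  have i: "set_integrable lborel {a..b} g" "set_integrable lborel {a..b} k"
    "set_integrable lborel {a..b} (\<lambda>x. f x * k x)" "set_integrable lborel {a..b} (\<lambda>x. h x * g x)"
    using f h fk hg by (auto simp: ac_deriv_def locally_integrable_def)
  have "(LINT x:{a..b}|lborel. g x * (h x - h a))
      = (LINT x:{a..b}|lborel. h x * g x) - h a * (LINT x:{a..b}|lborel. g x)"
    using i by (subst set_integral_mult_right[symmetric], subst set_integral_diff(2)[symmetric])
      (auto simp: algebra_simps)
  moreover have "(LINT y:{a..b}|lborel. (f b - f y) * k y)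
      = f b * (LINT x:{a..b}|lborel. k x) - (LINT x:{a..b}|lborel. f x * k x)"
    using i by (subst set_integral_mult_right[symmetric], subst set_integral_diff(2)[symmetric])
      (auto simp: algebra_simps)
  ultimately have "(LINT x:{a..b}|lborel. h x * g x) - h a * (f b - f a)
      = f b * (h b - h a) - (LINT x:{a..b}|lborel. f x * k x)"
    using ac_deriv_exchange[OF f h \<open>a \<le> b\<close>] ac_deriv_eq[OF f \<open>a \<le> b\<close>] ac_deriv_eq[OF h \<open>a \<le> b\<close>] by simp
  then show "f b * h b - f a * h a = (LINT x:{a..b}|lborel. f x * k x + h x * g x)"
    using i by (simp add: algebra_simps)
qed

lemma ac_deriv_C1:
  assumes "\<And>x. (f has_vector_derivative g x) (at x)" and "continuous_on UNIV g"
  shows "ac_deriv f g"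
  unfolding ac_deriv_def
proof (intro conjI allI impI)
  show "locally_integrable g" using assms(2) by (rule locally_integrable_continuous)
  fix a b :: real assume "a \<le> b"
  then have "integral\<^sup>L lborel (\<lambda>x. indicator {a..b} x *\<^sub>R g x) = f b - f a"
    by (intro integral_FTC_atLeastAtMost)
      (use assms in \<open>auto intro: has_vector_derivative_at_within continuous_on_subset\<close>)
  then show "f b - f a = (LINT x:{a..b}|lborel. g x)" by (simp add: set_lebesgue_integral_def)
qed

text \<open>Source of all integrations by parts on the line. No decay of \<open>F\<close> is
  assumed; it follows from integrability, since |F(a)| is at most the integral of |F| + |G| over
  [a, a + 1], which tends to 0 as |a| \<rightarrow> \<infinity>.\<close>

lemma ac_deriv_integral_eq_0:
  assumes ac: "ac_deriv F G" and F: "integrable lborel F" and G: "integrable lborel G"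
  shows "(\<integral>x. G x \<partial>lborel) = 0"
proof -
  have sF: "set_integrable lborel A F" and sG: "set_integrable lborel A G" if "A \<in> sets borel" for A
    using that F G unfolding set_integrable_def by (auto intro!: integrable_mult_indicator)
  have bound: "norm (F a) \<le> (\<integral>x. indicator {a..a + 1} x *\<^sub>R (norm (F x) + norm (G x)) \<partial>lborel)" for a
  proof -
    define c where "c = (\<integral>x. indicator {a..a + 1} x *\<^sub>R norm (G x) \<partial>lborel)"
    \<comment> \<open>Averaging this over the unit interval gives the bound.\<close>
    have 1: "norm (F a) \<le> norm (F x) + c" if "x \<in> {a..a + 1}" for x
    proof -
      have "norm (LINT y:{a..x}|lborel. G y) \<le> (\<integral>y. norm (indicator {a..x} y *\<^sub>R G y) \<partial>lborel)"
        unfolding set_lebesgue_integral_def by (rule integral_norm_bound)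
      also have "\<dots> \<le> c" unfolding c_def using that
        by (intro integral_mono integrable_norm integrable_mult_indicator G integrable_norm)
          (auto simp: indicator_def)
      finally show ?thesis
        using ac_deriv_eq[OF ac, of a x] that norm_triangle_ineq2[of "F a" "F x"]
        by (simp add: norm_minus_commute)
    qed
    have const: "integrable lborel (\<lambda>x. indicator {a..a + 1} x *\<^sub>R K)" for K :: real
      by (intro integrable_scaleR_left integrable_real_indicator) auto
    have "norm (F a) = (\<integral>x. indicator {a..a + 1} x *\<^sub>R norm (F a) \<partial>lborel)" by simp
    also have "\<dots> \<le> (\<integral>x. indicator {a..a + 1} x *\<^sub>R norm (F x) + indicator {a..a + 1} x *\<^sub>R c \<partial>lborel)"
      using 1 F
      by (intro integral_mono Bochner_Integration.integrable_add const integrable_mult_indicator)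
        (auto simp: indicator_def)
    also have "\<dots> = (\<integral>x. indicator {a..a + 1} x *\<^sub>R norm (F x) \<partial>lborel) + c"
      using integrable_mult_indicator[OF _ integrable_norm[OF F], of "{a..a + 1}"] const[of c]
      by (subst Bochner_Integration.integral_add) auto
    also have "\<dots> = (\<integral>x. indicator {a..a + 1} x *\<^sub>R (norm (F x) + norm (G x)) \<partial>lborel)"
      unfolding c_def scaleR_add_right using F G
      by (subst Bochner_Integration.integral_add)
        (auto intro!: integrable_mult_indicator integrable_norm simp del: real_scaleR_def)
    finally show ?thesis .
  qed
  have lim: "(\<lambda>n. F (u n)) \<longlonglongrightarrow> 0" if u: "filterlim (\<lambda>n. \<bar>u n\<bar>) at_top sequentially" for u :: "nat \<Rightarrow> real"
  proof (rule Lim_null_comparison)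
    show "\<forall>\<^sub>F n in sequentially. norm (F (u n)) \<le>
        (\<integral>x. indicator {u n..u n + 1} x *\<^sub>R (norm (F x) + norm (G x)) \<partial>lborel)"
      using bound by (auto intro: always_eventually)
    have "(\<lambda>n. \<integral>x. indicator {u n..u n + 1} x *\<^sub>R (norm (F x) + norm (G x)) \<partial>lborel)
        \<longlonglongrightarrow> (\<integral>x. 0 \<partial>(lborel::real measure))"
    proof (rule integral_dominated_convergence)
      show "integrable lborel (\<lambda>x. norm (F x) + norm (G x))" using F G by simp
      show "AE x in lborel. (\<lambda>n. indicator {u n..u n + 1} x *\<^sub>R (norm (F x) + norm (G x))) \<longlonglongrightarrow> 0"
      proof (rule AE_I2)
        fix x
        have "\<forall>\<^sub>F n in sequentially. \<bar>x\<bar> + 2 \<le> \<bar>u n\<bar>"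
          using u unfolding filterlim_at_top by blast
        then have "\<forall>\<^sub>F n in sequentially. indicator {u n..u n + 1} x *\<^sub>R (norm (F x) + norm (G x)) = 0"
          by eventually_elim (auto simp: indicator_def)
        then show "(\<lambda>n. indicator {u n..u n + 1} x *\<^sub>R (norm (F x) + norm (G x))) \<longlonglongrightarrow> 0"
          by (rule tendsto_eventually)
      qed
      show "AE x in lborel. norm (indicator {u n..u n + 1} x *\<^sub>R (norm (F x) + norm (G x)))
          \<le> norm (F x) + norm (G x)" for n
        by (intro AE_I2) (auto simp: indicator_def)
    qed (use F G in auto)
    then show "(\<lambda>n. \<integral>x. indicator {u n..u n + 1} x *\<^sub>R (norm (F x) + norm (G x)) \<partial>lborel) \<longlonglongrightarrow> 0"
      by simp
  qed
  have "(\<lambda>n. LINT x:{- real n..real n}|lborel. G x) \<longlonglongrightarrow> (\<integral>x. G x \<partial>lborel)"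
    unfolding set_lebesgue_integral_def
  proof (rule integral_dominated_convergence)
    show "integrable lborel (\<lambda>x. norm (G x))" using G by simp
    show "AE x in lborel. (\<lambda>n. indicator {- real n..real n} x *\<^sub>R G x) \<longlonglongrightarrow> G x"
    proof (rule AE_I2)
      fix x :: real
      obtain N where "\<bar>x\<bar> \<le> real N" using real_arch_simple by blast
      then have "\<forall>\<^sub>F n in sequentially. indicator {- real n..real n} x *\<^sub>R G x = G x"
        by (intro eventually_sequentiallyI[of N]) (auto simp: indicator_def)
      then show "(\<lambda>n. indicator {- real n..real n} x *\<^sub>R G x) \<longlonglongrightarrow> G x"
        by (rule tendsto_eventually)
    qed
    show "AE x in lborel. norm (indicator {- real n..real n} x *\<^sub>R G x) \<le> norm (G x)" for n
      by (intro AE_I2) (auto simp: indicator_def)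
  qed (use G in auto)
  moreover have "(\<lambda>n. F (real n) - F (- real n)) \<longlonglongrightarrow> 0 - 0"
    by (intro tendsto_diff lim) (auto simp: filterlim_real_sequentially)
  moreover have "(LINT x:{- real n..real n}|lborel. G x) = F (real n) - F (- real n)" for n
    by (rule ac_deriv_eq[OF ac]) simp
  ultimately show ?thesis using LIMSEQ_unique by fastforce
qed

section \<open>The Hilbert space of square-integrable functions\<close>

lemma square_integrable_rep_l2: "square_integrable (rep_l2 u)"
  using Quotient_rep_reflp[OF Quotient_l2, of u] by (simp add: l2_eq_def)

lemma abs_rep_l2: "abs_l2 (rep_l2 u) = u"
  by (rule Quotient_abs_rep[OF Quotient_l2])

lemma l2_eq_refl_iff: "l2_eq f f \<longleftrightarrow> square_integrable f"
  by (simp add: l2_eq_def)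

lemma abs_l2_eq_iff:
  "square_integrable f \<Longrightarrow> square_integrable g \<Longrightarrow> abs_l2 f = abs_l2 g \<longleftrightarrow> (AE x in lborel. f x = g x)"
  using Quotient_rel[OF Quotient_l2, of f g] by (simp add: l2_eq_def)

lemma l2_cases:
  obtains f where "square_integrable f" "u = abs_l2 f"
  using square_integrable_rep_l2 abs_rep_l2 by metis

lemmas abs_l2_plus = plus_l2.abs_eq[unfolded l2_eq_refl_iff]
  and abs_l2_uminus = uminus_l2.abs_eq[unfolded l2_eq_refl_iff]
  and abs_l2_scaleC = scaleC_l2.abs_eq[unfolded l2_eq_refl_iff]
  and abs_l2_inner = inner_l2.abs_eq[unfolded l2_eq_refl_iff]

lemma square_integrable_uminus: "square_integrable f \<Longrightarrow> square_integrable (\<lambda>x. - f x)"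
  using square_integrable_cmult[of f "- 1"] by simp

lemma square_integrable_diff:
  "square_integrable f \<Longrightarrow> square_integrable g \<Longrightarrow> square_integrable (\<lambda>x. f x - g x)"
  using square_integrable_add[OF _ square_integrable_uminus, of f g] by simp

lemma abs_l2_minus:
  "square_integrable f \<Longrightarrow> square_integrable g \<Longrightarrow> abs_l2 f - abs_l2 g = abs_l2 (\<lambda>x. f x - g x)"
  by (simp add: minus_l2_def abs_l2_uminus abs_l2_plus square_integrable_uminus)

lemma square_integrable_cnj: "square_integrable f \<Longrightarrow> square_integrable (\<lambda>x. cnj (f x))"
  by (auto simp: square_integrable_def intro!: borel_measurable_continuous_on[where f = cnj] continuous_intros)

lemma square_integrable_norm: "square_integrable f \<Longrightarrow> square_integrable (\<lambda>x. of_real (cmod (f x)))"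
  by (auto simp: square_integrable_def
      intro!: borel_measurable_continuous_on[where f = "\<lambda>z. of_real (cmod z)"] continuous_intros)

lemma integrable_mult_square_integrable:
  assumes f: "square_integrable f" and g: "square_integrable g"
  shows "integrable lborel (\<lambda>x. f x * g x)"
proof -
  have [measurable]: "f \<in> borel_measurable borel" "g \<in> borel_measurable borel"
    using assms by (auto simp: square_integrable_def)
  have "integrable lborel (\<lambda>x. of_real (cmod (f x)) \<bullet> (of_real (cmod (g x)) :: complex))"
    by (intro square_integrable_inner square_integrable_norm assms)
  then show ?thesis
    by (rule Bochner_Integration.integrable_bound) (auto simp: norm_mult inner_complex_def)
qed

text \<open>
  Bilinear, not sesquilinear: with respect to this form the annihilation and creation operators
  below are transposes of each other for every value of \<open>\<theta>\<close>.
\<close>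

lift_definition bil :: "l2 \<Rightarrow> l2 \<Rightarrow> complex" is "\<lambda>f g. \<integral>x. f x * g x \<partial>lborel"
proof -
  fix f f' g g' assume "l2_eq f f'" "l2_eq g g'"
  then have [measurable]: "f \<in> borel_measurable lborel" "g \<in> borel_measurable lborel"
      "f' \<in> borel_measurable lborel" "g' \<in> borel_measurable lborel"
    and ae: "AE x in lborel. f x = f' x" "AE x in lborel. g x = g' x"
    by (auto simp: l2_eq_def square_integrable_def)
  show "(\<integral>x. f x * g x \<partial>lborel) = (\<integral>x. f' x * g' x \<partial>lborel)"
    by (rule integral_cong_AE) (use ae in auto)
qed

lift_definition conj_l2 :: "l2 \<Rightarrow> l2" is "\<lambda>f x. cnj (f x)"
  by (auto simp: l2_eq_def square_integrable_cnj)

lemmas abs_l2_bil = bil.abs_eq[unfolded l2_eq_refl_iff]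
  and abs_l2_conj = conj_l2.abs_eq[unfolded l2_eq_refl_iff]

lemma bil_commute: "bil u v = bil v u"
  by transfer (simp add: mult.commute)

lemma bil_add_left: "bil (u + v) w = bil u w + bil v w"
  by transfer (simp add: l2_eq_def distrib_right integrable_mult_square_integrable)

lemma bil_scaleC_left: "bil (c *\<^sub>C u) v = c * bil u v"
  by transfer (simp add: mult.assoc)

lemma bil_add_right: "bil w (u + v) = bil w u + bil w v"
  by (metis bil_add_left bil_commute)

lemma bil_scaleC_right: "bil v (c *\<^sub>C u) = c * bil v u"
  by (metis bil_scaleC_left bil_commute)

lemma scaleC_minus1: "(- 1) *\<^sub>C (u::'a::complex_normed_vector) = - u"
  using scaleC_of_real[of "- 1" u] by simp

lemma scaleC_zero_right [simp]: "c *\<^sub>C (0::'a::complex_normed_vector) = 0"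
  using linear_0[OF bounded_linear.linear[OF bounded_linear_scaleC[of c]]] .

lemma scaleC_zero_left [simp]: "0 *\<^sub>C (u::'a::complex_normed_vector) = 0"
  using scaleC_of_real[of 0 u] by simp

lemma scaleC_one [simp]: "1 *\<^sub>C (u::'a::complex_normed_vector) = u"
  using scaleC_of_real[of 1 u] by simp

lemma scaleC_minus_right: "c *\<^sub>C (- u::'a::complex_normed_vector) = - (c *\<^sub>C u)"
  by (metis mult.commute scaleC_minus1 scaleC_scaleC)

lemma scaleC_minus_left: "(- c) *\<^sub>C (u::'a::complex_normed_vector) = - (c *\<^sub>C u)"
  by (metis mult_minus1 scaleC_minus1 scaleC_scaleC)

lemma scaleC_diff_right: "c *\<^sub>C (u - v::'a::complex_normed_vector) = c *\<^sub>C u - c *\<^sub>C v"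
  by (metis diff_conv_add_uminus scaleC_add_right scaleC_minus_right)

lemma scaleC_diff_left: "(c - d) *\<^sub>C (u::'a::complex_normed_vector) = c *\<^sub>C u - d *\<^sub>C u"
  by (metis diff_conv_add_uminus scaleC_add_left scaleC_minus_left)

lemma bounded_linear_scaleC_fun: "bounded_linear f \<Longrightarrow> bounded_linear (\<lambda>x. c *\<^sub>C (f x :: 'a::complex_normed_vector))"
  by (rule bounded_linear_compose[OF bounded_linear_scaleC])

lemma bil_minus_left: "bil (- u) v = - bil u v"
  using bil_scaleC_left[of "- 1" u v] by (simp add: scaleC_minus1)

lemma bil_minus_right: "bil v (- u) = - bil v u"
  by (metis bil_minus_left bil_commute)

lemma bil_diff_left: "bil (u - v) w = bil u w - bil v w"
  using bil_add_left[of u "- v" w] by (simp add: bil_minus_left)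

lemma bil_diff_right: "bil w (u - v) = bil w u - bil w v"
  by (metis bil_diff_left bil_commute)

lemma bil_zero [simp]: "bil 0 v = 0" "bil v 0 = 0"
  using bil_scaleC_left[of 0 0 v] bil_scaleC_right[of v 0 0] by simp_all

lemma conj_conj [simp]: "conj_l2 (conj_l2 u) = u"
  by transfer (simp add: l2_eq_def)

lemma conj_add: "conj_l2 (u + v) = conj_l2 u + conj_l2 v"
  by transfer (simp add: l2_eq_def square_integrable_add square_integrable_cnj)

lemma conj_scaleC: "conj_l2 (c *\<^sub>C u) = cnj c *\<^sub>C conj_l2 u"
  by transfer (simp add: l2_eq_def square_integrable_cmult square_integrable_cnj)

lemma bil_conj: "bil (conj_l2 u) (conj_l2 v) = cnj (bil u v)"
proof (transfer)
  fix f g assume "l2_eq f f" "l2_eq g g"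
  then have "integrable lborel (\<lambda>x. f x * g x)" by (simp add: l2_eq_def integrable_mult_square_integrable)
  then show "(\<integral>x. cnj (f x) * cnj (g x) \<partial>lborel) = cnj (\<integral>x. f x * g x \<partial>lborel)"
    using integral_bounded_linear[OF bounded_linear_cnj, of lborel "\<lambda>x. f x * g x"] by simp
qed

lemma Re_bil_conj: "Re (bil (conj_l2 u) v) = u \<bullet> v"
proof (transfer)
  fix f g assume "l2_eq f f" "l2_eq g g"
  then have "integrable lborel (\<lambda>x. cnj (f x) * g x)"
    by (simp add: l2_eq_def integrable_mult_square_integrable square_integrable_cnj)
  then show "Re (\<integral>x. cnj (f x) * g x \<partial>lborel) = (\<integral>x. f x \<bullet> g x \<partial>lborel)"
    by (subst integral_Re[symmetric]) (auto simp: inner_complex_def)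
qed

lemma bil_conj_self: "bil (conj_l2 u) u = of_real ((norm u)\<^sup>2)"
proof (rule complex_eqI)
  show "Re (bil (conj_l2 u) u) = Re (of_real ((norm u)\<^sup>2))"
    by (simp add: Re_bil_conj power2_norm_eq_inner)
  have "cnj (bil (conj_l2 u) u) = bil (conj_l2 u) u"
    by (metis bil_conj bil_commute conj_conj)
  then show "Im (bil (conj_l2 u) u) = Im (of_real ((norm u)\<^sup>2))"
    by (metis Im_complex_of_real Reals_cnj_iff complex_is_Real_iff)
qed

lemma norm_conj [simp]: "norm (conj_l2 u) = norm u"
proof -
  have "(norm (conj_l2 u))\<^sup>2 = (norm u)\<^sup>2"
    by (metis bil_conj_self bil_commute conj_conj of_real_eq_iff)
  then show ?thesis by simp
qed

text \<open>The complex conjugate of \<open>u\<close> is an admissible test vector and returns the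
  squared norm.\<close>

lemma bil_separates: "(\<And>v. bil u v = 0) \<Longrightarrow> u = 0"
  by (metis bil_commute bil_conj_self norm_eq_zero of_real_eq_0_iff power_eq_0_iff)

text \<open>A unimodular factor \<open>c\<close> rotates the value onto the positive real axis,
  where it is a real inner product and Cauchy-Schwarz applies.\<close>

lemma norm_bil_le: "cmod (bil u v) \<le> norm u * norm v"
proof (cases "bil u v = 0")
  case False
  define c where "c = cnj (bil u v) / of_real (cmod (bil u v))"
  have c: "cmod c = 1" using False by (simp add: c_def norm_divide)
  have "c * bil u v = bil u v * cnj (bil u v) / of_real (cmod (bil u v))" by (simp add: c_def)
  also have "\<dots> = of_real (cmod (bil u v))"
    using False by (simp add: complex_norm_square[symmetric] power2_eq_square)
  finally have "cmod (bil u v) = Re (c * bil u v)" by simp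
  also have "\<dots> = conj_l2 (c *\<^sub>C u) \<bullet> v"
    by (metis Re_bil_conj bil_scaleC_left conj_conj)
  also have "\<dots> \<le> norm (conj_l2 (c *\<^sub>C u)) * norm v" by (rule norm_cauchy_schwarz)
  finally show ?thesis using c by (simp add: norm_scaleC)
qed simp

section \<open>Gaussian moments and completeness\<close>

lemma gaussian_moment_integrable:
  assumes "0 < c" shows "integrable lborel (\<lambda>x::real. x ^ k * exp (- c * x\<^sup>2))"
proof -
  define \<sigma> where "\<sigma> = sqrt (1 / (2 * c))"
  have \<sigma>: "0 < \<sigma>" "\<sigma>\<^sup>2 = 1 / (2 * c)" using assms by (simp_all add: \<sigma>_def)
  have "integrable lborel (\<lambda>x. sqrt (2 * pi * \<sigma>\<^sup>2) * (normal_density 0 \<sigma> x * (x - 0) ^ k))"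
    by (intro integrable_mult_right integrable_normal_moment \<sigma>)
  moreover have "sqrt (2 * pi * \<sigma>\<^sup>2) * (normal_density 0 \<sigma> x * (x - 0) ^ k) = x ^ k * exp (- c * x\<^sup>2)" for x
    using \<sigma>(1) assms by (simp add: normal_density_def \<sigma>(2))
  ultimately show ?thesis by (simp only:)
qed

lemma norm_abs_l2_square:
  "square_integrable f \<Longrightarrow> (norm (abs_l2 f))\<^sup>2 = (\<integral>x. (cmod (f x))\<^sup>2 \<partial>lborel)"
  by (simp add: power2_norm_eq_inner abs_l2_inner)

lemma ennreal_norm_abs_l2_square:
  "square_integrable f \<Longrightarrow> ennreal ((norm (abs_l2 f))\<^sup>2) = (\<integral>\<^sup>+x. ennreal ((cmod (f x))\<^sup>2) \<partial>lborel)"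
  by (subst nn_integral_eq_integral) (auto simp: norm_abs_l2_square square_integrable_def)

lemma integral_norm_mult_le:
  assumes f: "square_integrable f" and g: "square_integrable g"
  shows "(\<integral>x. cmod (f x * g x) \<partial>lborel) \<le> norm (abs_l2 f) * norm (abs_l2 g)"
proof -
  let ?a = "\<lambda>h x. complex_of_real (cmod (h x))"
  have n: "norm (abs_l2 (?a h)) = norm (abs_l2 h)" if "square_integrable h" for h
  proof -
    have "(norm (abs_l2 (?a h)))\<^sup>2 = (norm (abs_l2 h))\<^sup>2"
      using that by (simp add: norm_abs_l2_square square_integrable_norm)
    then show ?thesis by simp
  qed
  have "(\<integral>x. cmod (f x * g x) \<partial>lborel) = abs_l2 (?a f) \<bullet> abs_l2 (?a g)"
    using f g by (simp add: abs_l2_inner square_integrable_norm inner_complex_def norm_mult)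
  also have "\<dots> \<le> norm (abs_l2 (?a f)) * norm (abs_l2 (?a g))" by (rule norm_cauchy_schwarz)
  finally show ?thesis using f g by (simp add: n)
qed

text \<open>Weighting by a Gaussian makes an \<open>L\<^sup>2\<close> Cauchy sequence Cauchy in \<open>L\<^sup>1\<close>, which yields an
  almost everywhere convergent subsequence.\<close>

instance l2 :: banach
proof
  fix X :: "nat \<Rightarrow> l2" assume X: "Cauchy X"
  define f where "f n = rep_l2 (X n)" for n
  have f: "square_integrable (f n)" "abs_l2 (f n) = X n" for n
    by (simp_all add: f_def square_integrable_rep_l2 abs_rep_l2)
  have [measurable]: "f n \<in> borel_measurable borel" for n
    using f by (simp add: square_integrable_def)
  define G where "G x = complex_of_real (exp (- (x\<^sup>2)))" for x :: real
  have G: "square_integrable G"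
  proof -
    have "integrable lborel (\<lambda>x::real. x ^ 0 * exp (- 2 * x\<^sup>2))"
      by (rule gaussian_moment_integrable) simp
    moreover have "(cmod (G x))\<^sup>2 = x ^ 0 * exp (- 2 * x\<^sup>2)" for x
      by (simp add: G_def norm_exp_eq_Re exp_double[symmetric] power2_eq_square exp_add[symmetric])
    moreover have "G \<in> borel_measurable borel"
      unfolding G_def by (intro borel_measurable_continuous_onI continuous_intros)
    ultimately show ?thesis by (simp add: square_integrable_def)
  qed
  have dist: "norm (abs_l2 (\<lambda>x. f i x - f j x)) = dist (X i) (X j)" for i j
    by (simp add: dist_norm f abs_l2_minus[symmetric])
  obtain r where r: "strict_mono r" "AE x in lborel. Cauchy (\<lambda>i. f (r i) x * G x)"
  proof (rule cauchy_L1_AE_cauchy_subseq[where M = lborel and s = "\<lambda>n x. f n x * G x"])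
    show "integrable lborel (\<lambda>x. f n x * G x)" for n
      by (intro integrable_mult_square_integrable f G)
    fix e :: real assume "0 < e"
    have "0 < norm (abs_l2 G) + 1" by (simp add: add_nonneg_pos)
    then obtain N where N: "\<And>i j. i \<ge> N \<Longrightarrow> j \<ge> N \<Longrightarrow> dist (X i) (X j) < e / (norm (abs_l2 G) + 1)"
      using X \<open>0 < e\<close> unfolding Cauchy_def by (meson divide_pos_pos)
    show "\<exists>N. \<forall>i\<ge>N. \<forall>j\<ge>N. (LINT x|lborel. norm (f i x * G x - f j x * G x)) < e"
    proof (intro exI[of _ N] allI impI)
      fix i j assume ij: "N \<le> i" "N \<le> j"
      have "(LINT x|lborel. norm (f i x * G x - f j x * G x)) \<le> dist (X i) (X j) * norm (abs_l2 G)"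
        using integral_norm_mult_le[OF square_integrable_diff[OF f(1) f(1)] G, of i j]
        by (simp add: dist left_diff_distrib)
      also have "\<dots> \<le> dist (X i) (X j) * (norm (abs_l2 G) + 1)" by (simp add: mult_left_mono)
      also have "\<dots> < e" using N[OF ij] \<open>0 < norm (abs_l2 G) + 1\<close> by (simp add: field_simps)
      finally show "(LINT x|lborel. norm (f i x * G x - f j x * G x)) < e" .
    qed
  qed
  define F where "F x = lim (\<lambda>i. f (r i) x)" for x
  have F_lim: "AE x in lborel. (\<lambda>i. f (r i) x) \<longlonglongrightarrow> F x"
    using r(2)
  proof eventually_elim
    case (elim x)
    then obtain L where "(\<lambda>i. f (r i) x * G x) \<longlonglongrightarrow> L"
      using Cauchy_convergent_iff convergentD by blast
    then have "(\<lambda>i. f (r i) x * G x / G x) \<longlonglongrightarrow> L / G x"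
      by (intro tendsto_divide) (auto simp: G_def)
    then have "(\<lambda>i. f (r i) x) \<longlonglongrightarrow> L / G x" by (simp add: G_def)
    then show ?case unfolding F_def by (metis convergentI convergent_LIMSEQ_iff)
  qed
  have [measurable]: "F \<in> borel_measurable borel"
    unfolding F_def by measurable
  \<comment> \<open>Fatou's lemma along the subsequence turns the Cauchy estimate into square
    integrability of F - f i and into a bound on its norm.\<close>
  have close: "square_integrable (\<lambda>x. F x - f i x) \<and> norm (abs_l2 (\<lambda>x. F x - f i x)) \<le> e"
    if "0 < e" and N: "\<And>i j. i \<ge> N \<Longrightarrow> j \<ge> N \<Longrightarrow> dist (X i) (X j) < e" and "N \<le> i" for e N i
  proof -
    have "(\<integral>\<^sup>+x. ennreal ((cmod (F x - f i x))\<^sup>2) \<partial>lborel)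
        = (\<integral>\<^sup>+x. liminf (\<lambda>j. ennreal ((cmod (f (r j) x - f i x))\<^sup>2)) \<partial>lborel)"
    proof (rule nn_integral_cong_AE)
      show "AE x in lborel. ennreal ((cmod (F x - f i x))\<^sup>2) = liminf (\<lambda>j. ennreal ((cmod (f (r j) x - f i x))\<^sup>2))"
        using F_lim
      proof eventually_elim
        case (elim x)
        then have "(\<lambda>j. ennreal ((cmod (f (r j) x - f i x))\<^sup>2)) \<longlonglongrightarrow> ennreal ((cmod (F x - f i x))\<^sup>2)"
          by (intro tendsto_intros)
        then show ?case by (intro lim_imp_Liminf[symmetric]) auto
      qed
    qed
    also have "\<dots> \<le> liminf (\<lambda>j. \<integral>\<^sup>+x. ennreal ((cmod (f (r j) x - f i x))\<^sup>2) \<partial>lborel)"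
      by (rule nn_integral_liminf) simp
    also have "\<dots> \<le> liminf (\<lambda>j. ennreal (e\<^sup>2))"
    proof (rule Liminf_mono, rule eventually_sequentiallyI[of N])
      fix j assume "N \<le> j"
      then have "N \<le> r j" using seq_suble[OF r(1), of j] by simp
      then have "dist (X (r j)) (X i) \<le> e" using N[of "r j" i] \<open>N \<le> i\<close> by simp
      then have "(norm (abs_l2 (\<lambda>x. f (r j) x - f i x)))\<^sup>2 \<le> e\<^sup>2"
        unfolding dist by (intro power_mono) auto
      then show "(\<integral>\<^sup>+x. ennreal ((cmod (f (r j) x - f i x))\<^sup>2) \<partial>lborel) \<le> ennreal (e\<^sup>2)"
        using ennreal_norm_abs_l2_square[OF square_integrable_diff[OF f(1) f(1)], of "r j" i]
        by (metis ennreal_leI)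
    qed
    also have "\<dots> = ennreal (e\<^sup>2)" by (simp add: Liminf_const)
    finally have le: "(\<integral>\<^sup>+x. ennreal ((cmod (F x - f i x))\<^sup>2) \<partial>lborel) \<le> ennreal (e\<^sup>2)" .
    then have si: "square_integrable (\<lambda>x. F x - f i x)"
      unfolding square_integrable_def
      by (intro conjI integrableI_nonneg) (auto simp: le_less_trans[OF le] intro: le_less_trans)
    moreover have "(norm (abs_l2 (\<lambda>x. F x - f i x)))\<^sup>2 \<le> e\<^sup>2"
      using le \<open>0 < e\<close> by (simp add: ennreal_norm_abs_l2_square[OF si, symmetric])
    then have "norm (abs_l2 (\<lambda>x. F x - f i x)) \<le> e"
      using \<open>0 < e\<close> by (simp add: power2_le_iff_abs_le)
    ultimately show ?thesis by simp
  qed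
  have F: "square_integrable F"
  proof -
    obtain N where "\<And>i j. i \<ge> N \<Longrightarrow> j \<ge> N \<Longrightarrow> dist (X i) (X j) < 1"
      using X unfolding Cauchy_def by (meson zero_less_one)
    then have "square_integrable (\<lambda>x. F x - f N x)" using close[of 1 N N] by simp
    from square_integrable_add[OF this f(1)[of N]] show ?thesis by simp
  qed
  have "X \<longlonglongrightarrow> abs_l2 F"
  proof (rule metric_LIMSEQ_I)
    fix e :: real assume "0 < e"
    then obtain N where N: "\<And>i j. i \<ge> N \<Longrightarrow> j \<ge> N \<Longrightarrow> dist (X i) (X j) < e / 2"
      using X unfolding Cauchy_def by (meson half_gt_zero)
    have "dist (X i) (abs_l2 F) < e" if "N \<le> i" for i
    proof -
      have "dist (X i) (abs_l2 F) = norm (abs_l2 (\<lambda>x. F x - f i x))"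
        by (subst dist_commute) (simp add: dist_norm f(2)[symmetric] abs_l2_minus F f(1))
      also have "\<dots> \<le> e / 2" using close[of "e / 2" N i] N \<open>0 < e\<close> that by simp
      finally show ?thesis using \<open>0 < e\<close> by simp
    qed
    then show "\<exists>N. \<forall>i\<ge>N. dist (X i) (abs_l2 F) < e" by blast
  qed
  then show "convergent X" by (rule convergentI)
qed

section \<open>Weak derivatives\<close>

lemma square_integrable_indicator: "square_integrable (\<lambda>x. indicator {a..b} x)"
proof -
  have "integrable lborel (\<lambda>x::real. indicator {a..b} x :: real)"
    by (cases "a \<le> b") (auto intro!: integrable_real_indicator)
  moreover have "(cmod (indicator {a..b} x))\<^sup>2 = indicator {a..b} x" for x :: real
    by (simp add: indicator_def)
  ultimately show ?thesis by (simp add: square_integrable_def)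
qed

lemma square_integrable_locally_integrable: "square_integrable f \<Longrightarrow> locally_integrable f"
  unfolding locally_integrable_def set_integrable_def
  using integrable_mult_square_integrable[OF square_integrable_indicator, of f]
  by (auto simp: indicator_scaleR_eq_if indicator_times_eq_if)

lemma test_function_deriv: 
  assumes "test_function \<phi>" shows "test_function (deriv \<phi>)"
proof -
  obtain b where b: "\<And>x. b < \<bar>x\<bar> \<Longrightarrow> \<phi> x = 0" and s: "smooth \<phi>"
    using assms by (auto simp: test_function_smooth)
  have "deriv \<phi> x = 0" if "b < \<bar>x\<bar>" for x
  proof -
    have "((\<lambda>_. 0) has_real_derivative 0) (at x)" by simp
    then have "(\<phi> has_real_derivative 0) (at x)"
      by (rule has_field_derivative_transform_within_open[where S = "{y. b < \<bar>y\<bar>}"])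
        (use that b in \<open>auto intro!: open_Collect_less continuous_intros\<close>)
    then show ?thesis by (rule DERIV_imp_deriv)
  qed
  then show ?thesis using smooth_deriv[OF s] unfolding test_function_smooth by blast
qed

text \<open>The product \<phi> f is absolutely continuous with compact support, so its derivative
  integrates to 0.\<close>

lemma integral_test_function_ac_deriv:
  assumes "test_function \<phi>" and f: "ac_deriv f g"
  shows "(\<integral>x. deriv \<phi> x *\<^sub>R f x \<partial>lborel) = - (\<integral>x. \<phi> x *\<^sub>R g x \<partial>lborel)"
proof -
  have \<phi>: "smooth \<phi>" using assms by (simp add: test_function_smooth)
  have "((\<lambda>x. complex_of_real (\<phi> x)) has_vector_derivative of_real (deriv \<phi> x)) (at x)" for x
    by (intro has_vector_derivative_of_real)
      (use smooth_has_derivative[OF \<phi>] in \<open>simp add: has_real_derivative_iff_has_vector_derivative\<close>)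
  then have "ac_deriv (\<lambda>x. complex_of_real (\<phi> x)) (\<lambda>x. of_real (deriv \<phi> x))"
    by (rule ac_deriv_C1) (intro continuous_intros smooth_continuous smooth_deriv \<phi>)
  from ac_deriv_mult[OF this f]
  have ac: "ac_deriv (\<lambda>x. \<phi> x *\<^sub>R f x) (\<lambda>x. \<phi> x *\<^sub>R g x + deriv \<phi> x *\<^sub>R f x)"
    by (simp add: scaleR_conv_of_real mult.commute)
  have i: "integrable lborel (\<lambda>x. \<phi> x *\<^sub>R f x)" "integrable lborel (\<lambda>x. \<phi> x *\<^sub>R g x)"
      "integrable lborel (\<lambda>x. deriv \<phi> x *\<^sub>R f x)"
    using assms integrable_test_function_scaleR test_function_deriv ac_deriv_locally_integrable[OF f]
      locally_integrable_continuous[OF ac_deriv_continuous[OF f]] by blast+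
  have "(\<integral>x. \<phi> x *\<^sub>R g x + deriv \<phi> x *\<^sub>R f x \<partial>lborel) = 0"
    using i by (intro ac_deriv_integral_eq_0[OF ac]) auto
  then show ?thesis using i by (simp add: add_eq_0_iff2 add.commute)
qed

lemma has_weak_derivative_abs_l2:
  "square_integrable f \<Longrightarrow> square_integrable g \<Longrightarrow> abs_l2 f has_weak_derivative abs_l2 g \<longleftrightarrow>
    (\<forall>\<phi>. test_function \<phi> \<longrightarrow> (\<integral>x. deriv \<phi> x *\<^sub>R f x \<partial>lborel) = - (\<integral>x. \<phi> x *\<^sub>R g x \<partial>lborel))"
  by (simp add: has_weak_derivative.abs_eq l2_eq_refl_iff)

lemma ac_deriv_has_weak_derivative:
  "square_integrable f \<Longrightarrow> square_integrable g \<Longrightarrow> ac_deriv f g \<Longrightarrow> abs_l2 f has_weak_derivative abs_l2 g"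
  by (simp add: has_weak_derivative_abs_l2 integral_test_function_ac_deriv)

lemma has_weak_derivative_unique:
  assumes "u has_weak_derivative v" "u has_weak_derivative w"
  shows "v = w"
proof -
  obtain f g h where r: "square_integrable f" "u = abs_l2 f" "square_integrable g" "v = abs_l2 g"
    "square_integrable h" "w = abs_l2 h"
    using l2_cases by metis
  have loc: "locally_integrable g" "locally_integrable h"
    using r by (auto intro: square_integrable_locally_integrable)
  have "AE x in lborel. g x - h x = 0"
  proof (rule AE_zero_if_test_integrals_zero)
    show "locally_integrable (\<lambda>x. g x - h x)"
      using r by (intro square_integrable_locally_integrable square_integrable_diff)
    fix \<phi> assume \<phi>: "test_function \<phi>"
    have "(\<integral>x. \<phi> x *\<^sub>R g x \<partial>lborel) = (\<integral>x. \<phi> x *\<^sub>R h x \<partial>lborel)"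
      using assms \<phi> by (auto simp: r has_weak_derivative_abs_l2)
    then show "(\<integral>x. \<phi> x *\<^sub>R (g x - h x) \<partial>lborel) = 0"
      using \<phi> loc by (simp add: scaleR_diff_right integrable_test_function_scaleR)
  qed
  then show ?thesis by (simp add: r abs_l2_eq_iff)
qed

lemma weak_derivative_eq: "u has_weak_derivative v \<Longrightarrow> weak_derivative u = v"
  unfolding weak_derivative_def using has_weak_derivative_unique by blast

lemma locally_integrable_antiderivative:
  assumes "locally_integrable g" obtains F where "ac_deriv F g"
proof -
  define F where "F x = (if 0 \<le> x then LINT y:{0..x}|lborel. g y else - (LINT y:{x..0}|lborel. g y))" for x
  have split: "(LINT y:{a..c}|lborel. g y) = (LINT y:{a..b}|lborel. g y) + (LINT y:{b..c}|lborel. g y)"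
    if "a \<le> b" "b \<le> c" for a b c
  proof -
    have "AE x in lborel. x \<noteq> b" by (rule AE_lborel_singleton)
    then have "(LINT y:{a..b} \<union> {b..c}|lborel. g y) = (LINT y:{a..b}|lborel. g y) + (LINT y:{b..c}|lborel. g y)"
      using assms by (intro set_integral_Un_AE) (auto simp: locally_integrable_def elim: eventually_mono)
    then show ?thesis using that by (simp add: ivl_disj_un_two_touch)
  qed
  have "F b - F a = (LINT x:{a..b}|lborel. g x)" if "a \<le> b" for a b
    using split[of 0 a b] split[of a 0 b] split[of a b 0] that by (auto simp: F_def)
  then have "ac_deriv F g" using assms by (simp add: ac_deriv_def)
  then show thesis by (rule that)
qed

lemma ac_deriv_add_const: "ac_deriv f g \<Longrightarrow> ac_deriv (\<lambda>x. f x + C) g"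
  by (simp add: ac_deriv_def)

text \<open>A primitive \<open>F\<close> of \<open>g\<close> has the same weak derivative as
  \<open>f\<close>, so f - F is almost everywhere a constant; F plus that constant is the
  representative wanted.\<close>

lemma has_weak_derivative_ac_deriv:
  assumes "u has_weak_derivative v"
  obtains f g where "square_integrable f" "u = abs_l2 f" "square_integrable g" "v = abs_l2 g" "ac_deriv f g"
proof -
  obtain f g where r: "square_integrable f" "u = abs_l2 f" "square_integrable g" "v = abs_l2 g"
    using l2_cases by metis
  have loc: "locally_integrable f" "locally_integrable g"
    using r by (auto intro: square_integrable_locally_integrable)
  obtain F where F: "ac_deriv F g" using locally_integrable_antiderivative[OF loc(2)] .
  have locF: "locally_integrable F"
    by (intro locally_integrable_continuous ac_deriv_continuous[OF F])
  obtain C where C: "AE x in lborel. f x - F x = C"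
  proof (rule du_bois_reymond)
    show "locally_integrable (\<lambda>x. f x - F x)"
      using loc(1) locF unfolding locally_integrable_def by (auto intro: set_integral_diff(1))
    fix \<phi> assume \<phi>: "test_function \<phi>"
    have "(\<integral>x. deriv \<phi> x *\<^sub>R f x \<partial>lborel) = (\<integral>x. deriv \<phi> x *\<^sub>R F x \<partial>lborel)"
      using assms \<phi> integral_test_function_ac_deriv[OF \<phi> F] by (simp add: r has_weak_derivative_abs_l2)
    then show "(\<integral>x. deriv \<phi> x *\<^sub>R (f x - F x) \<partial>lborel) = 0"
      using test_function_deriv[OF \<phi>] loc locF by (simp add: scaleR_diff_right integrable_test_function_scaleR)
  qed
  define f' where "f' x = F x + C" for x
  have ac: "ac_deriv f' g" unfolding f'_def by (rule ac_deriv_add_const[OF F])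
  have ae: "AE x in lborel. f x = f' x" using C by eventually_elim (simp add: f'_def diff_eq_eq add.commute)
  have [measurable]: "f \<in> borel_measurable borel" "f' \<in> borel_measurable borel"
    using r ac_deriv_measurable[OF ac] by (auto simp: square_integrable_def)
  have "integrable lborel (\<lambda>x. (cmod (f x))\<^sup>2) \<longleftrightarrow> integrable lborel (\<lambda>x. (cmod (f' x))\<^sup>2)"
    by (rule integrable_cong_AE) (use ae in auto)
  then have "square_integrable f'" using r by (simp add: square_integrable_def)
  moreover from this have "u = abs_l2 f'" using r ae by (simp add: abs_l2_eq_iff)
  ultimately show thesis using that r ac by blast
qed

section \<open>The operator domain in terms of representatives\<close>

lemma square_integrable_times_x:
  "f \<in> borel_measurable borel \<Longrightarrow>
    square_integrable (\<lambda>x. of_real x * f x) \<longleftrightarrow> integrable lborel (\<lambda>x. x\<^sup>2 * (cmod (f x))\<^sup>2)"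
  by (simp add: square_integrable_def norm_mult power_mult_distrib)

lemma in_weighted_l2_abs_l2:
  "square_integrable f \<Longrightarrow> in_weighted_l2 (abs_l2 f) \<longleftrightarrow> square_integrable (\<lambda>x. of_real x * f x)"
  by (subst square_integrable_times_x) (auto simp: square_integrable_def in_weighted_l2.abs_eq l2_eq_def)

lemma multiply_by_x_abs_l2:
  assumes "square_integrable f" "square_integrable (\<lambda>x. of_real x * f x)"
  shows "multiply_by_x (abs_l2 f) = abs_l2 (\<lambda>x. of_real x * f x)"
proof -
  have "integrable lborel (\<lambda>x. x\<^sup>2 * (cmod (f x))\<^sup>2)"
    using assms square_integrable_times_x[of f] by (simp add: square_integrable_def)
  then show ?thesis using assms by (simp add: multiply_by_x.abs_eq l2_eq_refl_iff)
qed

lemma domain_D_I: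
  assumes "square_integrable f" "square_integrable g" "square_integrable (\<lambda>x. of_real x * f x)" "ac_deriv f g"
  shows "abs_l2 f \<in> domain_D" "weak_derivative (abs_l2 f) = abs_l2 g"
    "multiply_by_x (abs_l2 f) = abs_l2 (\<lambda>x. of_real x * f x)"
proof -
  have d: "abs_l2 f has_weak_derivative abs_l2 g" using assms by (intro ac_deriv_has_weak_derivative)
  then show "weak_derivative (abs_l2 f) = abs_l2 g" by (rule weak_derivative_eq)
  show "multiply_by_x (abs_l2 f) = abs_l2 (\<lambda>x. of_real x * f x)"
    using assms by (intro multiply_by_x_abs_l2)
  show "abs_l2 f \<in> domain_D"
    using d assms by (auto simp: domain_D_def sobolev_H1_def in_weighted_l2_abs_l2)
qed

text \<open>Together with \<open>domain_D_I\<close> this moves between classes in \<open>l2\<close>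
  and functions; every statement about \<open>domain_D\<close> below passes through this
  pair.\<close>

lemma domain_D_E:
  assumes "u \<in> domain_D"
  obtains f g where "square_integrable f" "square_integrable g" "square_integrable (\<lambda>x. of_real x * f x)"
    "ac_deriv f g" "u = abs_l2 f" "weak_derivative u = abs_l2 g" "multiply_by_x u = abs_l2 (\<lambda>x. of_real x * f x)"
proof -
  from assms obtain v where v: "u has_weak_derivative v" and w: "in_weighted_l2 u"
    by (auto simp: domain_D_def sobolev_H1_def)
  from v obtain f g where fg: "square_integrable f" "u = abs_l2 f" "square_integrable g" "v = abs_l2 g" "ac_deriv f g"
    by (rule has_weak_derivative_ac_deriv)
  then have "square_integrable (\<lambda>x. of_real x * f x)" using w by (simp add: in_weighted_l2_abs_l2)
  then show thesis using fg by (intro that[of f g]) (auto simp: domain_D_I)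
qed

lemma ac_deriv_add: "ac_deriv f g \<Longrightarrow> ac_deriv h k \<Longrightarrow> ac_deriv (\<lambda>x. f x + h x) (\<lambda>x. g x + k x)"
  by (auto simp: ac_deriv_def locally_integrable_add locally_integrable_def set_integral_add(2) add_diff_add)

lemma ac_deriv_cmult: "ac_deriv f g \<Longrightarrow> ac_deriv (\<lambda>x. c * f x) (\<lambda>x. c * g x)"
  by (auto simp: ac_deriv_def locally_integrable_def right_diff_distrib[symmetric])

lemma ac_deriv_cnj: 
  assumes "ac_deriv f g" shows "ac_deriv (\<lambda>x. cnj (f x)) (\<lambda>x. cnj (g x))"
  unfolding ac_deriv_def locally_integrable_def
proof (intro conjI allI impI)
  have i: "integrable lborel (\<lambda>x. indicator {a..b} x *\<^sub>R g x)" for a b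
    using assms by (simp add: ac_deriv_def locally_integrable_def set_integrable_def)
  show "set_integrable lborel {a..b} (\<lambda>x. cnj (g x))" for a b
    unfolding set_integrable_def using integrable_bounded_linear[OF bounded_linear_cnj i[of a b]] by simp
  show "cnj (f b) - cnj (f a) = (LINT x:{a..b}|lborel. cnj (g x))" if "a \<le> b" for a b
    using integral_bounded_linear[OF bounded_linear_cnj i[of a b]] ac_deriv_eq[OF assms that]
    by (simp add: set_lebesgue_integral_def)
qed

lemma ac_deriv_of_real: "ac_deriv (\<lambda>x. complex_of_real x) (\<lambda>_. 1)"
  by (rule ac_deriv_C1) (auto intro!: derivative_eq_intros simp: has_vector_derivative_def scaleR_conv_of_real)

lemma domain_D_add:
  assumes "u \<in> domain_D" "v \<in> domain_D"
  shows "u + v \<in> domain_D" "weak_derivative (u + v) = weak_derivative u + weak_derivative v"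
    "multiply_by_x (u + v) = multiply_by_x u + multiply_by_x v"
proof -
  from assms(1) obtain f g where 1: "square_integrable f" "square_integrable g" "square_integrable (\<lambda>x. of_real x * f x)"
    "ac_deriv f g" "u = abs_l2 f" "weak_derivative u = abs_l2 g" "multiply_by_x u = abs_l2 (\<lambda>x. of_real x * f x)"
    by (rule domain_D_E)
  from assms(2) obtain h k where 2: "square_integrable h" "square_integrable k" "square_integrable (\<lambda>x. of_real x * h x)"
    "ac_deriv h k" "v = abs_l2 h" "weak_derivative v = abs_l2 k" "multiply_by_x v = abs_l2 (\<lambda>x. of_real x * h x)"
    by (rule domain_D_E)
  have x: "of_real x * (f x + h x) = of_real x * f x + of_real x * h x" for x by (rule distrib_left)
  have s: "square_integrable (\<lambda>x. f x + h x)" "square_integrable (\<lambda>x. g x + k x)"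
    "square_integrable (\<lambda>x. of_real x * (f x + h x))" "ac_deriv (\<lambda>x. f x + h x) (\<lambda>x. g x + k x)"
    unfolding x using 1 2 by (auto intro: square_integrable_add ac_deriv_add)
  have e: "u + v = abs_l2 (\<lambda>x. f x + h x)" using 1 2 by (simp add: abs_l2_plus)
  show "u + v \<in> domain_D" "weak_derivative (u + v) = weak_derivative u + weak_derivative v"
    "multiply_by_x (u + v) = multiply_by_x u + multiply_by_x v"
    using domain_D_I[OF s] 1 2 unfolding e x by (auto simp: abs_l2_plus)
qed

lemma domain_D_scaleC:
  assumes "u \<in> domain_D"
  shows "c *\<^sub>C u \<in> domain_D" "weak_derivative (c *\<^sub>C u) = c *\<^sub>C weak_derivative u"
    "multiply_by_x (c *\<^sub>C u) = c *\<^sub>C multiply_by_x u"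
proof -
  from assms(1) obtain f g where 1: "square_integrable f" "square_integrable g" "square_integrable (\<lambda>x. of_real x * f x)"
    "ac_deriv f g" "u = abs_l2 f" "weak_derivative u = abs_l2 g" "multiply_by_x u = abs_l2 (\<lambda>x. of_real x * f x)"
    by (rule domain_D_E)
  have x: "of_real x * (c * f x) = c * (of_real x * f x)" for x by simp
  have s: "square_integrable (\<lambda>x. c * f x)" "square_integrable (\<lambda>x. c * g x)"
    "square_integrable (\<lambda>x. of_real x * (c * f x))" "ac_deriv (\<lambda>x. c * f x) (\<lambda>x. c * g x)"
    unfolding x using 1 by (auto intro: square_integrable_cmult ac_deriv_cmult)
  have e: "c *\<^sub>C u = abs_l2 (\<lambda>x. c * f x)" using 1 by (simp add: abs_l2_scaleC)
  show "c *\<^sub>C u \<in> domain_D" "weak_derivative (c *\<^sub>C u) = c *\<^sub>C weak_derivative u"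
    "multiply_by_x (c *\<^sub>C u) = c *\<^sub>C multiply_by_x u"
    using domain_D_I[OF s] 1 unfolding e x by (auto simp: abs_l2_scaleC)
qed

lemma domain_D_conj:
  assumes "u \<in> domain_D"
  shows "conj_l2 u \<in> domain_D" "weak_derivative (conj_l2 u) = conj_l2 (weak_derivative u)"
    "multiply_by_x (conj_l2 u) = conj_l2 (multiply_by_x u)"
proof -
  from assms(1) obtain f g where 1: "square_integrable f" "square_integrable g" "square_integrable (\<lambda>x. of_real x * f x)"
    "ac_deriv f g" "u = abs_l2 f" "weak_derivative u = abs_l2 g" "multiply_by_x u = abs_l2 (\<lambda>x. of_real x * f x)"
    by (rule domain_D_E)
  have x: "of_real x * cnj (f x) = cnj (of_real x * f x)" for x by simp
  have s: "square_integrable (\<lambda>x. cnj (f x))" "square_integrable (\<lambda>x. cnj (g x))"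
    "square_integrable (\<lambda>x. of_real x * cnj (f x))" "ac_deriv (\<lambda>x. cnj (f x)) (\<lambda>x. cnj (g x))"
    unfolding x using 1 by (auto intro: square_integrable_cnj ac_deriv_cnj simp del: complex_cnj_mult)
  have e: "conj_l2 u = abs_l2 (\<lambda>x. cnj (f x))" using 1 by (simp add: abs_l2_conj)
  show "conj_l2 u \<in> domain_D" "weak_derivative (conj_l2 u) = conj_l2 (weak_derivative u)"
    "multiply_by_x (conj_l2 u) = conj_l2 (multiply_by_x u)"
    using domain_D_I[OF s] 1 unfolding e x by (auto simp: abs_l2_conj)
qed

text \<open>Integrate the derivative of the product f h, which is integrable by
  Cauchy-Schwarz.\<close>

lemma bil_weak_derivative:
  assumes "u \<in> domain_D" "v \<in> domain_D"
  shows "bil u (weak_derivative v) = - bil (weak_derivative u) v"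
proof -
  from assms(1) obtain f g where 1: "square_integrable f" "square_integrable g"
    "ac_deriv f g" "u = abs_l2 f" "weak_derivative u = abs_l2 g"
    by (rule domain_D_E)
  from assms(2) obtain h k where 2: "square_integrable h" "square_integrable k"
    "ac_deriv h k" "v = abs_l2 h" "weak_derivative v = abs_l2 k"
    by (rule domain_D_E)
  note i = integrable_mult_square_integrable
  have "(\<integral>x. f x * k x + h x * g x \<partial>lborel) = 0"
    using 1 2 by (intro ac_deriv_integral_eq_0[OF ac_deriv_mult[OF 1(3) 2(3)]]) (auto intro: i)
  then have "(\<integral>x. f x * k x \<partial>lborel) + (\<integral>x. h x * g x \<partial>lborel) = 0"
    using 1 2 by (simp add: i)
  then show ?thesis using 1 2 by (simp add: abs_l2_bil mult.commute eq_neg_iff_add_eq_0)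
qed

lemma bil_multiply_by_x:
  assumes "u \<in> domain_D" "v \<in> domain_D"
  shows "bil (multiply_by_x u) v = bil u (multiply_by_x v)"
proof -
  from assms(1) obtain f where 1: "square_integrable f" "square_integrable (\<lambda>x. of_real x * f x)"
    "u = abs_l2 f" "multiply_by_x u = abs_l2 (\<lambda>x. of_real x * f x)"
    by (rule domain_D_E)
  from assms(2) obtain h where 2: "square_integrable h" "square_integrable (\<lambda>x. of_real x * h x)"
    "v = abs_l2 h" "multiply_by_x v = abs_l2 (\<lambda>x. of_real x * h x)"
    by (rule domain_D_E)
  show ?thesis using 1 2 by (simp add: abs_l2_bil ac_simps)
qed

text \<open>The canonical commutation relation in weak form, from integrating the derivative of x f
  h. Each term pairs two square-integrable functions, so x may fall on one factor and the derivative
  on the other without leaving \<open>domain_D\<close>.\<close>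

lemma bil_multiply_by_x_weak_derivative:
  assumes "u \<in> domain_D" "v \<in> domain_D"
  shows "bil (multiply_by_x u) (weak_derivative v) + bil (weak_derivative u) (multiply_by_x v) = - bil u v"
proof -
  from assms(1) obtain f g where 1: "square_integrable f" "square_integrable g" "square_integrable (\<lambda>x. of_real x * f x)"
    "ac_deriv f g" "u = abs_l2 f" "weak_derivative u = abs_l2 g" "multiply_by_x u = abs_l2 (\<lambda>x. of_real x * f x)"
    by (rule domain_D_E)
  from assms(2) obtain h k where 2: "square_integrable h" "square_integrable k" "square_integrable (\<lambda>x. of_real x * h x)"
    "ac_deriv h k" "v = abs_l2 h" "weak_derivative v = abs_l2 k" "multiply_by_x v = abs_l2 (\<lambda>x. of_real x * h x)"
    by (rule domain_D_E)
  note i = integrable_mult_square_integrable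
  have int: "integrable lborel (\<lambda>x. of_real x * f x * h x)" "integrable lborel (\<lambda>x. of_real x * f x * k x)"
    "integrable lborel (\<lambda>x. g x * (of_real x * h x))" "integrable lborel (\<lambda>x. f x * h x)"
    using 1 2 by (auto intro: i)
  have G: "of_real x * f x * k x + h x * (of_real x * g x + f x * 1)
      = (of_real x * f x * k x + g x * (of_real x * h x)) + f x * h x" for x
    by (simp add: algebra_simps)
  have "(\<integral>x. (of_real x * f x * k x + g x * (of_real x * h x)) + f x * h x \<partial>lborel) = 0"
    using int by (intro ac_deriv_integral_eq_0[OF ac_deriv_mult[OF ac_deriv_mult[OF ac_deriv_of_real 1(4)] 2(4), unfolded G]]) auto
  then have "(\<integral>x. of_real x * f x * k x \<partial>lborel) + (\<integral>x. g x * (of_real x * h x) \<partial>lborel)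
      + (\<integral>x. f x * h x \<partial>lborel) = 0"
    using int by simp
  then show ?thesis using 1 2 by (simp add: abs_l2_bil eq_neg_iff_add_eq_0)
qed

section \<open>Schur test and explicit solutions of the first-order equations\<close>

text \<open>Split K as sqrt K times sqrt K, apply Cauchy-Schwarz in y using the row bound, then
  exchange the integrals and use the column bound. Only a pointwise domination of \<open>u\<close>
  is required, so it applies to solutions that are already at hand.\<close>

lemma Schur_test:
  fixes K :: "real \<Rightarrow> real \<Rightarrow> real"
  assumes [measurable]: "case_prod K \<in> borel_measurable (borel \<Otimes>\<^sub>M borel)" and K0: "\<And>x y. 0 \<le> K x y"
    and row: "\<And>x. (\<integral>\<^sup>+y. ennreal (K x y) \<partial>lborel) \<le> ennreal \<alpha>"
    and col: "\<And>y. (\<integral>\<^sup>+x. ennreal (K x y) \<partial>lborel) \<le> ennreal \<beta>"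
    and ab: "0 \<le> \<alpha>" "0 \<le> \<beta>"
    and f: "square_integrable f" and [measurable]: "u \<in> borel_measurable borel"
    and u: "AE x in lborel. ennreal (cmod (u x)) \<le> (\<integral>\<^sup>+y. ennreal (K x y * cmod (f y)) \<partial>lborel)"
  shows "square_integrable u" "norm (abs_l2 u) \<le> sqrt (\<alpha> * \<beta>) * norm (abs_l2 f)"
proof -
  have [measurable]: "f \<in> borel_measurable borel" using f by (simp add: square_integrable_def)
  have [measurable]: "K x \<in> borel_measurable borel" "(\<lambda>x. K x y) \<in> borel_measurable borel" for x y
    using measurable_Pair2[OF assms(1)] measurable_Pair1[OF assms(1)] by auto
  define N where "N = (\<integral>x. (cmod (f x))\<^sup>2 \<partial>lborel)"
  have N: "N = (norm (abs_l2 f))\<^sup>2" using f by (simp add: N_def norm_abs_l2_square)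
  have "(\<integral>\<^sup>+x. ennreal ((cmod (u x))\<^sup>2) \<partial>lborel)
      \<le> (\<integral>\<^sup>+x. ennreal \<alpha> * (\<integral>\<^sup>+y. ennreal (K x y * (cmod (f y))\<^sup>2) \<partial>lborel) \<partial>lborel)"
  proof (rule nn_integral_mono_AE, use u in eventually_elim)
    fix x assume ux: "ennreal (cmod (u x)) \<le> (\<integral>\<^sup>+y. ennreal (K x y * cmod (f y)) \<partial>lborel)"
    have "ennreal ((cmod (u x))\<^sup>2) = (ennreal (cmod (u x)))\<^sup>2" by (simp add: ennreal_power)
    also have "\<dots> \<le> (\<integral>\<^sup>+y. ennreal (K x y * cmod (f y)) \<partial>lborel)\<^sup>2" using ux by (rule power_mono) simp
    also have "(\<integral>\<^sup>+y. ennreal (K x y * cmod (f y)) \<partial>lborel)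
        = (\<integral>\<^sup>+y. ennreal (sqrt (K x y)) * ennreal (sqrt (K x y) * cmod (f y)) \<partial>lborel)"
      by (intro nn_integral_cong) (simp add: K0 ennreal_mult[symmetric] mult.assoc[symmetric])
    also have "\<dots>\<^sup>2 \<le> (\<integral>\<^sup>+y. (ennreal (sqrt (K x y)))\<^sup>2 \<partial>lborel)
        * (\<integral>\<^sup>+y. (ennreal (sqrt (K x y) * cmod (f y)))\<^sup>2 \<partial>lborel)"
      by (rule Cauchy_Schwarz_nn_integral) measurable
    also have "\<dots> = (\<integral>\<^sup>+y. ennreal (K x y) \<partial>lborel) * (\<integral>\<^sup>+y. ennreal (K x y * (cmod (f y))\<^sup>2) \<partial>lborel)"
      by (simp add: ennreal_power K0 power_mult_distrib)
    also have "\<dots> \<le> ennreal \<alpha> * (\<integral>\<^sup>+y. ennreal (K x y * (cmod (f y))\<^sup>2) \<partial>lborel)"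
      by (rule mult_right_mono[OF row]) simp
    finally show "ennreal ((cmod (u x))\<^sup>2) \<le> ennreal \<alpha> * (\<integral>\<^sup>+y. ennreal (K x y * (cmod (f y))\<^sup>2) \<partial>lborel)" .
  qed
  also have "\<dots> = ennreal \<alpha> * (\<integral>\<^sup>+x. (\<integral>\<^sup>+y. ennreal (K x y * (cmod (f y))\<^sup>2) \<partial>lborel) \<partial>lborel)"
    by (rule nn_integral_cmult) measurable
  also have "(\<integral>\<^sup>+x. (\<integral>\<^sup>+y. ennreal (K x y * (cmod (f y))\<^sup>2) \<partial>lborel) \<partial>lborel)
      = (\<integral>\<^sup>+y. (\<integral>\<^sup>+x. ennreal (K x y * (cmod (f y))\<^sup>2) \<partial>lborel) \<partial>lborel)"
    by (rule lborel_pair.Fubini'[symmetric]) measurable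
  also have "\<dots> \<le> (\<integral>\<^sup>+y. ennreal \<beta> * ennreal ((cmod (f y))\<^sup>2) \<partial>lborel)"
  proof (rule nn_integral_mono)
    fix y
    have "(\<integral>\<^sup>+x. ennreal (K x y * (cmod (f y))\<^sup>2) \<partial>lborel) = (\<integral>\<^sup>+x. ennreal (K x y) \<partial>lborel) * ennreal ((cmod (f y))\<^sup>2)"
      by (simp add: ennreal_mult K0 nn_integral_multc)
    also have "\<dots> \<le> ennreal \<beta> * ennreal ((cmod (f y))\<^sup>2)" by (rule mult_right_mono[OF col]) simp
    finally show "(\<integral>\<^sup>+x. ennreal (K x y * (cmod (f y))\<^sup>2) \<partial>lborel) \<le> ennreal \<beta> * ennreal ((cmod (f y))\<^sup>2)" .
  qed
  also have "\<dots> = ennreal \<beta> * ennreal N"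
    using ennreal_norm_abs_l2_square[OF f] by (simp add: nn_integral_cmult N)
  finally have le: "(\<integral>\<^sup>+x. ennreal ((cmod (u x))\<^sup>2) \<partial>lborel) \<le> ennreal (\<alpha> * \<beta> * N)"
    using ab by (simp add: ennreal_mult N mult.assoc mult_left_mono)
  show si: "square_integrable u"
    unfolding square_integrable_def by (intro conjI integrableI_nonneg) (auto intro: le_less_trans[OF le])
  have "(norm (abs_l2 u))\<^sup>2 \<le> \<alpha> * \<beta> * N"
    using le ab N by (simp add: ennreal_norm_abs_l2_square[OF si, symmetric])
  then have "sqrt ((norm (abs_l2 u))\<^sup>2) \<le> sqrt (\<alpha> * \<beta> * N)" by (rule real_sqrt_le_mono)
  then show "norm (abs_l2 u) \<le> sqrt (\<alpha> * \<beta>) * norm (abs_l2 f)"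
    by (simp add: N real_sqrt_mult)
qed

text \<open>The value \<open>y = 0\<close> is excluded, so that every column is supported on one half-line.\<close>

definition gauss_kernel :: "real \<Rightarrow> real \<Rightarrow> real \<Rightarrow> real" where
  "gauss_kernel c x y = (if 0 < y \<and> y \<le> x \<or> x \<le> y \<and> y < 0 then exp (- c * (x\<^sup>2 - y\<^sup>2) / 2) else 0)"

lemma gauss_kernel_nonneg: "0 \<le> gauss_kernel c x y"
  by (simp add: gauss_kernel_def)

lemma gauss_kernel_minus: "gauss_kernel c (- x) (- y) = gauss_kernel c x y"
  by (auto simp: gauss_kernel_def)

lemma gauss_kernel_measurable [measurable]: "case_prod (gauss_kernel c) \<in> borel_measurable (borel \<Otimes>\<^sub>M borel)"
  unfolding gauss_kernel_def[abs_def] by measurable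

lemma gauss_kernel_measurable1 [measurable]:
  "(\<lambda>x. gauss_kernel c x y) \<in> borel_measurable borel" "gauss_kernel c x \<in> borel_measurable borel"
  unfolding gauss_kernel_def[abs_def] by measurable

lemma nn_integral_gaussian:
  assumes "0 < c"
  shows "(\<integral>\<^sup>+y. ennreal (exp (- c * (x - y)\<^sup>2 / 2)) \<partial>lborel) = ennreal (sqrt (2 * pi / c))"
proof -
  define \<sigma> where "\<sigma> = sqrt (1 / c)"
  have \<sigma>: "0 < \<sigma>" "\<sigma>\<^sup>2 = 1 / c" using assms by (simp_all add: \<sigma>_def)
  have "exp (- c * (x - y)\<^sup>2 / 2) = sqrt (2 * pi / c) * normal_density x \<sigma> y" for y
    using assms by (simp add: normal_density_def \<sigma>(2) power2_commute)
  moreover have "(\<integral>\<^sup>+y. ennreal (normal_density x \<sigma> y) \<partial>lborel) = 1"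
    using \<sigma>(1) by (subst nn_integral_eq_integral) (auto simp: integral_normal_density)
  ultimately show ?thesis
    using assms by (simp add: ennreal_mult nn_integral_cmult)
qed

text \<open>On the support, x and y have the same sign and |y| \<le> |x|, hence (x - y)^2 \<le> x^2
  - y^2. The kernel lies below a Gaussian convolution kernel, which settles rows and columns at
  once.\<close>

lemma gauss_kernel_le: "0 < c \<Longrightarrow> gauss_kernel c x y \<le> exp (- c * (x - y)\<^sup>2 / 2)"
proof -
  assume c: "0 < c"
  have "(x - y)\<^sup>2 \<le> x\<^sup>2 - y\<^sup>2" if "0 < y \<and> y \<le> x \<or> x \<le> y \<and> y < 0"
  proof -
    have "0 \<le> y * (x - y)" using that by (auto simp: zero_le_mult_iff)
    then show ?thesis by (simp add: power2_eq_square algebra_simps)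
  qed
  then show ?thesis using c by (auto simp: gauss_kernel_def)
qed

lemma nn_integral_gauss_kernel:
  assumes "0 < c"
  shows "(\<integral>\<^sup>+y. ennreal (gauss_kernel c x y) \<partial>lborel) \<le> ennreal (sqrt (2 * pi / c))"
    "(\<integral>\<^sup>+x. ennreal (gauss_kernel c x y) \<partial>lborel) \<le> ennreal (sqrt (2 * pi / c))"
proof -
  show "(\<integral>\<^sup>+y. ennreal (gauss_kernel c x y) \<partial>lborel) \<le> ennreal (sqrt (2 * pi / c))"
    unfolding nn_integral_gaussian[OF assms, of x, symmetric]
    by (intro nn_integral_mono ennreal_leI gauss_kernel_le assms)
  show "(\<integral>\<^sup>+x. ennreal (gauss_kernel c x y) \<partial>lborel) \<le> ennreal (sqrt (2 * pi / c))"
    unfolding nn_integral_gaussian[OF assms, of y, symmetric]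
    by (intro nn_integral_mono ennreal_leI order_trans[OF gauss_kernel_le])
      (auto simp: assms power2_commute)
qed

lemma nn_integral_uminus:
  fixes h :: "real \<Rightarrow> ennreal"
  assumes [measurable]: "h \<in> borel_measurable borel"
  shows "(\<integral>\<^sup>+x. h (- x) \<partial>lborel) = (\<integral>\<^sup>+x. h x \<partial>lborel)"
proof -
  have "(\<integral>\<^sup>+x. h x \<partial>lborel) = (\<integral>\<^sup>+x. h x \<partial>distr lborel borel uminus)"
    by (simp add: lborel_distr_uminus)
  also have "\<dots> = (\<integral>\<^sup>+x. h (- x) \<partial>lborel)" by (rule nn_integral_distr) auto
  finally show ?thesis by simp
qed

text \<open>The weight x makes the Gaussian an exact derivative, which gives 1/c on either
  half-line. The weighted bounds put x times the solution into the square-integrable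
  functions.\<close>

lemma nn_integral_gauss_kernel_weighted_col:
  assumes "0 < c"
  shows "(\<integral>\<^sup>+x. ennreal (\<bar>x\<bar> * gauss_kernel c x y) \<partial>lborel) \<le> ennreal (1 / c)"
proof -
  have pos: "(\<integral>\<^sup>+x. ennreal (\<bar>x\<bar> * gauss_kernel c x y) \<partial>lborel) \<le> ennreal (1 / c)" if "0 < y" for y
  proof -
    have "(\<integral>\<^sup>+x. ennreal (\<bar>x\<bar> * gauss_kernel c x y) \<partial>lborel)
        = (\<integral>\<^sup>+x. ennreal (x * exp (- c * (x\<^sup>2 - y\<^sup>2) / 2)) * indicator {y..} x \<partial>lborel)"
      using that by (intro nn_integral_cong) (auto simp: gauss_kernel_def indicator_def)
    also have "\<dots> = ennreal (0 - (- (1 / c) * exp (- c * (y\<^sup>2 - y\<^sup>2) / 2)))"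
    proof (rule nn_integral_FTC_atLeast[where F = "\<lambda>x. - (1 / c) * exp (- c * (x\<^sup>2 - y\<^sup>2) / 2)"])
      show "((\<lambda>x. - (1 / c) * exp (- c * (x\<^sup>2 - y\<^sup>2) / 2)) has_real_derivative
          x * exp (- c * (x\<^sup>2 - y\<^sup>2) / 2)) (at x)" for x
        using assms by (auto intro!: derivative_eq_intros simp: power2_eq_square)
      show "((\<lambda>x. - (1 / c) * exp (- c * (x\<^sup>2 - y\<^sup>2) / 2)) \<longlongrightarrow> 0) at_top"
        using assms by real_asymp
    qed (use that in auto)
    finally show ?thesis by simp
  qed
  consider "0 < y" | "y = 0" | "y < 0" by linarith
  then show ?thesis
  proof cases
    case 3
    have "(\<integral>\<^sup>+x. ennreal (\<bar>- x\<bar> * gauss_kernel c (- x) y) \<partial>lborel) = (\<integral>\<^sup>+x. ennreal (\<bar>x\<bar> * gauss_kernel c x (- y)) \<partial>lborel)"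
      using gauss_kernel_minus[of c _ "- y"] by simp
    also have "\<dots> \<le> ennreal (1 / c)" by (rule pos) (use 3 in simp)
    finally show ?thesis
      by (subst (asm) nn_integral_uminus[where h = "\<lambda>x. ennreal (\<bar>x\<bar> * gauss_kernel c x y)"]) auto
  qed (use pos in \<open>auto simp: gauss_kernel_def\<close>)
qed

lemma nn_integral_gauss_kernel_weighted_row:
  assumes "0 < c"
  shows "(\<integral>\<^sup>+y. ennreal (\<bar>x\<bar> * gauss_kernel c x y) \<partial>lborel) \<le> ennreal (2 / c)"
proof -
  have pos: "(\<integral>\<^sup>+y. ennreal (\<bar>x\<bar> * gauss_kernel c x y) \<partial>lborel) \<le> ennreal (2 / c)" if "0 \<le> x" for x
  proof -
    have "(\<integral>\<^sup>+y. ennreal (\<bar>x\<bar> * gauss_kernel c x y) \<partial>lborel)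
        \<le> (\<integral>\<^sup>+y. ennreal (x * exp (- c * (x * (x - y)) / 2)) * indicator {0..x} y \<partial>lborel)"
    proof (rule nn_integral_mono)
      fix y
      \<comment> \<open>Replacing the quadratic exponent by one linear in y makes the row integral
        explicit; this costs the factor 2 in 2/c.\<close>
      have "x * (x - y) \<le> x\<^sup>2 - y\<^sup>2" if "0 < y" "y \<le> x"
        using mult_nonneg_nonneg[of y "x - y"] that by (simp add: power2_eq_square algebra_simps)
      then show "ennreal (\<bar>x\<bar> * gauss_kernel c x y)
          \<le> ennreal (x * exp (- c * (x * (x - y)) / 2)) * indicator {0..x} y"
        using that assms by (auto simp: gauss_kernel_def indicator_def intro!: ennreal_leI mult_left_mono)
    qed
    also have "\<dots> = ennreal (2 / c * exp (- c * (x * (x - x)) / 2) - 2 / c * exp (- c * (x * (x - 0)) / 2))"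
    proof (rule nn_integral_FTC_Icc[where F = "\<lambda>y. 2 / c * exp (- c * (x * (x - y)) / 2)"])
      show "((\<lambda>y. 2 / c * exp (- c * (x * (x - y)) / 2)) has_real_derivative
          x * exp (- c * (x * (x - y)) / 2)) (at y)" for y
        using assms by (auto intro!: derivative_eq_intros)
    qed (use that in auto)
    also have "\<dots> \<le> ennreal (2 / c)" using assms by (intro ennreal_leI) simp
    finally show ?thesis .
  qed
  show ?thesis
  proof (cases "0 \<le> x")
    case False
    have "(\<integral>\<^sup>+y. ennreal (\<bar>x\<bar> * gauss_kernel c x (- y)) \<partial>lborel) = (\<integral>\<^sup>+y. ennreal (\<bar>- x\<bar> * gauss_kernel c (- x) y) \<partial>lborel)"
      using gauss_kernel_minus[of c "- x"] by simp
    also have "\<dots> \<le> ennreal (2 / c)" by (rule pos) (use False in simp)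
    finally show ?thesis
      by (subst (asm) nn_integral_uminus[where h = "\<lambda>y. ennreal (\<bar>x\<bar> * gauss_kernel c x y)"]) auto
  qed (rule pos)
qed


section \<open>Integrating factors and variation of constants\<close>

definition gauss :: "complex \<Rightarrow> real \<Rightarrow> complex" where
  "gauss w x = exp (- w * (of_real x)\<^sup>2 / 2)"

lemma gauss_inverse: "gauss w x * gauss (- w) x = 1"
  by (simp add: gauss_def exp_add[symmetric])

lemma norm_gauss: "cmod (gauss w x) = exp (- Re w * x\<^sup>2 / 2)"
  by (simp add: gauss_def norm_exp_eq_Re power2_eq_square)

lemma gauss_continuous: "continuous_on A (gauss w)"
  unfolding gauss_def by (intro continuous_intros) auto

lemma ac_deriv_gauss: "ac_deriv (gauss w) (\<lambda>x. - w * of_real x * gauss w x)"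
proof (rule ac_deriv_C1)
  fix x :: real
  have "((\<lambda>z. exp (- w * z\<^sup>2 / 2)) has_field_derivative - w * of_real x * gauss w x) (at (of_real x))"
    by (auto intro!: derivative_eq_intros simp: gauss_def)
  from field_vector_diff_chain_at[OF has_vector_derivative_of_real[OF DERIV_ident[unfolded has_real_derivative_iff_has_vector_derivative]] this]
  show "(gauss w has_vector_derivative - w * of_real x * gauss w x) (at x)"
    by (simp add: gauss_def[abs_def] o_def)
qed (intro continuous_intros gauss_continuous)

lemma square_integrable_gauss:
  assumes "0 < Re w" shows "square_integrable (\<lambda>x. of_real x ^ k * gauss w x)"
proof -
  have "(cmod (of_real x ^ k * gauss w x))\<^sup>2 = x ^ (2 * k) * exp (- Re w * x\<^sup>2)" for x
    by (simp add: norm_mult norm_power norm_gauss power_mult_distrib exp_double[symmetric] power_mult[symmetric]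
        power_even_abs mult.commute[of k])
  moreover have "(\<lambda>x. of_real x ^ k * gauss w x) \<in> borel_measurable borel"
    by (intro borel_measurable_continuous_onI continuous_intros gauss_continuous)
  ultimately show ?thesis
    unfolding square_integrable_def using gaussian_moment_integrable[OF assms, of "2 * k"] by simp
qed

text \<open>Variation of constants for u' + w x u = f: u = \<open>gauss w\<close> times a primitive
  of \<open>gauss (- w) * f\<close>. The homogeneous solution decays, so there is no solvability
  condition.\<close>

lemma solve_annihilation:
  assumes w: "0 < Re w"
  obtains C where "\<And>f. square_integrable f \<Longrightarrow> \<exists>u. ac_deriv u (\<lambda>x. f x - w * of_real x * u x) \<and>
      square_integrable u \<and> square_integrable (\<lambda>x. of_real x * u x) \<and> norm (abs_l2 u) \<le> C * norm (abs_l2 f)"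
proof
  define c where "c = Re w"
  have c: "0 < c" using w by (simp add: c_def)
  \<comment> \<open>Chosen before \<open>f\<close> is fixed, since the constant of the lemma must
    not depend on \<open>f\<close>.\<close>
  define M where "M = sqrt (2 * pi / c)"
  fix f assume f: "square_integrable f"
  have [measurable]: "f \<in> borel_measurable borel" using f by (simp add: square_integrable_def)
  have loc: "locally_integrable (\<lambda>x. gauss (- w) x * f x)"
    by (intro locally_integrable_mult_continuous gauss_continuous square_integrable_locally_integrable f)
  obtain W0 where "ac_deriv W0 (\<lambda>x. gauss (- w) x * f x)"
    using locally_integrable_antiderivative[OF loc] .
  then have W: "ac_deriv (\<lambda>x. W0 x + (- W0 0)) (\<lambda>x. gauss (- w) x * f x)" by (rule ac_deriv_add_const)
  \<comment> \<open>With W(0) = 0, the value u(x) involves \<open>f\<close> only between 0 and x,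
    where exp(- c (x^2 - y^2) / 2) is at most 1.\<close>
  define W where "W x = W0 x + (- W0 0)" for x
  define u where "u x = gauss w x * W x" for x
  have e: "gauss w x * (gauss (- w) x * f x) + W x * (- w * of_real x * gauss w x) = f x - w * of_real x * u x" for x
  proof -
    have "gauss w x * (gauss (- w) x * f x) = f x"
      by (simp only: mult.assoc[symmetric] gauss_inverse mult_1)
    then show ?thesis by (simp add: u_def)
  qed
  have ac: "ac_deriv u (\<lambda>x. f x - w * of_real x * u x)"
    using ac_deriv_mult[OF ac_deriv_gauss[of w] W] unfolding u_def[symmetric] W_def[symmetric] e .
  note [measurable] = ac_deriv_measurable(1)[OF ac]
  have u: "ennreal (cmod (u x)) \<le> (\<integral>\<^sup>+y. ennreal (gauss_kernel c x y * cmod (f y)) \<partial>lborel)" for x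
  proof -
    define A where "A = (if 0 \<le> x then {0..x} else {x..0})"
    define I where "I = (LINT y:A|lborel. gauss (- w) y * f y)"
    have "W x = I \<or> W x = - I"
      using ac_deriv_eq[OF W, of 0 x] ac_deriv_eq[OF W, of x 0] by (auto simp: W_def A_def I_def)
    then have "cmod (u x) = cmod (gauss w x * I)" by (auto simp: u_def norm_mult)
    also have "gauss w x * I = (\<integral>y. gauss w x * (indicator A y *\<^sub>R (gauss (- w) y * f y)) \<partial>lborel)"
      unfolding I_def set_lebesgue_integral_def by (rule integral_mult_right_zero[symmetric])
    finally have 1: "cmod (u x) = cmod (\<integral>y. gauss w x * (indicator A y *\<^sub>R (gauss (- w) y * f y)) \<partial>lborel)" .
    have "set_integrable lborel A (\<lambda>y. gauss (- w) y * f y)"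
      using loc by (auto simp: A_def locally_integrable_def)
    then have "ennreal (cmod (u x)) \<le> (\<integral>\<^sup>+y. ennreal (cmod (gauss w x * (indicator A y *\<^sub>R (gauss (- w) y * f y)))) \<partial>lborel)"
      unfolding 1 by (intro integral_norm_bound_ennreal integrable_mult_right) (simp add: set_integrable_def)
    also have "\<dots> \<le> (\<integral>\<^sup>+y. ennreal (gauss_kernel c x y * cmod (f y)) \<partial>lborel)"
    proof (rule nn_integral_mono_AE, use AE_lborel_singleton[of 0] in eventually_elim)
      fix y :: real assume "y \<noteq> 0"
      have "cmod (gauss w x * (gauss (- w) y * f y)) = exp (- c * (x\<^sup>2 - y\<^sup>2) / 2) * cmod (f y)"
        by (simp add: norm_mult norm_gauss c_def exp_add[symmetric] right_diff_distrib diff_divide_distrib)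
      then show "ennreal (cmod (gauss w x * (indicator A y *\<^sub>R (gauss (- w) y * f y))))
          \<le> ennreal (gauss_kernel c x y * cmod (f y))"
        using \<open>y \<noteq> 0\<close> by (auto simp: A_def gauss_kernel_def indicator_def)
    qed
    finally show ?thesis .
  qed
  have xu: "ennreal (cmod (of_real x * u x)) \<le> (\<integral>\<^sup>+y. ennreal (\<bar>x\<bar> * gauss_kernel c x y * cmod (f y)) \<partial>lborel)" for x
  proof -
    have "ennreal (cmod (of_real x * u x)) = ennreal \<bar>x\<bar> * ennreal (cmod (u x))"
      by (simp add: norm_mult ennreal_mult)
    also have "\<dots> \<le> ennreal \<bar>x\<bar> * (\<integral>\<^sup>+y. ennreal (gauss_kernel c x y * cmod (f y)) \<partial>lborel)"
      by (rule mult_left_mono[OF u]) simp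
    also have "\<dots> = (\<integral>\<^sup>+y. ennreal (\<bar>x\<bar> * gauss_kernel c x y * cmod (f y)) \<partial>lborel)"
      by (subst nn_integral_cmult[symmetric])
        (auto simp: ennreal_mult[symmetric] gauss_kernel_nonneg mult.assoc)
    finally show ?thesis .
  qed
  have M: "0 \<le> M" using c by (simp add: M_def)
  note S = Schur_test[OF gauss_kernel_measurable gauss_kernel_nonneg
      nn_integral_gauss_kernel(1)[OF c, folded M_def] nn_integral_gauss_kernel(2)[OF c, folded M_def]
      M M f ac_deriv_measurable(1)[OF ac] AE_I2[OF u]]
  have "square_integrable (\<lambda>x. of_real x * u x)"
  proof (rule Schur_test(1)[OF _ _ nn_integral_gauss_kernel_weighted_row[OF c]
        nn_integral_gauss_kernel_weighted_col[OF c] _ _ f _ AE_I2[OF xu]])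
    show "(\<lambda>(x, y). \<bar>x\<bar> * gauss_kernel c x y) \<in> borel_measurable (borel \<Otimes>\<^sub>M borel)"
      unfolding gauss_kernel_def[abs_def] by measurable
  qed (use c in \<open>simp_all add: gauss_kernel_nonneg\<close>)
  with S ac show "\<exists>u. ac_deriv u (\<lambda>x. f x - w * of_real x * u x) \<and>
      square_integrable u \<and> square_integrable (\<lambda>x. of_real x * u x) \<and> norm (abs_l2 u) \<le> sqrt (M * M) * norm (abs_l2 f)"
    by blast
qed

text \<open>The homogeneous solution \<open>gauss (- w)\<close> of v' = w x v - f grows, so its
  coefficient must vanish at both ends of the line. That is the orthogonality hypothesis, and the
  resulting kernel is the transpose of the one for the annihilation equation.\<close>

lemma solve_creation:
  assumes w: "0 < Re w"
  obtains C where "\<And>f. square_integrable f \<Longrightarrow> (\<integral>x. gauss w x * f x \<partial>lborel) = 0 \<Longrightarrow>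
    \<exists>v. ac_deriv v (\<lambda>x. w * of_real x * v x - f x) \<and>
      square_integrable v \<and> square_integrable (\<lambda>x. of_real x * v x) \<and> norm (abs_l2 v) \<le> C * norm (abs_l2 f)"
proof
  define c where "c = Re w"
  have c: "0 < c" using w by (simp add: c_def)
  define M where "M = sqrt (2 * pi / c)"
  fix f assume f: "square_integrable f" and f0: "(\<integral>x. gauss w x * f x \<partial>lborel) = 0"
  have [measurable]: "f \<in> borel_measurable borel" using f by (simp add: square_integrable_def)
  define G where "G x = gauss w x * f x" for x
  have loc: "locally_integrable G" unfolding G_def
    by (intro locally_integrable_mult_continuous gauss_continuous square_integrable_locally_integrable f)
  have int: "integrable lborel G"
    unfolding G_def[abs_def] using integrable_mult_square_integrable[OF square_integrable_gauss[OF w, of 0] f] by simp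
  have sint: "set_integrable lborel A G" if "A \<in> sets borel" for A
    unfolding set_integrable_def using that by (intro integrable_mult_indicator int) simp
  define Z where "Z x = - (LINT y:{..x}|lborel. G y)" for x
  have "ac_deriv Z (\<lambda>x. - 1 * G x)"
    unfolding ac_deriv_def
  proof (intro conjI allI impI)
    show "locally_integrable (\<lambda>x. - 1 * G x)"
      using loc unfolding locally_integrable_def by (intro allI set_integrable_mult_right) blast
    fix a b :: real assume "a \<le> b"
    have "(LINT y:{..a} \<union> {a..b}|lborel. G y) = (LINT y:{..a}|lborel. G y) + (LINT y:{a..b}|lborel. G y)"
      using sint AE_lborel_singleton[of a] by (intro set_integral_Un_AE) (auto elim: eventually_mono)
    moreover have "{..a} \<union> {a..b} = {..b}" using \<open>a \<le> b\<close> by auto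
    ultimately show "Z b - Z a = (LINT x:{a..b}|lborel. - 1 * G x)"
      by (simp only: Z_def set_integral_mult_right) simp
  qed
  note Z = this
  define v where "v x = gauss (- w) x * Z x" for x
  have e: "gauss (- w) x * (- 1 * G x) + Z x * (- (- w) * of_real x * gauss (- w) x) = w * of_real x * v x - f x" for x
  proof -
    have "gauss (- w) x * G x = f x"
      using gauss_inverse[of w x] by (simp add: G_def mult.assoc[symmetric] mult.commute[of "gauss (- w) x"])
    then show ?thesis by (simp add: v_def algebra_simps)
  qed
  have ac: "ac_deriv v (\<lambda>x. w * of_real x * v x - f x)"
    using ac_deriv_mult[OF ac_deriv_gauss[of "- w"] Z] unfolding v_def[symmetric] e .
  note [measurable] = ac_deriv_measurable(1)[OF ac]
  have v: "ennreal (cmod (v x)) \<le> (\<integral>\<^sup>+y. ennreal (gauss_kernel c y x * cmod (f y)) \<partial>lborel)" if "x \<noteq> 0" for x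
  proof -
    \<comment> \<open>As the full integral of \<open>G\<close> is 0, the primitive can be written
      from either end up to sign. The end on the side of x is taken, so that \<open>f\<close> enters
      only at |y| \<ge> |x|.\<close>
    define A where "A = (if 0 < x then {x<..} else {..x})"
    define I where "I = (LINT y:A|lborel. G y)"
    have "(LINT y:{..x} \<union> {x<..}|lborel. G y) = (LINT y:{..x}|lborel. G y) + (LINT y:{x<..}|lborel. G y)"
      by (intro set_integral_Un sint) auto
    moreover have "{..x} \<union> {x<..} = UNIV" by auto
    ultimately have "(LINT y:{..x}|lborel. G y) + (LINT y:{x<..}|lborel. G y) = 0"
      using f0 by (simp add: G_def set_lebesgue_integral_def)
    then have "Z x = I \<or> Z x = - I" by (auto simp: Z_def A_def I_def dest: minus_unique)
    then have "cmod (v x) = cmod (gauss (- w) x * I)" by (auto simp: v_def norm_mult)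
    also have "gauss (- w) x * I = (\<integral>y. gauss (- w) x * (indicator A y *\<^sub>R G y) \<partial>lborel)"
      unfolding I_def set_lebesgue_integral_def by (rule integral_mult_right_zero[symmetric])
    finally have 1: "cmod (v x) = cmod (\<integral>y. gauss (- w) x * (indicator A y *\<^sub>R G y) \<partial>lborel)" .
    have "set_integrable lborel A G" by (rule sint) (simp add: A_def)
    then have "ennreal (cmod (v x)) \<le> (\<integral>\<^sup>+y. ennreal (cmod (gauss (- w) x * (indicator A y *\<^sub>R G y))) \<partial>lborel)"
      unfolding 1 by (intro integral_norm_bound_ennreal integrable_mult_right) (simp add: set_integrable_def)
    also have "\<dots> \<le> (\<integral>\<^sup>+y. ennreal (gauss_kernel c y x * cmod (f y)) \<partial>lborel)"
    proof (rule nn_integral_mono)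
      fix y :: real
      have "cmod (gauss (- w) x * G y) = exp (- c * (y\<^sup>2 - x\<^sup>2) / 2) * cmod (f y)"
        by (simp add: G_def norm_mult norm_gauss c_def exp_add[symmetric] right_diff_distrib diff_divide_distrib)
      then show "ennreal (cmod (gauss (- w) x * (indicator A y *\<^sub>R G y)))
          \<le> ennreal (gauss_kernel c y x * cmod (f y))"
        using \<open>x \<noteq> 0\<close> by (auto simp: A_def gauss_kernel_def indicator_def)
    qed
    finally show ?thesis .
  qed
  have xv: "ennreal (cmod (of_real x * v x)) \<le> (\<integral>\<^sup>+y. ennreal (\<bar>y\<bar> * gauss_kernel c y x * cmod (f y)) \<partial>lborel)"
    if "x \<noteq> 0" for x
  proof -
    have "ennreal (cmod (of_real x * v x)) = ennreal \<bar>x\<bar> * ennreal (cmod (v x))"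
      by (simp add: norm_mult ennreal_mult)
    also have "\<dots> \<le> ennreal \<bar>x\<bar> * (\<integral>\<^sup>+y. ennreal (gauss_kernel c y x * cmod (f y)) \<partial>lborel)"
      by (rule mult_left_mono[OF v[OF that]]) simp
    also have "\<dots> = (\<integral>\<^sup>+y. ennreal (\<bar>x\<bar> * gauss_kernel c y x * cmod (f y)) \<partial>lborel)"
      by (subst nn_integral_cmult[symmetric])
        (auto simp: ennreal_mult[symmetric] gauss_kernel_nonneg mult.assoc)
    \<comment> \<open>On the support |x| \<le> |y|, so the weight may move to the variable for which
      the weighted bounds were proved.\<close>
    also have "\<dots> \<le> (\<integral>\<^sup>+y. ennreal (\<bar>y\<bar> * gauss_kernel c y x * cmod (f y)) \<partial>lborel)"
    proof (intro nn_integral_mono ennreal_leI mult_right_mono[OF _ norm_ge_zero])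
      show "\<bar>x\<bar> * gauss_kernel c y x \<le> \<bar>y\<bar> * gauss_kernel c y x" for y
        by (auto simp: gauss_kernel_def)
    qed
    finally show ?thesis .
  qed
  have km: "(\<lambda>(x, y). gauss_kernel c y x) \<in> borel_measurable (borel \<Otimes>\<^sub>M borel)"
    "(\<lambda>(x, y). \<bar>y\<bar> * gauss_kernel c y x) \<in> borel_measurable (borel \<Otimes>\<^sub>M borel)"
    unfolding gauss_kernel_def[abs_def] by measurable
  have ae: "AE x in lborel. ennreal (cmod (v x)) \<le> (\<integral>\<^sup>+y. ennreal (gauss_kernel c y x * cmod (f y)) \<partial>lborel)"
    "AE x in lborel. ennreal (cmod (of_real x * v x)) \<le> (\<integral>\<^sup>+y. ennreal (\<bar>y\<bar> * gauss_kernel c y x * cmod (f y)) \<partial>lborel)"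
    using AE_lborel_singleton[of 0] by (auto elim!: eventually_mono intro: v xv)
  have M: "0 \<le> M" using c by (simp add: M_def)
  note S = Schur_test[OF km(1) gauss_kernel_nonneg
      nn_integral_gauss_kernel(2)[OF c, folded M_def] nn_integral_gauss_kernel(1)[OF c, folded M_def]
      M M f ac_deriv_measurable(1)[OF ac] ae(1)]
  have "square_integrable (\<lambda>x. of_real x * v x)"
    by (rule Schur_test(1)[OF km(2) _ nn_integral_gauss_kernel_weighted_col[OF c]
        nn_integral_gauss_kernel_weighted_row[OF c] _ _ f _ ae(2)])
      (use c in \<open>simp_all add: gauss_kernel_nonneg\<close>)
  with S ac show "\<exists>v. ac_deriv v (\<lambda>x. w * of_real x * v x - f x) \<and>
      square_integrable v \<and> square_integrable (\<lambda>x. of_real x * v x) \<and> norm (abs_l2 v) \<le> sqrt (M * M) * norm (abs_l2 f)"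
    by blast
qed

section \<open>Annihilation and creation operators\<close>

lemma domain_D_uminus: "u \<in> domain_D \<Longrightarrow> - u \<in> domain_D"
  using domain_D_scaleC(1)[of u "- 1"] by (simp add: scaleC_minus1)

lemma domain_D_diff: "u \<in> domain_D \<Longrightarrow> v \<in> domain_D \<Longrightarrow> u - v \<in> domain_D"
  using domain_D_add(1)[OF _ domain_D_uminus, of u v] by simp

lemma domain_D_zero: "0 \<in> domain_D"
proof -
  have "square_integrable (\<lambda>x. 0)" "ac_deriv (\<lambda>x. 0) (\<lambda>x. 0)"
    by (auto simp: square_integrable_zero intro!: ac_deriv_C1)
  then have "abs_l2 (\<lambda>x. 0) \<in> domain_D" by (intro domain_D_I(1)) simp_all
  then show ?thesis by (simp add: zero_l2_def)
qed

lemma domain_D_scaleR: "u \<in> domain_D \<Longrightarrow> r *\<^sub>R u \<in> domain_D"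
  by (metis domain_D_scaleC(1) scaleC_of_real)

lemmas bil_simps = bil_add_left bil_add_right bil_diff_left bil_diff_right bil_scaleC_left bil_scaleC_right
  bil_minus_left bil_minus_right

locale rotated =
  fixes \<theta> :: real
  assumes theta_gt: "- (pi / 2) < \<theta>" and theta_lt: "\<theta> < pi / 2"
begin

text \<open>The square E * E is the Gaussian parameter \<open>w\<close> of the previous section; its
  real part cos \<theta> is positive for the given range of \<theta>.\<close>

definition E :: complex where "E = exp (\<i> * of_real \<theta> / 2)"
definition E' :: complex where "E' = exp (- (\<i> * of_real \<theta> / 2))"

lemma E_E': "E * E' = 1" "E' * E = 1"
  by (simp_all add: E_def E'_def exp_add[symmetric])

lemma cnj_E: "cnj E = E'" "cnj E' = E"
  by (simp_all add: E_def E'_def exp_cnj)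

lemma norm_E: "cmod E = 1" "cmod E' = 1"
  by (simp_all add: E_def E'_def norm_exp_eq_Re)

lemma E_squared: "E * E = exp (\<i> * of_real \<theta>)"
  by (simp add: E_def exp_add[symmetric])

lemma E'_squared: "E' * E' = exp (- (\<i> * of_real \<theta>))"
  by (simp add: E'_def exp_add[symmetric] field_simps)

lemma Re_E_squared: "Re (E * E) = cos \<theta>" "Re (E' * E') = cos \<theta>"
  unfolding E_squared E'_squared by (simp_all add: Re_exp)

lemma Im_E_squared: "Im (E * E) = sin \<theta>" "Im (E' * E') = - sin \<theta>"
  unfolding E_squared E'_squared by (simp_all add: Im_exp)

lemma cos_theta_pos: "0 < cos \<theta>"
  using theta_gt theta_lt by (intro cos_gt_zero_pi) auto

definition annihil :: "l2 \<Rightarrow> l2" where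
  "annihil u = E *\<^sub>C multiply_by_x u + E' *\<^sub>C weak_derivative u"

definition create :: "l2 \<Rightarrow> l2" where
  "create u = E *\<^sub>C multiply_by_x u - E' *\<^sub>C weak_derivative u"

lemma annihil_add: "u \<in> domain_D \<Longrightarrow> v \<in> domain_D \<Longrightarrow> annihil (u + v) = annihil u + annihil v"
  and create_add: "u \<in> domain_D \<Longrightarrow> v \<in> domain_D \<Longrightarrow> create (u + v) = create u + create v"
  by (simp_all add: annihil_def create_def domain_D_add scaleC_add_right)

lemma annihil_scaleC: "u \<in> domain_D \<Longrightarrow> annihil (c *\<^sub>C u) = c *\<^sub>C annihil u"
  and create_scaleC: "u \<in> domain_D \<Longrightarrow> create (c *\<^sub>C u) = c *\<^sub>C create u"
  by (simp_all add: annihil_def create_def domain_D_scaleC scaleC_add_right scaleC_diff_right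
      scaleC_scaleC mult.commute)

lemma create_scaleR: "u \<in> domain_D \<Longrightarrow> create (r *\<^sub>R u) = r *\<^sub>R create u"
  by (metis create_scaleC scaleC_of_real)

lemma annihil_minus: "u \<in> domain_D \<Longrightarrow> annihil (- u) = - annihil u"
  and create_minus: "u \<in> domain_D \<Longrightarrow> create (- u) = - create u"
  using annihil_scaleC[of u "- 1"] create_scaleC[of u "- 1"] by (simp_all add: scaleC_minus1)

lemma annihil_diff: "u \<in> domain_D \<Longrightarrow> v \<in> domain_D \<Longrightarrow> annihil (u - v) = annihil u - annihil v"
  and create_diff: "u \<in> domain_D \<Longrightarrow> v \<in> domain_D \<Longrightarrow> create (u - v) = create u - create v"
  using annihil_add[of u "- v"] create_add[of u "- v"]
  by (simp_all add: annihil_minus create_minus domain_D_uminus)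

lemma annihil_zero [simp]: "annihil 0 = 0" and create_zero [simp]: "create 0 = 0"
  using annihil_scaleC[OF domain_D_zero, of 0] create_scaleC[OF domain_D_zero, of 0] by simp_all

lemma bil_annihil:
  "u \<in> domain_D \<Longrightarrow> v \<in> domain_D \<Longrightarrow> bil (annihil u) v = bil u (create v)"
  by (simp add: annihil_def create_def bil_simps bil_multiply_by_x bil_weak_derivative)

lemma bil_create:
  "u \<in> domain_D \<Longrightarrow> v \<in> domain_D \<Longrightarrow> bil (create u) v = bil u (annihil v)"
  by (metis bil_annihil bil_commute)

lemma bil_annihil_annihil:
  assumes "u \<in> domain_D" "v \<in> domain_D"
  shows "bil (annihil u) (annihil v) = E * E * bil (multiply_by_x u) (multiply_by_x v)
    + E' * E' * bil (weak_derivative u) (weak_derivative v) - bil u v"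
proof -
  have "bil (annihil u) (annihil v) = E * E * bil (multiply_by_x u) (multiply_by_x v)
    + E' * E' * bil (weak_derivative u) (weak_derivative v)
    + E * E' * (bil (multiply_by_x u) (weak_derivative v) + bil (weak_derivative u) (multiply_by_x v))"
    by (simp add: annihil_def bil_simps algebra_simps)
  then show ?thesis by (simp add: bil_multiply_by_x_weak_derivative assms E_E')
qed

text \<open>This is the commutator a b - b a = 2 as a form identity, valid on the first-order
  domain. The two operators differ in the sign of the derivative, so only the mixed terms contribute
  to the difference.\<close>

lemma bil_create_create:
  assumes "u \<in> domain_D" "v \<in> domain_D"
  shows "bil (create u) (create v) = bil (annihil u) (annihil v) + 2 * bil u v"
proof -
  have "bil (create u) (create v) = E * E * bil (multiply_by_x u) (multiply_by_x v)
    + E' * E' * bil (weak_derivative u) (weak_derivative v)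
    - E * E' * (bil (multiply_by_x u) (weak_derivative v) + bil (weak_derivative u) (multiply_by_x v))"
    by (simp add: create_def bil_simps algebra_simps)
  then show ?thesis by (simp add: bil_multiply_by_x_weak_derivative assms E_E' bil_annihil_annihil)
qed

section \<open>Ground state and solvability of the first-order equations\<close>

definition phi0 :: l2 where "phi0 = abs_l2 (gauss (E * E))"

lemma square_integrable_phi0: "square_integrable (gauss (E * E))"
  using square_integrable_gauss[of "E * E" 0] cos_theta_pos by (simp add: Re_E_squared del: times_complex.simps)

lemma phi0_in_domain: "phi0 \<in> domain_D" and annihil_phi0: "annihil phi0 = 0"
proof -
  let ?g = "gauss (E * E)"
  have x: "square_integrable (\<lambda>x. of_real x * ?g x)"
    using square_integrable_gauss[of "E * E" 1] cos_theta_pos by (simp add: Re_E_squared del: times_complex.simps)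
  have eq: "- (E * E) * of_real x * ?g x = - (E * E) * (of_real x * ?g x)" for x by simp
  have d: "square_integrable (\<lambda>x. - (E * E) * of_real x * ?g x)"
    unfolding eq by (rule square_integrable_cmult[OF x])
  note I = domain_D_I[OF square_integrable_phi0 d x ac_deriv_gauss, folded phi0_def]
  show "phi0 \<in> domain_D" by (rule I(1))
  have "annihil phi0 = abs_l2 (\<lambda>x. E * (of_real x * ?g x) + E' * (- (E * E) * of_real x * ?g x))"
    unfolding annihil_def I(2,3) using x d
    by (simp only: abs_l2_scaleC abs_l2_plus square_integrable_cmult)
  also have "(\<lambda>x. E * (of_real x * ?g x) + E' * (- (E * E) * of_real x * ?g x)) = (\<lambda>x. 0)"
  proof
    fix x
    have "E' * (- (E * E) * of_real x * ?g x) = - (E' * E) * (E * (of_real x * ?g x))" by simp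
    then show "E * (of_real x * ?g x) + E' * (- (E * E) * of_real x * ?g x) = 0" by (simp add: E_E')
  qed
  finally show "annihil phi0 = 0" by (simp add: zero_l2_def)
qed

lemma phi0_nonzero: "phi0 \<noteq> 0"
proof
  assume "phi0 = 0"
  then have "AE x in lborel. gauss (E * E) x = 0"
    using abs_l2_eq_iff[OF square_integrable_phi0 square_integrable_zero] by (simp add: phi0_def zero_l2_def)
  then have "AE x in (lborel :: real measure). False" by (simp add: gauss_def)
  then have "ae_filter (lborel :: real measure) = bot" by (simp add: eventually_False)
  then show False by (simp add: ae_filter_eq_bot_iff)
qed

text \<open>Multiplying a u = f by \<open>E\<close> gives u' = E f - E^2 x u, the equation solved
  above with w = E * E and right-hand side E f.\<close>

lemma annihil_solvable: "\<exists>C. \<forall>f. \<exists>u\<in>domain_D. annihil u = f \<and> norm u \<le> C * norm f"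
proof -
  obtain C where C: "\<And>f. square_integrable f \<Longrightarrow> \<exists>u. ac_deriv u (\<lambda>x. f x - E * E * of_real x * u x) \<and>
      square_integrable u \<and> square_integrable (\<lambda>x. of_real x * u x) \<and> norm (abs_l2 u) \<le> C * norm (abs_l2 f)"
    using solve_annihilation[of "E * E"] cos_theta_pos Re_E_squared(1) by metis
  have "\<exists>u\<in>domain_D. annihil u = f \<and> norm u \<le> C * norm f" for f
  proof -
    obtain h where h: "square_integrable h" "E *\<^sub>C f = abs_l2 h" by (rule l2_cases)
    obtain u where u: "ac_deriv u (\<lambda>x. h x - E * E * of_real x * u x)"
      "square_integrable u" "square_integrable (\<lambda>x. of_real x * u x)" "norm (abs_l2 u) \<le> C * norm (abs_l2 h)"
      using C[OF h(1)] by blast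
    have eq: "E * E * of_real x * u x = E * E * (of_real x * u x)" for x by simp
    have s: "square_integrable (\<lambda>x. E * E * of_real x * u x)"
      unfolding eq by (rule square_integrable_cmult[OF u(3)])
    note I = domain_D_I[OF u(2) square_integrable_diff[OF h(1) s] u(3,1)]
    have 1: "weak_derivative (abs_l2 u) = E *\<^sub>C f - (E * E) *\<^sub>C multiply_by_x (abs_l2 u)"
      unfolding I(2,3) abs_l2_scaleC[OF u(3)] h(2) abs_l2_minus[OF h(1) s[unfolded eq]] eq by simp
    have "annihil (abs_l2 u) = f"
      unfolding annihil_def 1
      by (simp add: scaleC_diff_right scaleC_scaleC E_E' mult.assoc[symmetric])
    moreover have "norm (abs_l2 u) \<le> C * norm f"
      using u(4) norm_scaleC[of E f] by (simp add: h(2)[symmetric] norm_E)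
    ultimately show ?thesis using I(1) by blast
  qed
  then show ?thesis by blast
qed

text \<open>The same multiplication by \<open>E\<close>. The condition is also forced, because
  \<open>bil phi0 (create v) = bil (annihil phi0) v = 0\<close>.\<close>

lemma create_solvable:
  "\<exists>C. \<forall>f. bil phi0 f = 0 \<longrightarrow> (\<exists>v\<in>domain_D. create v = f \<and> norm v \<le> C * norm f)"
proof -
  obtain C where C: "\<And>f. square_integrable f \<Longrightarrow> (\<integral>x. gauss (E * E) x * f x \<partial>lborel) = 0 \<Longrightarrow>
      \<exists>v. ac_deriv v (\<lambda>x. E * E * of_real x * v x - f x) \<and>
      square_integrable v \<and> square_integrable (\<lambda>x. of_real x * v x) \<and> norm (abs_l2 v) \<le> C * norm (abs_l2 f)"
    using solve_creation[of "E * E"] cos_theta_pos Re_E_squared(1) by metis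
  have "\<exists>v\<in>domain_D. create v = f \<and> norm v \<le> C * norm f" if f: "bil phi0 f = 0" for f
  proof -
    obtain h where h: "square_integrable h" "E *\<^sub>C f = abs_l2 h" by (rule l2_cases)
    have "bil phi0 (E *\<^sub>C f) = 0" using f by (simp add: bil_scaleC_right)
    then have "(\<integral>x. gauss (E * E) x * h x \<partial>lborel) = 0"
      by (simp add: h(2) phi0_def abs_l2_bil square_integrable_phi0 h(1))
    then obtain v where v: "ac_deriv v (\<lambda>x. E * E * of_real x * v x - h x)"
      "square_integrable v" "square_integrable (\<lambda>x. of_real x * v x)" "norm (abs_l2 v) \<le> C * norm (abs_l2 h)"
      using C[OF h(1)] by blast
    have eq: "E * E * of_real x * v x = E * E * (of_real x * v x)" for x by simp
    have s: "square_integrable (\<lambda>x. E * E * of_real x * v x)"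
      unfolding eq by (rule square_integrable_cmult[OF v(3)])
    note I = domain_D_I[OF v(2) square_integrable_diff[OF s h(1)] v(3,1)]
    have 1: "weak_derivative (abs_l2 v) = (E * E) *\<^sub>C multiply_by_x (abs_l2 v) - E *\<^sub>C f"
      unfolding I(2,3) abs_l2_scaleC[OF v(3)] h(2) abs_l2_minus[OF s[unfolded eq] h(1)] eq by simp
    have "create (abs_l2 v) = f"
      unfolding create_def 1
      by (simp add: scaleC_diff_right scaleC_scaleC E_E' mult.assoc[symmetric])
    moreover have "norm (abs_l2 v) \<le> C * norm f"
      using v(4) norm_scaleC[of E f] by (simp add: h(2)[symmetric] norm_E)
    ultimately show ?thesis using I(1) by blast
  qed
  then show ?thesis by blast
qed

text \<open>If \<open>phi0\<close> were isotropic, then \<open>phi0 = create V\<close>; testing \<open>annihil (create V) = 0\<close> against the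
  complex conjugate of \<open>V\<close> contradicts \<open>0 < cos \<theta>\<close>.\<close>

lemma bil_phi0_phi0: "bil phi0 phi0 \<noteq> 0"
proof
  assume "bil phi0 phi0 = 0"
  then obtain V where V: "V \<in> domain_D" "create V = phi0" using create_solvable by blast
  note c = domain_D_conj[OF V(1)]
  have "bil (create V) (create (conj_l2 V)) = 0"
    using bil_annihil[OF phi0_in_domain c(1)] by (simp add: V(2) annihil_phi0)
  then have 0: "E * E * of_real ((norm (multiply_by_x V))\<^sup>2) + E' * E' * of_real ((norm (weak_derivative V))\<^sup>2)
      + of_real ((norm V)\<^sup>2) = 0"
    using bil_create_create[OF V(1) c(1)] bil_annihil_annihil[OF V(1) c(1)]
      bil_conj_self[of V] bil_conj_self[of "multiply_by_x V"] bil_conj_self[of "weak_derivative V"]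
    by (simp add: c bil_commute[of _ "conj_l2 _"] add.commute)
  have "cos \<theta> * (norm (multiply_by_x V))\<^sup>2 + cos \<theta> * (norm (weak_derivative V))\<^sup>2 + (norm V)\<^sup>2 = 0"
    using arg_cong[OF 0, of Re] Re_E_squared by (simp only: plus_complex.simps Re_complex_of_real Im_complex_of_real
        times_complex.simps(1)[of "_ * _"] zero_complex.simps mult_zero_right diff_zero)
  moreover have "0 \<le> cos \<theta> * (norm (multiply_by_x V))\<^sup>2" "0 \<le> cos \<theta> * (norm (weak_derivative V))\<^sup>2"
    using cos_theta_pos by (intro mult_nonneg_nonneg; simp)+
  ultimately have "(norm V)\<^sup>2 \<le> 0" by linarith
  then have "V = 0" by simp
  then show False using V(2) phi0_nonzero by simp
qed

definition p0 :: "l2 \<Rightarrow> l2" where "p0 f = (bil phi0 f / bil phi0 phi0) *\<^sub>C phi0"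

lemma bil_phi0_p0: "bil phi0 (p0 f) = bil phi0 f"
  using bil_phi0_phi0 by (simp add: p0_def bil_scaleC_right)

lemma bil_p0: "bil (p0 f) g = bil f (p0 g)"
  by (simp add: p0_def bil_simps bil_commute)

lemma norm_p0_le: "norm (p0 f) \<le> ((norm phi0)\<^sup>2 / cmod (bil phi0 phi0)) * norm f"
proof -
  have "norm (p0 f) = cmod (bil phi0 f) / cmod (bil phi0 phi0) * norm phi0"
    by (simp add: p0_def norm_scaleC norm_divide)
  also have "\<dots> \<le> (norm phi0 * norm f) / cmod (bil phi0 phi0) * norm phi0"
    by (intro mult_right_mono divide_right_mono norm_bil_le) auto
  finally show ?thesis by (simp add: power2_eq_square field_simps)
qed

lemma bounded_linear_p0: "bounded_linear p0"
proof (rule bounded_linear_intro)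
  show "p0 (f + g) = p0 f + p0 g" for f g
    by (simp add: p0_def bil_simps add_divide_distrib scaleC_add_left)
  show "p0 (r *\<^sub>R f) = r *\<^sub>R p0 f" for r f
    by (simp add: p0_def bil_simps scaleC_of_real[symmetric] scaleC_scaleC)
  show "norm (p0 f) \<le> norm f * ((norm phi0)\<^sup>2 / cmod (bil phi0 phi0))" for f
    using norm_p0_le[of f] by (simp add: mult.commute)
qed

lemma p0_in_domain: "p0 f \<in> domain_D" and annihil_p0: "annihil (p0 f) = 0"
  by (simp_all add: p0_def domain_D_scaleC phi0_in_domain annihil_scaleC annihil_phi0)

text \<open>Duality: modulo \<open>phi0\<close>, every vector \<open>g\<close> lies in the range of
  \<open>create\<close>, the transpose of \<open>annihil\<close>.\<close>

lemma annihil_injective: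
  assumes u: "u \<in> domain_D" "annihil u = 0" "bil phi0 u = 0" shows "u = 0"
proof (rule bil_separates)
  fix g
  have "bil phi0 (g - p0 g) = 0" by (simp add: bil_diff_right bil_phi0_p0)
  then obtain V where V: "V \<in> domain_D" "create V = g - p0 g" using create_solvable by blast
  have "bil u (create V) = 0" using bil_annihil[OF u(1) V(1)] u(2) by simp
  moreover have "bil u (p0 g) = 0" using u(3) by (simp add: bil_p0[symmetric]) (simp add: p0_def)
  ultimately show "bil u g = 0" by (simp add: V bil_diff_right)
qed

lemma create_injective:
  assumes v: "v \<in> domain_D" "create v = 0" shows "v = 0"
proof (rule bil_separates)
  fix f
  obtain U where U: "U \<in> domain_D" "annihil U = f" using annihil_solvable by blast
  then show "bil v f = 0" using bil_create[OF v(1) U(1)] v by simp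
qed

text \<open>Subtracting the \<open>phi0\<close> component makes the solution unique. Uniqueness
  turns a pointwise choice into a linear map, and the subtraction costs the factor 1 plus the norm
  bound of \<open>p0\<close>.\<close>

lemma annihil_inverse_ex:
  obtains annihil_inv where "bounded_linear annihil_inv" "\<And>f. annihil_inv f \<in> domain_D" "\<And>f. annihil (annihil_inv f) = f" "\<And>f. bil phi0 (annihil_inv f) = 0"
proof -
  obtain C where C: "\<And>f. \<exists>u\<in>domain_D. annihil u = f \<and> norm u \<le> C * norm f" using annihil_solvable by blast
  define K where "K = \<bar>C\<bar> * (1 + (norm phi0)\<^sup>2 / cmod (bil phi0 phi0))"
  have "\<exists>u. u \<in> domain_D \<and> annihil u = f \<and> bil phi0 u = 0 \<and> norm u \<le> norm f * K" for f
  proof -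
    obtain u where u: "u \<in> domain_D" "annihil u = f" "norm u \<le> C * norm f" using C by blast
    have "norm (u - p0 u) \<le> norm u + (norm phi0)\<^sup>2 / cmod (bil phi0 phi0) * norm u"
      using norm_triangle_ineq4[of u "p0 u"] norm_p0_le[of u] by linarith
    also have "\<dots> = norm u * (1 + (norm phi0)\<^sup>2 / cmod (bil phi0 phi0))" by (simp add: algebra_simps)
    also have "\<dots> \<le> (\<bar>C\<bar> * norm f) * (1 + (norm phi0)\<^sup>2 / cmod (bil phi0 phi0))"
    proof (rule mult_right_mono)
      show "norm u \<le> \<bar>C\<bar> * norm f"
        using u(3) mult_right_mono[OF abs_ge_self[of C] norm_ge_zero[of f]] by linarith
    qed simp
    finally have "norm (u - p0 u) \<le> norm f * K" by (simp add: K_def ac_simps)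
    then show ?thesis using u
      by (intro exI[of _ "u - p0 u"])
        (simp add: domain_D_diff p0_in_domain annihil_diff annihil_p0 bil_diff_right bil_phi0_p0)
  qed
  then obtain annihil_inv where annihil_inv: "\<And>f. annihil_inv f \<in> domain_D \<and> annihil (annihil_inv f) = f \<and> bil phi0 (annihil_inv f) = 0 \<and> norm (annihil_inv f) \<le> norm f * K"
    by metis
  have "bounded_linear annihil_inv"
  proof (rule bounded_linear_intro)
    show "annihil_inv (f + g) = annihil_inv f + annihil_inv g" for f g
      using annihil_injective[of "annihil_inv (f + g) - (annihil_inv f + annihil_inv g)"] annihil_inv
      by (simp add: domain_D_diff domain_D_add annihil_diff annihil_add bil_simps)
    show "annihil_inv (r *\<^sub>R f) = r *\<^sub>R annihil_inv f" for r f
      using annihil_injective[of "annihil_inv (r *\<^sub>R f) - r *\<^sub>R annihil_inv f"] annihil_inv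
      by (simp add: domain_D_diff domain_D_scaleC scaleC_of_real[symmetric] annihil_diff annihil_scaleC bil_simps)
    show "norm (annihil_inv f) \<le> norm f * K" for f using annihil_inv by blast
  qed
  then show thesis using that annihil_inv by blast
qed

lemma create_inverse_ex:
  obtains create_inv where "bounded_linear create_inv" "\<And>f. create_inv f \<in> domain_D" "\<And>f. create (create_inv f) = f - p0 f"
proof -
  obtain C where C: "\<And>f. bil phi0 f = 0 \<Longrightarrow> \<exists>v\<in>domain_D. create v = f \<and> norm v \<le> C * norm f"
    using create_solvable by blast
  define K where "K = \<bar>C\<bar> * (1 + (norm phi0)\<^sup>2 / cmod (bil phi0 phi0))"
  have "\<exists>v. v \<in> domain_D \<and> create v = f - p0 f \<and> norm v \<le> norm f * K" for f
  proof -
    have "bil phi0 (f - p0 f) = 0" by (simp add: bil_diff_right bil_phi0_p0)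
    then obtain v where v: "v \<in> domain_D" "create v = f - p0 f" "norm v \<le> C * norm (f - p0 f)" using C by blast
    have "norm (f - p0 f) \<le> norm f + (norm phi0)\<^sup>2 / cmod (bil phi0 phi0) * norm f"
      using norm_triangle_ineq4[of f "p0 f"] norm_p0_le[of f] by linarith
    then have 1: "norm (f - p0 f) \<le> norm f * (1 + (norm phi0)\<^sup>2 / cmod (bil phi0 phi0))"
      by (simp add: algebra_simps)
    have "norm v \<le> \<bar>C\<bar> * norm (f - p0 f)"
      using v(3) mult_right_mono[OF abs_ge_self[of C] norm_ge_zero[of "f - p0 f"]] by linarith
    also have "\<dots> \<le> \<bar>C\<bar> * (norm f * (1 + (norm phi0)\<^sup>2 / cmod (bil phi0 phi0)))"
      by (rule mult_left_mono[OF 1]) simp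
    finally have "norm v \<le> norm f * K" by (simp add: K_def ac_simps)
    then show ?thesis using v by blast
  qed
  then obtain create_inv where create_inv: "\<And>f. create_inv f \<in> domain_D \<and> create (create_inv f) = f - p0 f \<and> norm (create_inv f) \<le> norm f * K"
    by metis
  have p0: "p0 (f + g) = p0 f + p0 g" "p0 (r *\<^sub>R f) = r *\<^sub>R p0 f" for f g r
    by (auto simp: linear_simps[OF bounded_linear_p0])
  have "bounded_linear create_inv"
  proof (rule bounded_linear_intro)
    show "create_inv (f + g) = create_inv f + create_inv g" for f g
      using create_injective[of "create_inv (f + g) - (create_inv f + create_inv g)"] create_inv
      by (simp add: domain_D_diff domain_D_add create_diff create_add p0)
    show "create_inv (r *\<^sub>R f) = r *\<^sub>R create_inv f" for r f
      using create_injective[of "create_inv (r *\<^sub>R f) - r *\<^sub>R create_inv f"] create_inv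
      by (simp add: domain_D_diff domain_D_scaleR p0 scaleR_diff_right create_diff create_scaleR)
    show "norm (create_inv f) \<le> norm f * K" for f using create_inv by blast
  qed
  then show thesis using that create_inv by blast
qed

end

section \<open>Ladder of eigenvectors and reduced resolvents\<close>

context rotated
begin

definition annihil_inv :: "l2 \<Rightarrow> l2" where
  "annihil_inv = (SOME A. bounded_linear A \<and> (\<forall>f. A f \<in> domain_D \<and> annihil (A f) = f \<and> bil phi0 (A f) = 0))"

definition create_inv :: "l2 \<Rightarrow> l2" where
  "create_inv = (SOME B. bounded_linear B \<and> (\<forall>f. B f \<in> domain_D \<and> create (B f) = f - p0 f))"

lemma annihil_inv: "bounded_linear annihil_inv" "annihil_inv f \<in> domain_D" "annihil (annihil_inv f) = f" "bil phi0 (annihil_inv f) = 0"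
proof -
  have "\<exists>A. bounded_linear A \<and> (\<forall>f. A f \<in> domain_D \<and> annihil (A f) = f \<and> bil phi0 (A f) = 0)"
    using annihil_inverse_ex by metis
  from someI_ex[OF this, folded annihil_inv_def]
  show "bounded_linear annihil_inv" "annihil_inv f \<in> domain_D" "annihil (annihil_inv f) = f" "bil phi0 (annihil_inv f) = 0" by auto
qed

lemma create_inv: "bounded_linear create_inv" "create_inv f \<in> domain_D" "create (create_inv f) = f - p0 f"
proof -
  have "\<exists>B. bounded_linear B \<and> (\<forall>f. B f \<in> domain_D \<and> create (B f) = f - p0 f)"
    using create_inverse_ex by metis
  from someI_ex[OF this, folded create_inv_def]
  show "bounded_linear create_inv" "create_inv f \<in> domain_D" "create (create_inv f) = f - p0 f" by auto
qed

text \<open>The two inverses are transposes of each other, as the operators are; the normalisation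
  against \<open>phi0\<close> removes the term with \<open>p0 g\<close>.\<close>

lemma bil_annihil_inv: "bil (annihil_inv f) g = bil f (create_inv g)"
proof -
  have "bil (annihil_inv f) (p0 g) = 0"
    by (simp add: p0_def bil_scaleC_right bil_commute[of "annihil_inv f"] annihil_inv)
  then have "bil (annihil_inv f) g = bil (annihil_inv f) (create (create_inv g))" by (simp add: create_inv bil_diff_right)
  also have "\<dots> = bil (annihil (annihil_inv f)) (create_inv g)" by (rule bil_annihil[symmetric]) (auto simp: annihil_inv create_inv)
  finally show ?thesis by (simp add: annihil_inv)
qed

lemma bil_eqI: "(\<And>h. bil u h = bil v h) \<Longrightarrow> u = v"
  using bil_separates[of "u - v"] by (simp add: bil_diff_left)

text \<open>Elliptic regularity, obtained by duality from the form identity.\<close>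

lemma create_eq_annihil_inv:
  assumes u: "u \<in> domain_D" "annihil u \<in> domain_D"
  shows "create u = annihil_inv (create (annihil u) + 2 *\<^sub>C u)"
proof (rule bil_eqI)
  fix h
  \<comment> \<open>The component \<open>p0 h\<close> does not see \<open>create u\<close>, so
    \<open>h\<close> may be replaced by \<open>create (create_inv h)\<close>. Both arguments are
    then in the range of \<open>create\<close>, and the form identity applies.\<close>
  have "bil (create u) (p0 h) = (bil phi0 h / bil phi0 phi0) * bil u (annihil phi0)"
    using bil_create[OF u(1) phi0_in_domain] by (simp add: p0_def bil_scaleC_right)
  then have "bil (create u) h = bil (create u) (create (create_inv h))"
    by (simp add: create_inv bil_diff_right annihil_phi0)
  also have "\<dots> = bil (create (annihil u)) (create_inv h) + 2 * bil u (create_inv h)"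
    using bil_create_create[OF u(1) create_inv(2)] bil_create[OF u(2) create_inv(2)] by simp
  also have "\<dots> = bil (annihil_inv (create (annihil u) + 2 *\<^sub>C u)) h"
    by (simp add: bil_annihil_inv bil_simps)
  finally show "bil (create u) h = bil (annihil_inv (create (annihil u) + 2 *\<^sub>C u)) h" .
qed

lemma create_in_domain:
  "u \<in> domain_D \<Longrightarrow> annihil u \<in> domain_D \<Longrightarrow> create u \<in> domain_D"
  by (subst create_eq_annihil_inv) (auto simp: annihil_inv)

lemma annihil_create:
  "u \<in> domain_D \<Longrightarrow> annihil u \<in> domain_D \<Longrightarrow> annihil (create u) = create (annihil u) + 2 *\<^sub>C u"
  by (subst create_eq_annihil_inv) (auto simp: annihil_inv)

section \<open>Eigenvectors and their oblique projections\<close>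

primrec phi :: "nat \<Rightarrow> l2" where
  "phi 0 = phi0"
| "phi (Suc n) = create (phi n)"

text \<open>The induction carries both claims and the regularity of \<open>annihil (phi n)\<close>,
  which \<open>create_in_domain\<close> and \<open>annihil_create\<close> require. At n = 0 the
  truncated index n - 1 is harmless, as its coefficient is 0.\<close>

lemma phi_in_domain: "phi n \<in> domain_D"
  and annihil_phi: "annihil (phi n) = of_nat (2 * n) *\<^sub>C phi (n - 1)"
proof -
  have "phi n \<in> domain_D \<and> annihil (phi n) = of_nat (2 * n) *\<^sub>C phi (n - 1) \<and> annihil (phi n) \<in> domain_D"
  proof (induction n)
    case 0
    then show ?case by (simp add: phi0_in_domain annihil_phi0 domain_D_zero)
  next
    case (Suc n)
    have 0: "create (annihil (phi n)) = of_nat (2 * n) *\<^sub>C phi n"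
    proof (cases n)
      case (Suc k)
      have "phi k \<in> domain_D" if "0 < n"
      proof -
        have "phi k = (1 / of_nat (2 * n)) *\<^sub>C annihil (phi n)"
          using Suc.IH that \<open>n = Suc k\<close> by (simp add: scaleC_scaleC del: of_nat_mult of_nat_Suc)
        then show ?thesis by (metis Suc.IH domain_D_scaleC(1))
      qed
      then show ?thesis using Suc.IH \<open>n = Suc k\<close> by (simp add: create_scaleC)
    qed (use Suc.IH in simp)
    then have 1: "annihil (create (phi n)) = of_nat (2 * Suc n) *\<^sub>C phi n"
    proof -
      have "annihil (create (phi n)) = of_nat (2 * n) *\<^sub>C phi n + 2 *\<^sub>C phi n"
        by (metis Suc.IH annihil_create 0)
      also have "\<dots> = (of_nat (2 * n) + 2) *\<^sub>C phi n" by (rule scaleC_add_left[symmetric])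
      also have "of_nat (2 * n) + 2 = (of_nat (2 * Suc n) :: complex)" by simp
      finally show ?thesis .
    qed
    moreover have "create (phi n) \<in> domain_D" using Suc.IH create_in_domain by blast
    ultimately show ?case using Suc.IH by (simp add: domain_D_scaleC)
  qed
  then show "phi n \<in> domain_D" "annihil (phi n) = of_nat (2 * n) *\<^sub>C phi (n - 1)" by auto
qed

definition kappa :: "nat \<Rightarrow> complex" where "kappa n = 2 ^ n * fact n * bil phi0 phi0"

lemma kappa_nonzero: "kappa n \<noteq> 0"
  by (simp add: kappa_def bil_phi0_phi0)

lemma kappa_Suc: "kappa (Suc n) = of_nat (2 * Suc n) * kappa n"
  by (simp add: kappa_def algebra_simps)

lemma bil_phi_phi: "bil (phi n) (phi n) = kappa n"
proof (induction n)
  case (Suc n)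
  have "bil (phi (Suc n)) (phi (Suc n)) = bil (phi n) (annihil (phi (Suc n)))"
    using bil_create[OF phi_in_domain phi_in_domain, of n "Suc n"] by simp
  also have "\<dots> = of_nat (2 * Suc n) * kappa n" by (simp only: annihil_phi bil_scaleC_right diff_Suc_1 Suc.IH)
  finally show ?case by (simp only: kappa_Suc)
qed (simp add: kappa_def)

definition p :: "nat \<Rightarrow> l2 \<Rightarrow> l2" where "p n f = (bil (phi n) f / kappa n) *\<^sub>C phi n"

lemma p_0: "p 0 = p0"
  by (simp add: fun_eq_iff p_def p0_def kappa_def)

lemma bil_p: "bil (phi n) (p n f) = bil (phi n) f"
  using kappa_nonzero by (simp add: p_def bil_scaleC_right bil_phi_phi)

lemma p_p: "p n (p n f) = p n f"
  unfolding p_def[of n "p n f"] bil_p by (simp add: p_def)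

lemma p_in_domain: "p n f \<in> domain_D"
  by (simp add: p_def domain_D_scaleC phi_in_domain)

lemma norm_p_le: "norm (p n f) \<le> ((norm (phi n))\<^sup>2 / cmod (kappa n)) * norm f"
proof -
  have "norm (p n f) = cmod (bil (phi n) f) / cmod (kappa n) * norm (phi n)"
    by (simp add: p_def norm_scaleC norm_divide)
  also have "\<dots> \<le> (norm (phi n) * norm f) / cmod (kappa n) * norm (phi n)"
    by (intro mult_right_mono divide_right_mono norm_bil_le) auto
  finally show ?thesis by (simp add: power2_eq_square field_simps)
qed

lemma p_add: "p n (f + g) = p n f + p n g"
  by (simp add: p_def bil_simps add_divide_distrib scaleC_add_left)

lemma p_scaleC: "p n (c *\<^sub>C f) = c *\<^sub>C p n f"
  by (simp add: p_def bil_simps scaleC_scaleC)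

lemma p_minus: "p n (- f) = - p n f" and p_diff: "p n (f - g) = p n f - p n g"
  by (simp_all add: p_def bil_simps diff_divide_distrib scaleC_diff_left scaleC_minus_left)

lemma bounded_linear_p: "bounded_linear (p n)"
proof (rule bounded_linear_intro)
  show "p n (r *\<^sub>R f) = r *\<^sub>R p n f" for r f using p_scaleC[of n "of_real r" f] by (simp add: scaleC_of_real)
  show "norm (p n f) \<le> norm f * ((norm (phi n))\<^sup>2 / cmod (kappa n))" for f
    using norm_p_le[of n f] by (simp add: mult.commute)
qed (rule p_add)

lemma create_p: "u \<in> domain_D \<Longrightarrow> create (p n u) = p (Suc n) (create u)"
proof -
  assume u: "u \<in> domain_D"
  have "bil (phi (Suc n)) (create u) = of_nat (2 * Suc n) * bil (phi n) u"
    using bil_annihil[OF phi_in_domain u, of "Suc n"] by (simp only: annihil_phi bil_scaleC_left diff_Suc_1)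
  then have "bil (phi (Suc n)) (create u) / kappa (Suc n) = bil (phi n) u / kappa n"
    unfolding kappa_Suc by (simp del: of_nat_mult of_nat_Suc)
  then show ?thesis by (simp add: p_def create_scaleC phi_in_domain)
qed

lemma annihil_p: "u \<in> domain_D \<Longrightarrow> annihil (p (Suc n) u) = p n (annihil u)"
proof -
  assume u: "u \<in> domain_D"
  have "bil (phi n) (annihil u) = bil (phi (Suc n)) u"
    using bil_create[OF phi_in_domain u, of n] by simp
  moreover have "bil (phi (Suc n)) u / kappa (Suc n) * of_nat (2 * Suc n) = bil (phi (Suc n)) u / kappa n"
    unfolding kappa_Suc by (simp del: of_nat_mult of_nat_Suc)
  ultimately show ?thesis
    by (simp add: p_def annihil_scaleC phi_in_domain annihil_phi scaleC_scaleC del: of_nat_mult of_nat_Suc phi.simps)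
qed

lemma annihil_p_0: "annihil (p 0 u) = 0"
  by (simp add: p_0 annihil_p0)

lemma create_annihil_p: "create (annihil (p n f)) = of_nat (2 * n) *\<^sub>C p n f"
proof (cases n)
  case (Suc k)
  then show ?thesis
    by (simp add: p_def annihil_scaleC create_scaleC phi_in_domain annihil_phi domain_D_scaleC scaleC_scaleC mult.commute
        del: of_nat_mult of_nat_Suc phi.simps)
      (simp add: scaleC_scaleC mult.commute)
qed (simp add: annihil_p_0)

lemma annihil_create_p: "annihil (create (p n f)) = of_nat (2 * Suc n) *\<^sub>C p n f"
  by (simp add: p_def create_scaleC phi_in_domain phi.simps(2)[symmetric] annihil_scaleC annihil_phi
      scaleC_scaleC mult.commute del: of_nat_mult of_nat_Suc phi.simps)

text \<open>The part \<open>p0 f\<close> lost by \<open>create_inv\<close> is invisible at level n +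
  1: pairing it with \<open>create (phi n)\<close> moves \<open>annihil\<close> onto
  \<open>phi0\<close>.\<close>

lemma create_p_create_inv: "create (p n (create_inv f)) = p (Suc n) f"
proof -
  have "bil (phi (Suc n)) (p0 f) = 0"
    using bil_create[OF phi_in_domain p0_in_domain, of n f] by (simp add: annihil_p0)
  then have "p (Suc n) (p0 f) = 0" by (simp add: p_def del: phi.simps)
  then show ?thesis by (simp add: create_p create_inv p_diff)
qed

text \<open>The reduced resolvents of \<open>create \<circ> annihil\<close> at its eigenvalues, built by the ladder recursion
  \<open>T (n + 1) = create \<circ> T n \<circ> create_inv - p 0 / (2 n + 2)\<close>.\<close>

lemma reduced_resolvent_ex:
  "\<exists>T. bounded_linear T \<and> bounded_linear (\<lambda>f. annihil (T f)) \<and> bounded_linear (\<lambda>f. create (T f)) \<and>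
    (\<forall>f. T f \<in> domain_D \<and> annihil (T f) \<in> domain_D \<and> create (T f) \<in> domain_D \<and>
      create (annihil (T f)) = of_nat (2 * n) *\<^sub>C T f + f - p n f)"
proof -
  \<comment> \<open>Boundedness of create \<circ> T is left out of the induction; it follows
    afterwards by writing \<open>create (T g)\<close> through the bounded map
    \<open>annihil_inv\<close>.\<close>
  have "\<exists>T. bounded_linear T \<and> bounded_linear (\<lambda>f. annihil (T f)) \<and> 
    (\<forall>f. T f \<in> domain_D \<and> annihil (T f) \<in> domain_D \<and> 
      create (annihil (T f)) = of_nat (2 * n) *\<^sub>C T f + f - p n f)"
  proof (induction n)
    case 0
    show ?case
      by (rule exI[of _ "\<lambda>f. annihil_inv (create_inv f)"])
        (auto simp: annihil_inv create_inv p_0 intro: bounded_linear_compose[OF annihil_inv(1) create_inv(1)] create_inv(1))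
  next
    case (Suc n)
    then obtain T where T: "bounded_linear T" "bounded_linear (\<lambda>f. annihil (T f))" "\<And>f. T f \<in> domain_D"
        "\<And>f. annihil (T f) \<in> domain_D" "\<And>f. create (annihil (T f)) = of_nat (2 * n) *\<^sub>C T f + f - p n f"
      by blast
    define k where "k = (of_nat (2 * Suc n) :: complex)"
    have k: "k \<noteq> 0" "of_nat (2 * n) + 2 = k"
      unfolding k_def by (simp only: of_nat_eq_0_iff) (simp_all add: algebra_simps)
    \<comment> \<open>On the range of \<open>p0\<close> the operator create \<circ> annihil is 0, so
      there the shifted operator is - k with inverse - 1/k. This term supplies the component that
      \<open>create_inv\<close> discards.\<close>
    define T' where "T' f = create (T (create_inv f)) - (1 / k) *\<^sub>C p0 f" for f
    have cT: "create (T g) \<in> domain_D" "annihil (create (T g)) = k *\<^sub>C T g + g - p n g" for g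
      using T create_in_domain[of "T g"] annihil_create[of "T g"]
      by (auto simp: k(2)[symmetric] scaleC_add_left)
    have dT': "T' f \<in> domain_D" for f by (simp add: T'_def domain_D_diff cT domain_D_scaleC p0_in_domain)
    have a: "annihil (T' f) = k *\<^sub>C T (create_inv f) + create_inv f - p n (create_inv f)" for f
      by (simp add: T'_def annihil_diff cT domain_D_scaleC p0_in_domain annihil_scaleC annihil_p0)
    have ad: "annihil (T' f) \<in> domain_D" for f
      unfolding a by (intro domain_D_diff domain_D_add domain_D_scaleC T create_inv p_in_domain)
    have "create (annihil (T' f)) = k *\<^sub>C create (T (create_inv f)) + (f - p0 f) - p (Suc n) f" for f
      unfolding a using T create_inv
      by (simp add: create_diff create_add domain_D_add domain_D_scaleC p_in_domain create_scaleC create_p_create_inv)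
    then have ba: "create (annihil (T' f)) = k *\<^sub>C T' f + f - p (Suc n) f" for f
      using k by (simp add: T'_def scaleC_diff_right scaleC_scaleC)
    have "create (T g) = annihil_inv (k *\<^sub>C T g + g - p n g)" for g
    proof -
      have eq: "(of_nat (2 * n) *\<^sub>C T g + g - p n g) + 2 *\<^sub>C T g = k *\<^sub>C T g + g - p n g"
        by (simp only: k(2)[symmetric] scaleC_add_left) simp
      show ?thesis using create_eq_annihil_inv[OF T(3,4), of g] unfolding T(5) eq .
    qed
    then have "bounded_linear (\<lambda>g. create (T g))"
      using T by (simp add: bounded_linear_compose[OF annihil_inv(1)] bounded_linear_sub bounded_linear_add
          bounded_linear_scaleC_fun bounded_linear_p bounded_linear_ident)
    then have 1: "bounded_linear T'"
      unfolding T'_def by (intro bounded_linear_sub bounded_linear_scaleC_fun bounded_linear_p0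
          bounded_linear_compose[OF _ create_inv(1), of "\<lambda>g. create (T g)"])
    have 2: "bounded_linear (\<lambda>f. annihil (T' f))"
      unfolding a by (intro bounded_linear_sub bounded_linear_add bounded_linear_scaleC_fun create_inv(1)
          bounded_linear_compose[OF T(1) create_inv(1)] bounded_linear_compose[OF bounded_linear_p create_inv(1)])
    show ?case using 1 2 dT' ad ba unfolding k_def by blast
  qed
  then obtain T where T: "bounded_linear T" "bounded_linear (\<lambda>f. annihil (T f))" "\<And>f. T f \<in> domain_D"
        "\<And>f. annihil (T f) \<in> domain_D" "\<And>f. create (annihil (T f)) = of_nat (2 * n) *\<^sub>C T f + f - p n f"
    by blast
  have "create (T g) = annihil_inv ((of_nat (2 * n) *\<^sub>C T g + g - p n g) + 2 *\<^sub>C T g)" for g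
    using create_eq_annihil_inv[OF T(3,4), of g] by (simp only: T)
  then have "bounded_linear (\<lambda>g. create (T g))"
    using T by (simp only: bounded_linear_compose[OF annihil_inv(1)] bounded_linear_sub bounded_linear_add
        bounded_linear_scaleC_fun bounded_linear_p bounded_linear_ident)
  moreover have "create (T f) \<in> domain_D" for f by (rule create_in_domain[OF T(3,4)])
  ultimately show ?thesis using T by blast
qed

end

section \<open>Riesz projection at a semisimple eigenvalue\<close>

lemma bounded_bilinear_scaleC: "bounded_bilinear (\<lambda>c (x::'a::complex_normed_vector). c *\<^sub>C x)"
proof
  show "(a + b) *\<^sub>C x = a *\<^sub>C x + b *\<^sub>C x" for a b and x :: 'a by (rule scaleC_add_left)
  show "a *\<^sub>C (x + y) = a *\<^sub>C x + a *\<^sub>C y" for a and x y :: 'a by (rule scaleC_add_right)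
  show "(r *\<^sub>R a) *\<^sub>C x = r *\<^sub>R a *\<^sub>C x" for r a and x :: 'a
    by (simp add: scaleR_conv_of_real scaleC_of_real[symmetric] scaleC_scaleC)
  show "a *\<^sub>C r *\<^sub>R x = r *\<^sub>R a *\<^sub>C x" for r a and x :: 'a
    by (simp add: scaleC_of_real[symmetric] scaleC_scaleC mult.commute)
  show "\<exists>K. \<forall>a (x::'a). norm (a *\<^sub>C x) \<le> norm a * norm x * K"
    by (intro exI[of _ 1]) (simp add: norm_scaleC)
qed

text \<open>The map y \<mapsto> h - \<epsilon> T y is a contraction with constant 1/2. The a priori
  bound |y| \<le> 2 |h| gives uniqueness, and with it the linearity and boundedness of the solution
  map.\<close>

lemma neumann_inverse_ex:
  fixes T :: "'a::{complex_normed_vector, banach} \<Rightarrow> 'a"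
  assumes T: "bounded_linear T" and K: "\<And>x. norm (T x) \<le> K * norm x" and small: "cmod \<epsilon> * K \<le> 1 / 2"
  obtains Y where "bounded_linear Y" "\<And>h. Y h + \<epsilon> *\<^sub>C T (Y h) = h" "\<And>h. norm (Y h) \<le> 2 * norm h"
proof -
  interpret T: bounded_linear T by (rule T)
  have small': "norm (\<epsilon> *\<^sub>C T x) \<le> 1 / 2 * norm x" for x
  proof -
    have "norm (\<epsilon> *\<^sub>C T x) \<le> cmod \<epsilon> * (K * norm x)"
      unfolding norm_scaleC by (intro mult_left_mono K) simp
    also have "\<dots> = (cmod \<epsilon> * K) * norm x" by simp
    also have "\<dots> \<le> 1 / 2 * norm x" by (intro mult_right_mono small) simp
    finally show ?thesis .
  qed
  have bound: "norm y \<le> 2 * norm h" if "y + \<epsilon> *\<^sub>C T y = h" for y h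
  proof -
    have "norm y \<le> norm h + norm (\<epsilon> *\<^sub>C T y)"
      using that norm_triangle_ineq4[of h "\<epsilon> *\<^sub>C T y"] by (metis add_diff_cancel_right')
    then show ?thesis using small'[of y] by linarith
  qed
  have "\<exists>y. y + \<epsilon> *\<^sub>C T y = h" for h
  proof -
    have "\<exists>!y. h - \<epsilon> *\<^sub>C T y = y"
    proof (rule banach_fix_type)
      show "\<forall>x y. dist (h - \<epsilon> *\<^sub>C T x) (h - \<epsilon> *\<^sub>C T y) \<le> 1 / 2 * dist x y"
      proof (intro allI)
        fix x y
        have "(h - \<epsilon> *\<^sub>C T x) - (h - \<epsilon> *\<^sub>C T y) = \<epsilon> *\<^sub>C T (y - x)"
          by (simp add: T.diff scaleC_diff_right)
        then show "dist (h - \<epsilon> *\<^sub>C T x) (h - \<epsilon> *\<^sub>C T y) \<le> 1 / 2 * dist x y"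
          using small'[of "y - x"] by (simp add: dist_norm norm_minus_commute)
      qed
    qed auto
    then obtain y where "h - \<epsilon> *\<^sub>C T y = y" by blast
    then have "y + \<epsilon> *\<^sub>C T y = h" by (metis diff_add_cancel)
    then show ?thesis by blast
  qed
  then obtain Y where Y: "\<And>h. Y h + \<epsilon> *\<^sub>C T (Y h) = h" by metis
  have unique: "x = y" if "x + \<epsilon> *\<^sub>C T x = y + \<epsilon> *\<^sub>C T y" for x y
  proof -
    have "(x - y) + \<epsilon> *\<^sub>C T (x - y) = 0" using that by (simp add: T.diff scaleC_diff_right add_diff_add[symmetric])
    from bound[OF this] show ?thesis by simp
  qed
  have "bounded_linear Y"
  proof (rule bounded_linear_intro)
    show "Y (g + h) = Y g + Y h" for g h
    proof (rule unique)
      have "(Y g + Y h) + \<epsilon> *\<^sub>C T (Y g + Y h) = (Y g + \<epsilon> *\<^sub>C T (Y g)) + (Y h + \<epsilon> *\<^sub>C T (Y h))"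
        by (simp add: T.add scaleC_add_right)
      then show "Y (g + h) + \<epsilon> *\<^sub>C T (Y (g + h)) = (Y g + Y h) + \<epsilon> *\<^sub>C T (Y g + Y h)" by (simp add: Y)
    qed
    show "Y (r *\<^sub>R h) = r *\<^sub>R Y h" for r h
    proof (rule unique)
      have "r *\<^sub>R Y h + \<epsilon> *\<^sub>C T (r *\<^sub>R Y h) = r *\<^sub>R (Y h + \<epsilon> *\<^sub>C T (Y h))"
        by (simp add: T.scaleR scaleR_add_right bounded_bilinear.scaleR_right[OF bounded_bilinear_scaleC])
      then show "Y (r *\<^sub>R h) + \<epsilon> *\<^sub>C T (Y (r *\<^sub>R h)) = r *\<^sub>R Y h + \<epsilon> *\<^sub>C T (r *\<^sub>R Y h)" by (simp add: Y)
    qed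
    show "norm (Y h) \<le> norm h * 2" for h using bound[OF Y] by (simp add: mult.commute)
  qed
  then show thesis using that Y bound[OF Y] by blast
qed

lemma is_resolvent_resolvent: "is_resolvent D A z R \<Longrightarrow> resolvent D A z = R"
  unfolding resolvent_def using is_resolvent_unique by blast

text \<open>\<open>Q\<close> and \<open>T\<close> are the residue and the reduced resolvent at a
  simple pole. The assumption \<open>inj\<close> makes a right inverse of z - A two-sided;
  \<open>separation\<close> provides enough complex-linear functionals to identify vectors.\<close>

locale semisimple_eigenvalue =
  fixes D :: "'a::{complex_normed_vector, banach} set" and A :: "'a \<Rightarrow> 'a" and \<mu> :: complex
    and Q T :: "'a \<Rightarrow> 'a"
  assumes D_add: "u \<in> D \<Longrightarrow> v \<in> D \<Longrightarrow> u + v \<in> D" and D_scaleC: "u \<in> D \<Longrightarrow> c *\<^sub>C u \<in> D"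
    and A_add: "u \<in> D \<Longrightarrow> v \<in> D \<Longrightarrow> A (u + v) = A u + A v" and A_scaleC: "u \<in> D \<Longrightarrow> A (c *\<^sub>C u) = c *\<^sub>C A u"
    and Pi: "bounded_linear Q" "Q (c *\<^sub>C u) = c *\<^sub>C Q u" "Q u \<in> D" "A (Q u) = \<mu> *\<^sub>C Q u"
    and T: "bounded_linear T" "T u \<in> D" "\<mu> *\<^sub>C T u - A (T u) = u - Q u" "Q (T u) = 0"
    and inj: "(\<And>h. \<exists>w\<in>D. z *\<^sub>C w - A w = h) \<Longrightarrow> u \<in> D \<Longrightarrow> z *\<^sub>C u - A u = 0 \<Longrightarrow> u = 0"
    and separation: "(\<And>h. bounded_linear h \<Longrightarrow> (\<And>c v. h (c *\<^sub>C v) = c * h v) \<Longrightarrow> h u = (0::complex)) \<Longrightarrow> u = 0"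
begin

lemma D_diff: "u \<in> D \<Longrightarrow> v \<in> D \<Longrightarrow> u - v \<in> D"
  using D_add[of u "- 1 *\<^sub>C v"] D_scaleC[of v "- 1"] by (simp add: scaleC_minus1)

lemma A_diff: "u \<in> D \<Longrightarrow> v \<in> D \<Longrightarrow> A (u - v) = A u - A v"
  using A_add[of u "- 1 *\<^sub>C v"] D_scaleC[of v "- 1"] A_scaleC[of v "- 1"] by (simp add: scaleC_minus1)

text \<open>With \<epsilon> = z - \<mu>, the resolvent is T (1 + \<epsilon> T)^(-1) + Q /
  \<epsilon>, the Laurent expansion at a simple pole in closed form. The radius 1/(2 K) makes
  \<epsilon> T a contraction.\<close>

lemma resolvent_near:
  "\<exists>\<delta>>0. \<exists>K. \<forall>z. z \<noteq> \<mu> \<longrightarrow> cmod (z - \<mu>) < \<delta> \<longrightarrow> (\<exists>R. is_resolvent D A z R \<and>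
    (\<forall>u. norm ((z - \<mu>) *\<^sub>C blinfun_apply R u - Q u) \<le> cmod (z - \<mu>) * K * norm u))"
proof -
  obtain K where K: "0 < K" "\<And>x. norm (T x) \<le> norm x * K" using bounded_linear.pos_bounded[OF T(1)] by blast
  interpret Pi: bounded_linear Q by (rule Pi)
  define \<delta> where "\<delta> = 1 / (2 * K)"
  have "\<exists>R. is_resolvent D A z R \<and>
    (\<forall>u. norm ((z - \<mu>) *\<^sub>C blinfun_apply R u - Q u) \<le> cmod (z - \<mu>) * (2 * K) * norm u)"
    if z: "z \<noteq> \<mu>" "cmod (z - \<mu>) < \<delta>" for z
  proof -
    define \<epsilon> where "\<epsilon> = z - \<mu>"
    have \<epsilon>: "\<epsilon> \<noteq> 0" "z = \<mu> + \<epsilon>" using z by (simp_all add: \<epsilon>_def)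
    have "cmod \<epsilon> * K \<le> 1 / 2" using z(2) K(1) by (simp add: \<epsilon>_def \<delta>_def field_simps)
    then obtain Y where Y: "bounded_linear Y" "\<And>h. Y h + \<epsilon> *\<^sub>C T (Y h) = h" "\<And>h. norm (Y h) \<le> 2 * norm h"
      using neumann_inverse_ex[OF T(1), of K \<epsilon>] K(2) by (metis mult.commute)
    define R where "R h = T (Y h) + (1 / \<epsilon>) *\<^sub>C Q h" for h
    have R: "bounded_linear R" unfolding R_def
      by (intro bounded_linear_add bounded_linear_compose[OF T(1) Y(1)] bounded_linear_scaleC_fun Pi(1))
    have RD: "R h \<in> D" for h by (simp add: R_def D_add D_scaleC T Pi)
    have R_inv: "z *\<^sub>C R h - A (R h) = h" for h
    proof -
      \<comment> \<open>Since Q T = 0, the Neumann inverse leaves the \<open>Q\<close> component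
        unchanged.\<close>
      have "Q h = Q (Y h) + \<epsilon> *\<^sub>C Q (T (Y h))"
        by (subst Y(2)[of h, symmetric]) (simp only: Pi.add Pi(2))
      then have "Q (Y h) = Q h" by (simp add: T(4))
      then have 1: "\<mu> *\<^sub>C T (Y h) - A (T (Y h)) = Y h - Q h" by (simp add: T(3))
      have "z *\<^sub>C R h - A (R h) = (\<mu> *\<^sub>C T (Y h) - A (T (Y h))) + \<epsilon> *\<^sub>C T (Y h)
          + (\<epsilon> * (1 / \<epsilon>)) *\<^sub>C Q h"
        by (simp add: R_def A_add A_scaleC D_scaleC T(2) Pi(3,4) \<epsilon>(2) scaleC_add_left scaleC_add_right
            scaleC_scaleC mult.commute add_divide_distrib)
      also have "\<dots> = Y h + \<epsilon> *\<^sub>C T (Y h)" using \<epsilon>(1) by (simp add: 1)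
      finally show ?thesis by (simp add: Y(2))
    qed
    have "R (z *\<^sub>C u - A u) = u" if u: "u \<in> D" for u
    proof -
      let ?v = "R (z *\<^sub>C u - A u) - u"
      have "z *\<^sub>C ?v - A ?v = (z *\<^sub>C R (z *\<^sub>C u - A u) - A (R (z *\<^sub>C u - A u))) - (z *\<^sub>C u - A u)"
        by (simp add: A_diff RD u scaleC_diff_right)
      then have "z *\<^sub>C ?v - A ?v = 0" by (simp only: R_inv diff_self)
      then have "?v = 0" by (rule inj[rotated 2]) (use RD R_inv u D_diff in blast)+
      then show ?thesis by simp
    qed
    then have "is_resolvent D A z (Blinfun R)"
      unfolding is_resolvent_def bounded_linear_Blinfun_apply[OF R] using RD R_inv by blast
    moreover have "norm (\<epsilon> *\<^sub>C R u - Q u) \<le> cmod \<epsilon> * (2 * K) * norm u" for u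
    proof -
      have "\<epsilon> *\<^sub>C R u - Q u = \<epsilon> *\<^sub>C T (Y u)"
        using \<epsilon>(1) by (simp add: R_def scaleC_add_right scaleC_scaleC)
      then have "norm (\<epsilon> *\<^sub>C R u - Q u) = cmod \<epsilon> * norm (T (Y u))" by (simp add: norm_scaleC)
      moreover have t: "norm (T (Y u)) \<le> (2 * norm u) * K"
        using K(2)[of "Y u"] mult_right_mono[OF Y(3)[of u], of K] K(1) by linarith
      ultimately show ?thesis using mult_left_mono[OF t norm_ge_zero[of \<epsilon>]] by (simp add: ac_simps)
    qed
    ultimately show ?thesis
      by (intro exI[of _ "Blinfun R"]) (simp add: bounded_linear_Blinfun_apply[OF R] \<epsilon>_def)
  qed
  moreover have "0 < \<delta>" using K by (simp add: \<delta>_def)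
  ultimately show ?thesis by blast
qed

text \<open>Elements of the operator space are real-linear by type; complex linearity is inherited
  from \<open>A\<close> and is used in the resolvent identity.\<close>

lemma resolvent_scaleC:
  assumes R: "is_resolvent D A z R" shows "blinfun_apply R (c *\<^sub>C u) = c *\<^sub>C blinfun_apply R u"
proof -
  have "z *\<^sub>C (c *\<^sub>C blinfun_apply R u) - A (c *\<^sub>C blinfun_apply R u)
      = c *\<^sub>C (z *\<^sub>C blinfun_apply R u - A (blinfun_apply R u))"
  proof -
    have "blinfun_apply R u \<in> D" using R by (simp add: is_resolvent_def)
    then show ?thesis by (simp add: A_scaleC scaleC_diff_right scaleC_scaleC mult.commute)
  qed
  also have "\<dots> = c *\<^sub>C u" using R by (simp add: is_resolvent_def)
  finally have "blinfun_apply R (c *\<^sub>C u)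
      = blinfun_apply R (z *\<^sub>C (c *\<^sub>C blinfun_apply R u) - A (c *\<^sub>C blinfun_apply R u))" by simp
  also have "\<dots> = c *\<^sub>C blinfun_apply R u" using R by (simp add: is_resolvent_def D_scaleC)
  finally show ?thesis .
qed

lemma resolvent_identity:
  assumes "is_resolvent D A z R" "is_resolvent D A w S"
  shows "R - S = (w - z) *\<^sub>C (R o\<^sub>L S)"
proof (rule blinfun_eqI)
  fix u
  let ?v = "blinfun_apply S u"
  have v: "?v \<in> D" "w *\<^sub>C ?v - A ?v = u" using assms(2) by (auto simp: is_resolvent_def)
  have "?v = blinfun_apply R (z *\<^sub>C ?v - A ?v)" using assms(1) v(1) by (simp add: is_resolvent_def)
  also have "z *\<^sub>C ?v - A ?v = (w *\<^sub>C ?v - A ?v) - (w - z) *\<^sub>C ?v" by (simp add: scaleC_diff_left)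
  also have "\<dots> = u - (w - z) *\<^sub>C ?v" by (simp only: v(2))
  finally have "?v = blinfun_apply R u - (w - z) *\<^sub>C blinfun_apply R ?v"
    by (simp add: blinfun.diff_right resolvent_scaleC[OF assms(1)])
  then show "blinfun_apply (R - S) u = blinfun_apply ((w - z) *\<^sub>C (R o\<^sub>L S)) u"
    by (simp add: blinfun.diff_left scaleC_blinfun.rep_eq algebra_simps)
qed

text \<open>No bound on the resolvent near \<open>w\<close> is given in advance. The resolvent
  identity bootstraps one: for |z - w| small, |R z - R w| is at most half of |R z|, so |R z| \<le> 2
  N.\<close>

lemma resolvent_continuous:
  assumes R: "\<And>z. z \<in> S \<Longrightarrow> is_resolvent D A z (R z)"
  shows "continuous_on S R"
  unfolding continuous_on_iff
proof (intro ballI allI impI)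
  fix w and e :: real assume w: "w \<in> S" and e: "0 < e"
  define N where "N = norm (R w) + 1"
  have N: "0 < N" "norm (R w) \<le> N" by (simp_all add: N_def add_nonneg_pos)
  define d where "d = min (1 / (2 * N)) (e / (2 * N * N))"
  have "0 < d" using N e by (simp add: d_def)
  moreover have "dist (R z) (R w) < e" if z: "z \<in> S" "dist z w < d" for z
  proof -
    have dz: "cmod (w - z) * N \<le> 1 / 2" "cmod (w - z) * (2 * N * N) < e"
      using z(2) N by (auto simp: d_def dist_norm norm_minus_commute field_simps)
    have 1: "norm (R z - R w) \<le> cmod (w - z) * (norm (R z) * N)"
    proof -
      have "norm (R z - R w) = cmod (w - z) * norm (R z o\<^sub>L R w)"
        by (simp add: resolvent_identity[OF R[OF z(1)] R[OF w]] norm_scaleC)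
      also have "\<dots> \<le> cmod (w - z) * (norm (R z) * N)"
        by (intro mult_left_mono order_trans[OF norm_blinfun_compose] N) auto
      finally show ?thesis .
    qed
    have "cmod (w - z) * (norm (R z) * N) = (cmod (w - z) * N) * norm (R z)" by simp
    also have "\<dots> \<le> 1 / 2 * norm (R z)" by (intro mult_right_mono dz) simp
    finally have "norm (R z) \<le> 2 * N"
      using 1 norm_triangle_ineq2[of "R z" "R w"] N(2) by linarith
    then have "cmod (w - z) * (norm (R z) * N) \<le> cmod (w - z) * (2 * N * N)"
      using N by (intro mult_left_mono mult_right_mono) auto
    then show ?thesis using 1 dz(2) by (simp add: dist_norm)
  qed
  ultimately show "\<exists>d>0. \<forall>z\<in>S. dist z w < d \<longrightarrow> dist (R z) (R w) < e" by blast
qed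

lemma resolvent_holomorphic:
  assumes S: "open S" and R: "\<And>z. z \<in> S \<Longrightarrow> is_resolvent D A z (R z)"
    and h: "bounded_linear h" "\<And>c v. h (c *\<^sub>C v) = c * h v"
  shows "(\<lambda>z. h (blinfun_apply (R z) u)) holomorphic_on S"
  unfolding holomorphic_on_open[OF S]
proof
  fix w assume w: "w \<in> S"
  have "((\<lambda>z. (h (blinfun_apply (R z) u) - h (blinfun_apply (R w) u)) / (z - w)) \<longlongrightarrow> - h (blinfun_apply (R w) (blinfun_apply (R w) u))) (at w)"
  proof (rule Lim_transform_eventually)
    have "continuous_on S R" by (rule resolvent_continuous[OF R])
    then have "isCont R w" using S w by (simp add: continuous_on_eq_continuous_at)
    then have "(R \<longlongrightarrow> R w) (at w)" by (simp add: isCont_def)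
    then show "((\<lambda>z. - h (blinfun_apply (R z) (blinfun_apply (R w) u))) \<longlongrightarrow> - h (blinfun_apply (R w) (blinfun_apply (R w) u))) (at w)"
      by (intro tendsto_minus bounded_linear.tendsto[OF h(1)] tendsto_intros)
    have "\<forall>\<^sub>F z in at w. z \<in> S" using S w by (simp add: eventually_at_in_open')
    moreover have "\<forall>\<^sub>F z in at w. z \<noteq> w" by (simp add: eventually_neq_at_within)
    ultimately show "\<forall>\<^sub>F z in at w. - h (blinfun_apply (R z) (blinfun_apply (R w) u))
        = (h (blinfun_apply (R z) u) - h (blinfun_apply (R w) u)) / (z - w)"
    proof eventually_elim
      case (elim z)
      have "h (blinfun_apply (R z) u) - h (blinfun_apply (R w) u) = h (blinfun_apply (R z - R w) u)"
        using linear_simps(2)[OF h(1)] by (simp add: blinfun.diff_left)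
      also have "\<dots> = (w - z) * h (blinfun_apply (R z) (blinfun_apply (R w) u))"
        by (simp add: resolvent_identity[OF R[OF elim(1)] R[OF w]] scaleC_blinfun.rep_eq h(2))
      finally show ?case using elim(2) by (simp add: field_simps)
    qed
  qed
  then show "\<exists>f'. ((\<lambda>z. h (blinfun_apply (R z) u)) has_field_derivative f') (at w)"
    unfolding has_field_derivative_iff by blast
qed

text \<open>For each functional \<open>h\<close>, multiplying h(R(z) u) by z - \<mu> gives a
  function with a removable singularity at \<mu> and value h(Q u) there, so Cauchy's formula
  evaluates the contour integral. The chosen radius may exceed \<delta>: on the rest of the
  punctured disc the resolvent exists because the disc meets the spectrum at most in \<mu>.\<close>

theorem riesz_projection_eq: "blinfun_apply (riesz_projection D A \<mu>) u = Q u"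
proof -
  obtain \<delta> K where near: "0 < \<delta>" "\<And>z. z \<noteq> \<mu> \<Longrightarrow> cmod (z - \<mu>) < \<delta> \<Longrightarrow> \<exists>R. is_resolvent D A z R \<and>
    (\<forall>u. norm ((z - \<mu>) *\<^sub>C blinfun_apply R u - Q u) \<le> cmod (z - \<mu>) * K * norm u)"
    using resolvent_near by blast
  define r where "r = (SOME r. 0 < r \<and> cball \<mu> r \<inter> spectrum D A \<subseteq> {\<mu>})"
  \<comment> \<open>An admissible radius exists, so the choice operator in
    \<open>riesz_projection\<close> satisfies its specification.\<close>
  have "0 < \<delta> / 2 \<and> cball \<mu> (\<delta> / 2) \<inter> spectrum D A \<subseteq> {\<mu>}"
  proof (intro conjI subsetI)
    fix z assume z: "z \<in> cball \<mu> (\<delta> / 2) \<inter> spectrum D A"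
    then have "cmod (z - \<mu>) < \<delta>" using near(1) by (simp add: dist_norm norm_minus_commute)
    then show "z \<in> {\<mu>}" using near(2)[of z] z by (auto simp: spectrum_def)
  qed (use near(1) in simp)
  then have r: "0 < r" "cball \<mu> r \<inter> spectrum D A \<subseteq> {\<mu>}"
    using someI_ex[of "\<lambda>r. 0 < r \<and> cball \<mu> r \<inter> spectrum D A \<subseteq> {\<mu>}"] unfolding r_def by blast+
  define R where "R = resolvent D A"
  have R: "is_resolvent D A z (R z)" if "z \<in> cball \<mu> r - {\<mu>}" for z
  proof -
    have "z \<notin> spectrum D A" using r(2) that by blast
    then show ?thesis unfolding R_def spectrum_def using is_resolvent_resolvent by fastforce
  qed
  define I where "I = contour_integral_vec (circlepath \<mu> r) R"
  have path: "circlepath \<mu> r t \<in> cball \<mu> r - {\<mu>}" for t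
    using r(1) by (simp add: circlepath dist_norm norm_mult)
  have cont: "continuous_on {0..1} (\<lambda>t. vector_derivative (circlepath \<mu> r) (at t within {0..1}) *\<^sub>C R (circlepath \<mu> r t))"
  proof -
    have c0: "continuous_on {0..1} (circlepath \<mu> r)" using path_circlepath by (simp add: path_def)
    have "continuous_on (cball \<mu> r - {\<mu>}) R" by (rule resolvent_continuous[OF R])
    then have "continuous_on {0..1} (\<lambda>t. R (circlepath \<mu> r t))"
      by (rule continuous_on_compose2[OF _ c0]) (intro image_subsetI path)
    then have "continuous_on {0..1} (\<lambda>t. (2 * pi * \<i> * r * exp (2 * of_real pi * \<i> * of_real t)) *\<^sub>C R (circlepath \<mu> r t))"
      by (intro bounded_bilinear.continuous_on[OF bounded_bilinear_scaleC] continuous_intros)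
    then show ?thesis
      by (rule continuous_on_eq) (simp add: vector_derivative_circlepath01)
  qed
  have I: "((\<lambda>t. vector_derivative (circlepath \<mu> r) (at t within {0..1}) *\<^sub>C R (circlepath \<mu> r t)) has_integral I) {0..1}"
    unfolding I_def contour_integral_vec_def by (intro integrable_integral integrable_continuous_interval cont)
  have key: "h (blinfun_apply I u) = 2 * of_real pi * \<i> * h (Q u)"
    if h: "bounded_linear h" "\<And>c v. h (c *\<^sub>C v) = c * h v" for h :: "'a \<Rightarrow> complex"
  proof -
    interpret h: bounded_linear h by (rule h)
    define F where "F z = (if z = \<mu> then h (Q u) else (z - \<mu>) * h (blinfun_apply (R z) u))" for z
    have hol: "F holomorphic_on (ball \<mu> r - {\<mu>})"
    proof -
      have "(\<lambda>z. (z - \<mu>) * h (blinfun_apply (R z) u)) holomorphic_on (ball \<mu> r - {\<mu>})"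
        by (intro holomorphic_intros resolvent_holomorphic h R open_delete open_ball) auto
      then show ?thesis by (rule holomorphic_transform) (simp add: F_def)
    qed
    have "continuous (at z within cball \<mu> r) F" if z: "z \<in> cball \<mu> r" for z
    proof (cases "z = \<mu>")
      case True
      obtain H where H: "0 < H" "\<And>v. cmod (h v) \<le> norm v * H" using h.pos_bounded by blast
      have "\<forall>\<^sub>F z in at \<mu>. cmod (F z - h (Q u)) \<le> cmod (z - \<mu>) * (K * norm u * H)"
      proof -
        have "\<forall>\<^sub>F z in at \<mu>. z \<noteq> \<mu> \<and> dist z \<mu> < min \<delta> r"
          using near(1) r(1) unfolding eventually_at by (intro exI[of _ "min \<delta> r"]) auto
        then show ?thesis
        proof eventually_elim
          case (elim z)
          then have z: "z \<in> cball \<mu> r - {\<mu>}" by (simp add: dist_commute)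
          obtain R' where R': "is_resolvent D A z R'"
            "norm ((z - \<mu>) *\<^sub>C blinfun_apply R' u - Q u) \<le> cmod (z - \<mu>) * K * norm u"
            using near(2)[of z] elim by (auto simp: dist_norm)
          have "R' = R z" using is_resolvent_unique[OF R'(1) R[OF z]] .
          then have "F z - h (Q u) = h ((z - \<mu>) *\<^sub>C blinfun_apply R' u - Q u)"
            using elim by (simp add: F_def h.diff h(2))
          also have "cmod \<dots> \<le> (cmod (z - \<mu>) * K * norm u) * H"
            by (rule order_trans[OF H(2) mult_right_mono[OF R'(2) less_imp_le[OF H(1)]]])
          finally show ?case by (simp add: ac_simps)
        qed
      qed
      moreover have "((\<lambda>z. cmod (z - \<mu>) * (K * norm u * H)) \<longlongrightarrow> 0) (at \<mu>)"
        by (auto intro!: tendsto_eq_intros)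
      ultimately have "((\<lambda>z. F z - h (Q u)) \<longlongrightarrow> 0) (at \<mu>)" by (rule Lim_null_comparison)
      then have "(F \<longlongrightarrow> h (Q u)) (at \<mu>)" by (rule LIM_zero_cancel)
      then have "(F \<longlongrightarrow> F \<mu>) (at \<mu>)" by (simp add: F_def)
      then show ?thesis
        using True by (metis continuous_at_imp_continuous_at_within isCont_def)
    next
      case False
      have "continuous_on (cball \<mu> r - {\<mu>}) (\<lambda>z. (z - \<mu>) * h (blinfun_apply (R z) u))"
        by (intro continuous_intros h.continuous_on resolvent_continuous R)
      then have "continuous_on (cball \<mu> r - {\<mu>}) F"
        by (rule continuous_on_eq) (simp add: F_def)
      then have "continuous (at z within cball \<mu> r - {\<mu>}) F"
        using z False by (simp add: continuous_on_eq_continuous_within)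
      moreover have "at z within cball \<mu> r - {\<mu>} = at z within cball \<mu> r"
        using False by (intro at_within_nhd[of _ "- {\<mu>}"]) auto
      ultimately show ?thesis by simp
    qed
    then have contF: "continuous_on (cball \<mu> r) F" by (simp add: continuous_on_eq_continuous_within)
    have "F holomorphic_on ball \<mu> r"
      by (rule no_isolated_singularity[where K = "{\<mu>}"]) (use contF hol in \<open>auto intro: continuous_on_subset\<close>)
    then have "((\<lambda>z. F z / (z - \<mu>)) has_contour_integral (2 * of_real pi * \<i> * F \<mu>)) (circlepath \<mu> r)"
      using contF r(1) by (intro Cauchy_integral_circlepath) auto
    then have 1: "((\<lambda>t. F (circlepath \<mu> r t) / (circlepath \<mu> r t - \<mu>) * vector_derivative (circlepath \<mu> r) (at t within {0..1}))
        has_integral (2 * of_real pi * \<i> * h (Q u))) {0..1}"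
      by (simp add: has_contour_integral_def F_def)
    have "bounded_linear (\<lambda>B. h (blinfun_apply B u))"
      by (intro bounded_linear_compose[OF h(1)] blinfun.bounded_linear_left)
    from has_integral_linear[OF I this]
    have 2: "((\<lambda>t. h (blinfun_apply (vector_derivative (circlepath \<mu> r) (at t within {0..1}) *\<^sub>C R (circlepath \<mu> r t)) u))
        has_integral h (blinfun_apply I u)) {0..1}" by (simp add: o_def)
    have "h (blinfun_apply (vector_derivative (circlepath \<mu> r) (at t within {0..1}) *\<^sub>C R (circlepath \<mu> r t)) u)
      = F (circlepath \<mu> r t) / (circlepath \<mu> r t - \<mu>) * vector_derivative (circlepath \<mu> r) (at t within {0..1})" for t
      using path[of t] by (simp add: scaleC_blinfun.rep_eq h(2) F_def)
    with 2 have "((\<lambda>t. F (circlepath \<mu> r t) / (circlepath \<mu> r t - \<mu>) * vector_derivative (circlepath \<mu> r) (at t within {0..1}))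
        has_integral h (blinfun_apply I u)) {0..1}" by simp
    then show ?thesis using 1 by (rule has_integral_unique)
  qed
  have "riesz_projection D A \<mu> = (1 / (2 * of_real pi * \<i>)) *\<^sub>C I"
    by (simp add: riesz_projection_def Let_def r_def I_def R_def)
  then have "blinfun_apply (riesz_projection D A \<mu>) u = (1 / (2 * of_real pi * \<i>)) *\<^sub>C blinfun_apply I u"
    by (simp add: scaleC_blinfun.rep_eq)
  moreover have "(1 / (2 * of_real pi * \<i>)) *\<^sub>C blinfun_apply I u - Q u = 0"
  proof (rule separation)
    fix h :: "'a \<Rightarrow> complex" assume h: "bounded_linear h" "\<And>c v. h (c *\<^sub>C v) = c * h v"
    show "h ((1 / (2 * of_real pi * \<i>)) *\<^sub>C blinfun_apply I u - Q u) = 0"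
      using key[OF h] linear_simps(2)[OF h(1)] by (simp add: h(2))
  qed
  ultimately show ?thesis by simp
qed

end

section \<open>Spectral projections of the Dirac operator\<close>

lemma vector_4 [simp]:
  "(vector [a, b, c, d] :: ('a::zero) ^ 4) $ 1 = a"
  "(vector [a, b, c, d] :: ('a::zero) ^ 4) $ 2 = b"
  "(vector [a, b, c, d] :: ('a::zero) ^ 4) $ 3 = c"
  "(vector [a, b, c, d] :: ('a::zero) ^ 4) $ 4 = d"
  unfolding vector_def by simp_all

lemma vec4_eq_iff: "(u :: 'a ^ 4) = v \<longleftrightarrow> u $ 1 = v $ 1 \<and> u $ 2 = v $ 2 \<and> u $ 3 = v $ 3 \<and> u $ 4 = v $ 4"
  by (simp add: vec_eq_iff forall_4)

lemma scaleC_vec_nth [simp]: "(c *\<^sub>C v) $ i = c *\<^sub>C (v $ i)"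
  by (simp add: scaleC_vec_def)

lemma norm_vec_le_sum: "norm v \<le> (\<Sum>i\<in>UNIV. norm (v $ i))"
  unfolding norm_vec_def by (rule L2_set_le_sum) simp

lemma bounded_linear_vecI:
  fixes f :: "'a::real_normed_vector \<Rightarrow> 'b::real_normed_vector ^ 'n"
  assumes f: "\<And>i. bounded_linear (\<lambda>x. f x $ i)"
  shows "bounded_linear f"
proof (rule bounded_linear_intro)
  show "f (x + y) = f x + f y" for x y using linear_simps(1)[OF f] by (simp add: vec_eq_iff)
  show "f (r *\<^sub>R x) = r *\<^sub>R f x" for r x using linear_simps(5)[OF f] by (simp add: vec_eq_iff)
  show "norm (f x) \<le> norm x * (\<Sum>i\<in>UNIV. onorm (\<lambda>x. f x $ i))" for x
  proof -
    have "norm (f x) \<le> (\<Sum>i\<in>UNIV. norm (f x $ i))" by (rule norm_vec_le_sum)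
    also have "\<dots> \<le> (\<Sum>i\<in>UNIV. onorm (\<lambda>x. f x $ i) * norm x)"
      by (intro sum_mono onorm f)
    finally show ?thesis by (simp add: sum_distrib_left mult.commute)
  qed
qed

lemma bounded_linear_vec4I:
  fixes f :: "'a::real_normed_vector \<Rightarrow> 'b::real_normed_vector ^ 4"
  assumes "bounded_linear (\<lambda>x. f x $ 1)" "bounded_linear (\<lambda>x. f x $ 2)"
    "bounded_linear (\<lambda>x. f x $ 3)" "bounded_linear (\<lambda>x. f x $ 4)"
  shows "bounded_linear f"
proof (rule bounded_linear_vecI)
  fix i :: 4 show "bounded_linear (\<lambda>x. f x $ i)" using exhaust_4[of i] assms by auto
qed

lemma bounded_linear_bil: "bounded_linear (\<lambda>u. bil u v)"
proof (rule bounded_linear_intro[where K = "norm v"])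
  show "bil (r *\<^sub>R u) v = r *\<^sub>R bil u v" for r u
    by (metis bil_scaleC_left scaleC_of_real scaleR_conv_of_real)
  show "norm (bil u v) \<le> norm u * norm v" for u by (rule norm_bil_le)
qed (rule bil_add_left)

lemma H_domain_iff: "\<psi> \<in> H_domain \<longleftrightarrow> \<psi> $ 1 \<in> domain_D \<and> \<psi> $ 2 \<in> domain_D \<and> \<psi> $ 3 \<in> domain_D \<and> \<psi> $ 4 \<in> domain_D"
  by (simp add: H_domain_def forall_4)

text \<open>
  The Dirac operator is symmetric for this form, so that surjectivity of \<open>z - H\<close> implies its injectivity.
\<close>

definition J_form :: "l2 ^ 4 \<Rightarrow> l2 ^ 4 \<Rightarrow> complex" where
  "J_form u v = bil (u $ 1) (v $ 1) - bil (u $ 2) (v $ 2) + bil (u $ 3) (v $ 3) - bil (u $ 4) (v $ 4)"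

lemma J_form_diff: "J_form (u - v) w = J_form u w - J_form v w" "J_form w (u - v) = J_form w u - J_form w v"
  by (simp_all add: J_form_def bil_simps)

lemma J_form_scaleC: "J_form (c *\<^sub>C u) w = c * J_form u w" "J_form w (c *\<^sub>C u) = c * J_form w u"
  by (simp_all add: J_form_def bil_simps algebra_simps)

lemma J_form_separates:
  assumes "\<And>v. J_form u v = 0" shows "u = 0"
proof -
  have "u $ 1 = 0" by (rule bil_separates) (use assms[of "vector [_, 0, 0, 0]"] in \<open>simp add: J_form_def\<close>)
  moreover have "u $ 2 = 0" by (rule bil_separates) (use assms[of "vector [0, _, 0, 0]"] in \<open>simp add: J_form_def\<close>)
  moreover have "u $ 3 = 0" by (rule bil_separates) (use assms[of "vector [0, 0, _, 0]"] in \<open>simp add: J_form_def\<close>)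
  moreover have "u $ 4 = 0" by (rule bil_separates) (use assms[of "vector [0, 0, 0, _]"] in \<open>simp add: J_form_def\<close>)
  ultimately show ?thesis by (simp add: vec4_eq_iff)
qed

lemma H_domain_add: "u \<in> H_domain \<Longrightarrow> v \<in> H_domain \<Longrightarrow> u + v \<in> H_domain"
  and H_domain_scaleC: "u \<in> H_domain \<Longrightarrow> c *\<^sub>C u \<in> H_domain"
  and H_domain_diff: "u \<in> H_domain \<Longrightarrow> v \<in> H_domain \<Longrightarrow> u - v \<in> H_domain"
  by (simp_all add: H_domain_iff domain_D_add domain_D_scaleC domain_D_diff)

lemmas scaleC_simps = scaleC_add_right scaleC_add_left scaleC_diff_right scaleC_diff_left
  scaleC_minus_right scaleC_minus_left scaleC_scaleC

section \<open>The Dirac operator in terms of ladder operators\<close>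

context rotated
begin

lemma H_op_nth:
  "H_op m \<theta> \<psi> $ 1 = of_real m *\<^sub>C \<psi> $ 3 + \<i> *\<^sub>C create (\<psi> $ 4)"
  "H_op m \<theta> \<psi> $ 2 = - (\<i> *\<^sub>C annihil (\<psi> $ 3)) - of_real m *\<^sub>C \<psi> $ 4"
  "H_op m \<theta> \<psi> $ 3 = of_real m *\<^sub>C \<psi> $ 1 + \<i> *\<^sub>C create (\<psi> $ 2)"
  "H_op m \<theta> \<psi> $ 4 = - (\<i> *\<^sub>C annihil (\<psi> $ 1)) - of_real m *\<^sub>C \<psi> $ 2"
  unfolding H_op_def E_def[symmetric] E'_def[symmetric]
  by (simp_all add: matrix_apply_def sum_4 dirac_alpha1_def dirac_alpha2_def dirac_alpha3_def
      off_diagonal_blocks_def pauli1_def pauli2_def pauli3_def create_def annihil_def scaleC_simps mult.commute)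

lemma H_add: "u \<in> H_domain \<Longrightarrow> v \<in> H_domain \<Longrightarrow> H_op m \<theta> (u + v) = H_op m \<theta> u + H_op m \<theta> v"
  by (simp add: vec4_eq_iff H_op_nth H_domain_iff create_add annihil_add scaleC_simps)

lemma H_scaleC: "u \<in> H_domain \<Longrightarrow> H_op m \<theta> (c *\<^sub>C u) = c *\<^sub>C H_op m \<theta> u"
  by (simp add: vec4_eq_iff H_op_nth H_domain_iff create_scaleC annihil_scaleC scaleC_simps mult.commute)

lemma H_diff: "u \<in> H_domain \<Longrightarrow> v \<in> H_domain \<Longrightarrow> H_op m \<theta> (u - v) = H_op m \<theta> u - H_op m \<theta> v"
  by (simp add: vec4_eq_iff H_op_nth H_domain_iff create_diff annihil_diff scaleC_simps)

lemma J_form_H: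
  "u \<in> H_domain \<Longrightarrow> v \<in> H_domain \<Longrightarrow> J_form (H_op m \<theta> u) v = J_form u (H_op m \<theta> v)"
  by (simp add: J_form_def H_op_nth H_domain_iff bil_simps bil_create bil_annihil algebra_simps)

text \<open>The projection for the square of the operator. The eigenvalue 2 (k + 1) belongs to
  \<open>phi (Suc k)\<close> for create \<circ> annihil but to \<open>phi k\<close> for annihil
  \<circ> create, hence the alternating levels.\<close>

definition P :: "nat \<Rightarrow> l2 ^ 4 \<Rightarrow> l2 ^ 4" where
  "P k \<psi> = vector [p (Suc k) (\<psi> $ 1), p k (\<psi> $ 2), p (Suc k) (\<psi> $ 3), p k (\<psi> $ 4)]"

lemma P_nth:
  "P k \<psi> $ 1 = p (Suc k) (\<psi> $ 1)" "P k \<psi> $ 2 = p k (\<psi> $ 2)"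
  "P k \<psi> $ 3 = p (Suc k) (\<psi> $ 3)" "P k \<psi> $ 4 = p k (\<psi> $ 4)"
  by (simp_all add: P_def)

lemma create_p_in_domain: "create (p n f) \<in> domain_D"
  using domain_D_scaleC(1)[OF phi_in_domain, of _ "Suc n"] by (simp add: p_def create_scaleC phi_in_domain)

lemma annihil_p_in_domain: "annihil (p n f) \<in> domain_D"
  by (simp add: p_def annihil_scaleC phi_in_domain annihil_phi domain_D_scaleC)

lemmas p_domain = p_in_domain create_p_in_domain annihil_p_in_domain

lemma P_in_domain: "P k \<psi> \<in> H_domain" and HP_in_domain: "H_op m \<theta> (P k \<psi>) \<in> H_domain"
  by (simp_all add: H_domain_iff P_nth H_op_nth p_domain domain_D_add domain_D_diff domain_D_uminus domain_D_scaleC)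

lemma P_scaleC: "P k (c *\<^sub>C \<psi>) = c *\<^sub>C P k \<psi>"
  by (simp add: vec4_eq_iff P_nth p_scaleC)

lemma P_add: "P k (u + v) = P k u + P k v"
  by (simp add: vec4_eq_iff P_nth p_add)

lemma P_P: "P k (P k \<psi>) = P k \<psi>"
  by (simp add: vec4_eq_iff P_nth p_p)

text \<open>The off-diagonal entries of the operator raise level k to k + 1 and lower it back, which
  matches the alternating levels of \<open>P k\<close>.\<close>

lemma P_H_P: "P k (H_op m \<theta> (P k \<psi>)) = H_op m \<theta> (P k \<psi>)"
  by (simp add: vec4_eq_iff P_nth H_op_nth p_add p_diff p_minus p_scaleC p_p
      create_p[OF p_in_domain, symmetric] annihil_p[OF p_in_domain, symmetric])

lemma H_H_P:
  assumes "\<mu>\<^sup>2 = of_real (m\<^sup>2) + of_nat (2 * Suc k)"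
  shows "H_op m \<theta> (H_op m \<theta> (P k \<psi>)) = \<mu>\<^sup>2 *\<^sub>C P k \<psi>"
  unfolding assms
  by (simp add: vec4_eq_iff P_nth H_op_nth p_domain domain_D_scaleC domain_D_add domain_D_diff domain_D_uminus
      create_add create_diff create_minus create_scaleC annihil_add annihil_diff annihil_minus annihil_scaleC
      create_annihil_p annihil_create_p scaleC_simps power2_eq_square mult.commute)

lemma bounded_linear_HP: "bounded_linear (\<lambda>\<psi>. H_op m \<theta> (P k \<psi>))" and bounded_linear_P: "bounded_linear (P k)"
proof -
  note nth = bounded_linear_vec_nth
  have c: "bounded_linear (\<lambda>f. create (p n f))" and a: "bounded_linear (\<lambda>f. annihil (p n f))" for n
  proof -
    have b: "bounded_linear (\<lambda>f. (bil (phi n) f / kappa n) *\<^sub>C v)" for v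
      using bounded_linear_bil[of "phi n"]
      by (intro bounded_linear_compose[OF bounded_bilinear.bounded_linear_left[OF bounded_bilinear_scaleC]]
          bounded_linear_divide[THEN bounded_linear_compose]) (simp add: bil_commute)
    show "bounded_linear (\<lambda>f. create (p n f))" "bounded_linear (\<lambda>f. annihil (p n f))"
      using b by (simp_all add: p_def create_scaleC annihil_scaleC phi_in_domain)
  qed
  show "bounded_linear (P k)"
    by (rule bounded_linear_vec4I) (simp_all add: P_nth bounded_linear_compose[OF bounded_linear_p nth])
  show "bounded_linear (\<lambda>\<psi>. H_op m \<theta> (P k \<psi>))"
    by (rule bounded_linear_vec4I)
      (simp_all add: P_nth H_op_nth bounded_linear_add bounded_linear_sub bounded_linear_minus bounded_linear_scaleC_fun
        bounded_linear_compose[OF bounded_linear_p nth] bounded_linear_compose[OF c nth] bounded_linear_compose[OF a nth])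
qed

text \<open>On the range of \<open>P k\<close> the square of H is \<mu>^2, so (H + \<mu>) / (2
  \<mu>) splits off the eigenvalue \<mu> from its negative.\<close>

definition eigenprojection :: "real \<Rightarrow> complex \<Rightarrow> nat \<Rightarrow> l2 ^ 4 \<Rightarrow> l2 ^ 4" where
  "eigenprojection m \<mu> k \<psi> = (1 / 2) *\<^sub>C P k \<psi> + (1 / (2 * \<mu>)) *\<^sub>C H_op m \<theta> (P k \<psi>)"

text \<open>\<open>X\<close> is the reduced resolvent of the squared operator: (H^2 - \<mu>^2) X = 1
  - P. It is diagonal, built from the scalar reduced resolvents at levels k + 1 and k.\<close>

lemma square_inverse_ex:
  assumes "\<mu>\<^sup>2 = of_real (m\<^sup>2) + of_nat (2 * Suc k)"
  obtains X where "bounded_linear X" "bounded_linear (\<lambda>\<psi>. H_op m \<theta> (X \<psi>))" "\<And>\<psi>. X \<psi> \<in> H_domain"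
    "\<And>\<psi>. H_op m \<theta> (X \<psi>) \<in> H_domain" "\<And>\<psi>. H_op m \<theta> (H_op m \<theta> (X \<psi>)) = \<mu>\<^sup>2 *\<^sub>C X \<psi> + (\<psi> - P k \<psi>)"
proof -
  obtain T where T: "bounded_linear T" "bounded_linear (\<lambda>f. annihil (T f))" "bounded_linear (\<lambda>f. create (T f))"
    "\<And>f. T f \<in> domain_D" "\<And>f. annihil (T f) \<in> domain_D" "\<And>f. create (T f) \<in> domain_D"
    "\<And>f. create (annihil (T f)) = of_nat (2 * Suc k) *\<^sub>C T f + f - p (Suc k) f"
    using reduced_resolvent_ex[of "Suc k"] by blast
  obtain S where S: "bounded_linear S" "bounded_linear (\<lambda>f. annihil (S f))" "bounded_linear (\<lambda>f. create (S f))"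
    "\<And>f. S f \<in> domain_D" "\<And>f. annihil (S f) \<in> domain_D" "\<And>f. create (S f) \<in> domain_D"
    "\<And>f. create (annihil (S f)) = of_nat (2 * k) *\<^sub>C S f + f - p k f"
    using reduced_resolvent_ex[of k] by blast
  \<comment> \<open>The commutator adds 2 S f, which raises 2 k to the common value 2 (k +
    1).\<close>
  have S': "annihil (create (S f)) = of_nat (2 * Suc k) *\<^sub>C S f + f - p k f" for f
    unfolding annihil_create[OF S(4,5)] S(7) by (simp add: scaleC_add_left algebra_simps)
  define X :: "l2 ^ 4 \<Rightarrow> l2 ^ 4" where "X \<psi> = vector [T (\<psi> $ 1), S (\<psi> $ 2), T (\<psi> $ 3), S (\<psi> $ 4)]" for \<psi>
  have X: "X \<psi> $ 1 = T (\<psi> $ 1)" "X \<psi> $ 2 = S (\<psi> $ 2)" "X \<psi> $ 3 = T (\<psi> $ 3)" "X \<psi> $ 4 = S (\<psi> $ 4)" for \<psi>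
    by (simp_all add: X_def)
  note nth = bounded_linear_vec_nth
  show thesis
  proof (rule that[of X])
    show "bounded_linear X"
      by (rule bounded_linear_vec4I)
        (simp_all add: X bounded_linear_compose[OF T(1) nth] bounded_linear_compose[OF S(1) nth])
    show "bounded_linear (\<lambda>\<psi>. H_op m \<theta> (X \<psi>))"
      by (rule bounded_linear_vec4I)
        (simp_all add: X H_op_nth bounded_linear_add bounded_linear_sub bounded_linear_minus bounded_linear_scaleC_fun
          bounded_linear_compose[OF T(1) nth] bounded_linear_compose[OF S(1) nth]
          bounded_linear_compose[OF T(2) nth] bounded_linear_compose[OF S(3) nth])
    show "X \<psi> \<in> H_domain" "H_op m \<theta> (X \<psi>) \<in> H_domain" for \<psi>
      by (simp_all add: H_domain_iff X H_op_nth T S domain_D_add domain_D_diff domain_D_uminus domain_D_scaleC)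
    show "H_op m \<theta> (H_op m \<theta> (X \<psi>)) = \<mu>\<^sup>2 *\<^sub>C X \<psi> + (\<psi> - P k \<psi>)" for \<psi>
      unfolding assms
      by (simp add: vec4_eq_iff X P_nth H_op_nth T S S' domain_D_scaleC domain_D_add domain_D_diff domain_D_uminus
          create_add create_diff create_minus create_scaleC annihil_add annihil_diff annihil_minus annihil_scaleC
          scaleC_simps power2_eq_square mult.commute)
  qed
qed

text \<open>The locale is instantiated with a reduced resolvent assembled from \<open>X\<close> on
  the complement of \<open>P k\<close> and from the explicit inverse on the eigenspace of -
  \<mu>.\<close>

theorem riesz_projection_H:
  assumes ev: "\<mu>\<^sup>2 = of_real (m\<^sup>2) + of_nat (2 * Suc k)" and nz: "\<mu> \<noteq> 0"
  shows "blinfun_apply (riesz_projection H_domain (H_op m \<theta>) \<mu>) \<psi> = eigenprojection m \<mu> k \<psi>"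
proof -
  define H where "H = H_op m \<theta>"
  define Q where "Q = eigenprojection m \<mu> k"
  \<comment> \<open>The projection onto the eigenspace of - \<mu>, complementary to \<open>Q\<close>
    inside \<open>P k\<close>.\<close>
  define M where "M \<psi> = (1 / 2) *\<^sub>C P k \<psi> - (1 / (2 * \<mu>)) *\<^sub>C H (P k \<psi>)" for \<psi>
  have Q_eq: "Q \<psi> = (1 / 2) *\<^sub>C P k \<psi> + (1 / (2 * \<mu>)) *\<^sub>C H (P k \<psi>)" for \<psi>
    by (simp add: Q_def eigenprojection_def H_def)
  have QM: "Q \<psi> + M \<psi> = P k \<psi>" for \<psi>
    by (simp add: Q_eq M_def scaleC_add_left[symmetric])
  have dom: "P k \<psi> \<in> H_domain" "H (P k \<psi>) \<in> H_domain" "M \<psi> \<in> H_domain" "Q \<psi> \<in> H_domain" for \<psi>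
    by (simp_all add: H_def M_def Q_eq P_in_domain HP_in_domain H_domain_add H_domain_diff H_domain_scaleC)
  have HHP: "H (H (P k \<psi>)) = \<mu>\<^sup>2 *\<^sub>C P k \<psi>" for \<psi> unfolding H_def by (rule H_H_P[OF ev])
  have c: "1 / (2 * \<mu>) * \<mu>\<^sup>2 = \<mu> * (1 / 2)" "\<mu> * (1 / (2 * \<mu>)) = 1 / 2" "1 / (2 * \<mu>) * (2 * \<mu>) = 1"
    using nz by (simp_all add: power2_eq_square field_simps)
  have HQ: "H (Q \<psi>) = \<mu> *\<^sub>C Q \<psi>" for \<psi>
  proof -
    have "H (Q \<psi>) = (1 / 2) *\<^sub>C H (P k \<psi>) + (1 / (2 * \<mu>) * \<mu>\<^sup>2) *\<^sub>C P k \<psi>"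
      unfolding Q_eq using dom by (simp only: H_def H_add H_scaleC H_domain_scaleC)
        (simp only: H_def[symmetric] HHP scaleC_scaleC)
    also have "\<dots> = \<mu> *\<^sub>C Q \<psi>" unfolding c Q_eq scaleC_add_right scaleC_scaleC by simp
    finally show ?thesis .
  qed
  have HM: "H (M \<psi>) = - (\<mu> *\<^sub>C M \<psi>)" for \<psi>
  proof -
    have "H (M \<psi>) = (1 / 2) *\<^sub>C H (P k \<psi>) - (1 / (2 * \<mu>) * \<mu>\<^sup>2) *\<^sub>C P k \<psi>"
      unfolding M_def using dom by (simp only: H_def H_diff H_scaleC H_domain_scaleC)
        (simp only: H_def[symmetric] HHP scaleC_scaleC)
    also have "\<dots> = - (\<mu> *\<^sub>C M \<psi>)" unfolding c M_def scaleC_diff_right scaleC_scaleC by simp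
    finally show ?thesis .
  qed
  have Q_scaleC: "Q (c *\<^sub>C \<psi>) = c *\<^sub>C Q \<psi>" for c \<psi>
    using dom by (simp add: Q_eq P_scaleC H_def H_scaleC P_in_domain scaleC_simps mult.commute)
  have PQ: "P k (Q \<psi>) = Q \<psi>" for \<psi>
    by (simp add: Q_eq P_add P_scaleC P_P H_def P_H_P)
  have QQ: "Q (Q \<psi>) = Q \<psi>" for \<psi>
  proof -
    have "Q (Q \<psi>) = (1 / 2) *\<^sub>C Q \<psi> + (1 / (2 * \<mu>) * \<mu>) *\<^sub>C Q \<psi>"
      by (subst Q_eq) (simp only: PQ HQ scaleC_scaleC)
    also have "\<dots> = Q \<psi>" using nz by (simp add: scaleC_add_left[symmetric])
    finally show ?thesis .
  qed
  have Q_bl: "bounded_linear Q"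
    unfolding Q_eq H_def by (intro bounded_linear_add bounded_linear_scaleC_fun bounded_linear_P bounded_linear_HP)
  have M_bl: "bounded_linear M"
    unfolding M_def H_def by (intro bounded_linear_sub bounded_linear_scaleC_fun bounded_linear_P bounded_linear_HP)
  obtain X where X: "bounded_linear X" "bounded_linear (\<lambda>\<psi>. H (X \<psi>))" "\<And>\<psi>. X \<psi> \<in> H_domain"
    "\<And>\<psi>. H (X \<psi>) \<in> H_domain" "\<And>\<psi>. H (H (X \<psi>)) = \<mu>\<^sup>2 *\<^sub>C X \<psi> + (\<psi> - P k \<psi>)"
    using square_inverse_ex[OF ev] unfolding H_def by blast
  \<comment> \<open>On the range of \<open>M\<close> the operator \<mu> - H equals 2 \<mu>;
    elsewhere (\<mu> - H) (H + \<mu>) = \<mu>^2 - H^2 turns - (H + \<mu>) X into the inverse. The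
    two parts add up to (\<mu> - H) Y = 1 - Q.\<close>
  define Y where "Y \<psi> = (1 / (2 * \<mu>)) *\<^sub>C M \<psi> - (H (X \<psi>) + \<mu> *\<^sub>C X \<psi>)" for \<psi>
  have Y_bl: "bounded_linear Y"
    unfolding Y_def by (intro bounded_linear_add bounded_linear_sub bounded_linear_scaleC_fun M_bl X)
  have Y_dom: "Y \<psi> \<in> H_domain" for \<psi>
    by (simp add: Y_def H_domain_add H_domain_diff H_domain_scaleC dom X)
  have Y: "\<mu> *\<^sub>C Y \<psi> - H (Y \<psi>) = \<psi> - Q \<psi>" for \<psi>
  proof -
    have "H (Y \<psi>) = (1 / (2 * \<mu>)) *\<^sub>C H (M \<psi>) - (H (H (X \<psi>)) + \<mu> *\<^sub>C H (X \<psi>))"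
      unfolding Y_def using dom(3)[of \<psi>] X(3,4)[of \<psi>]
      by (simp only: H_def H_add H_diff H_scaleC H_domain_scaleC H_domain_add)
    also have "\<dots> = - ((1 / 2) *\<^sub>C M \<psi>) - (\<mu>\<^sup>2 *\<^sub>C X \<psi> + (\<psi> - P k \<psi>) + \<mu> *\<^sub>C H (X \<psi>))"
      unfolding HM X(5) using nz by (simp add: scaleC_minus_right scaleC_scaleC mult.commute)
    finally have 1: "H (Y \<psi>) = - ((1 / 2) *\<^sub>C M \<psi>) - (\<mu>\<^sup>2 *\<^sub>C X \<psi> + (\<psi> - P k \<psi>) + \<mu> *\<^sub>C H (X \<psi>))" .
    have 2: "\<mu> *\<^sub>C Y \<psi> = (1 / 2) *\<^sub>C M \<psi> - (\<mu> *\<^sub>C H (X \<psi>) + \<mu>\<^sup>2 *\<^sub>C X \<psi>)"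
      unfolding Y_def scaleC_diff_right scaleC_add_right scaleC_scaleC c(2) power2_eq_square ..
    have "(1 / 2) *\<^sub>C M \<psi> + (1 / 2) *\<^sub>C M \<psi> = M \<psi>" by (simp add: scaleC_add_left[symmetric])
    then show ?thesis unfolding 1 2 QM[of \<psi>, symmetric] by (simp add: algebra_simps)
  qed
  \<comment> \<open>Removing the \<open>Q\<close> component secures Q T = 0 and does not change
    (\<mu> - H) Y, since \<mu> - H vanishes on the range of \<open>Q\<close>.\<close>
  define T where "T \<psi> = Y \<psi> - Q (Y \<psi>)" for \<psi>
  have eq: "blinfun_apply (riesz_projection H_domain H \<mu>) \<psi> = Q \<psi>"
  proof (rule semisimple_eigenvalue.riesz_projection_eq[where T = T and Q = Q], rule semisimple_eigenvalue.intro)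
    show "bounded_linear Q" "\<And>c u. Q (c *\<^sub>C u) = c *\<^sub>C Q u" "\<And>u. Q u \<in> H_domain" "\<And>u. H (Q u) = \<mu> *\<^sub>C Q u"
      by (rule Q_bl Q_scaleC dom HQ)+
    show "\<And>u v. u \<in> H_domain \<Longrightarrow> v \<in> H_domain \<Longrightarrow> u + v \<in> H_domain" "\<And>u c. u \<in> H_domain \<Longrightarrow> c *\<^sub>C u \<in> H_domain"
      by (rule H_domain_add H_domain_scaleC; assumption)+
    show "\<And>u v. u \<in> H_domain \<Longrightarrow> v \<in> H_domain \<Longrightarrow> H (u + v) = H u + H v"
      "\<And>u c. u \<in> H_domain \<Longrightarrow> H (c *\<^sub>C u) = c *\<^sub>C H u"
      unfolding H_def by (rule H_add H_scaleC; assumption)+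
    show "bounded_linear T"
      unfolding T_def by (intro bounded_linear_sub bounded_linear_compose[OF Q_bl Y_bl] Y_bl)
    show "T u \<in> H_domain" for u by (simp add: T_def H_domain_diff Y_dom dom)
    show "\<mu> *\<^sub>C T u - H (T u) = u - Q u" for u
      using Y[of u] HQ[of "Y u"] Y_dom[of u] dom(4)[of "Y u"]
      by (simp add: T_def H_def H_diff scaleC_diff_right)
    show "Q (T u) = 0" for u
      by (simp add: T_def linear_simps(2)[OF Q_bl] QQ)
    show "u = 0" if "\<And>h. \<exists>w\<in>H_domain. z *\<^sub>C w - H w = h" and u: "u \<in> H_domain" "z *\<^sub>C u - H u = 0" for z u
    proof (rule J_form_separates)
      fix h
      obtain w where w: "w \<in> H_domain" "z *\<^sub>C w - H w = h" using \<open>\<And>h. \<exists>w\<in>H_domain. z *\<^sub>C w - H w = h\<close> by blast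
      have "J_form u h = J_form (z *\<^sub>C u - H u) w"
        unfolding w(2)[symmetric] using u(1) w(1) by (simp add: J_form_diff J_form_scaleC H_def J_form_H)
      then show "J_form u h = 0" using u(2) by (simp add: J_form_def)
    qed
    show "u = 0" if h: "\<And>h. bounded_linear h \<Longrightarrow> (\<And>c v. h (c *\<^sub>C v) = c * h v) \<Longrightarrow> h u = (0::complex)" for u :: "l2 ^ 4"
    proof -
      have "u $ i = 0" for i
      proof (rule bil_separates)
        fix v
        show "bil (u $ i) v = 0"
          by (rule h) (simp_all add: bil_scaleC_left bounded_linear_compose[OF bounded_linear_bil bounded_linear_vec_nth])
      qed
      then show ?thesis by (simp add: vec_eq_iff)
    qed
  qed
  then show ?thesis by (simp add: H_def Q_def)
qed

end

section \<open>Growth of the projections\<close>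

text \<open>To be read with \<open>D n\<close> the squared norm of \<open>phi n\<close> and
  \<epsilon> n the rescaled inner product of \<open>phi n\<close> and \<open>phi (n + 2)\<close>.
  All coefficients are nonnegative, so the functional \<open>V\<close> that pairs with the dominant
  eigenvalue controls the growth from both sides up to a factor of order n.\<close>

lemma positive_recursion_growth:
  fixes D \<epsilon> :: "nat \<Rightarrow> real"
  assumes c: "0 < c" "c \<le> 1" and \<sigma>: "0 \<le> \<sigma>" "\<sigma> < 1" and D: "\<And>n. 0 < D n"
    and e0: "c * \<epsilon> 0 = 2 * D 0"
    and e: "\<And>n. c * \<epsilon> (Suc n) = 2 * real (Suc n) * \<epsilon> n + 2 * real (n + 2) * D (Suc n)"
    and D2: "\<And>n. c * D (n + 2) = 2 * real (n + 2) * D (Suc n) + 2 * \<sigma>\<^sup>2 * real (Suc n) * \<epsilon> n"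
  obtains C1 C2 where "0 < C1" "0 < C2"
    "\<And>n. C1 * ((1 + \<sigma>) / c) ^ n / real (n + 2) \<le> D (n + 2) / (2 ^ (n + 2) * fact (n + 2))"
    "\<And>n. D (n + 1) / (2 ^ (n + 1) * fact (n + 1)) \<le> C2 * ((1 + \<sigma>) / c) ^ n"
proof -
  define \<rho> where "\<rho> = (1 + \<sigma>) / c"
  define d where "d n = D n / (2 ^ n * fact n)" for n
  \<comment> \<open>Scaled like \<open>d (n + 2)\<close>: the recursion for \<open>d\<close> then
    has constant coefficients, and only the one for \<delta> keeps a factor (n + 2) / (n +
    3).\<close>
  define \<delta> where "\<delta> n = 2 * real (Suc n) * \<epsilon> n / (2 ^ (n + 2) * fact (n + 2))" for n
  \<comment> \<open>In the limit \<open>n \<rightarrow> \<infinity>\<close> the recursion for \<open>(\<delta> n, d (Suc n))\<close> has constant coefficients and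
    \<open>(\<sigma>, 1)\<close> as a left eigenvector for its dominant eigenvalue \<open>\<rho>\<close>.\<close>
  define V where "V n = \<sigma> * \<delta> n + d (Suc n)" for n
  have \<rho>: "0 < \<rho>" using c \<sigma> by (simp add: \<rho>_def)
  have d: "0 < d n" for n using D by (simp add: d_def)
  have "0 \<le> \<epsilon> n" for n
  proof (induction n)
    case 0
    have "0 < c * \<epsilon> 0" using e0 D[of 0] by simp
    then show ?case using c by (simp add: zero_less_mult_iff)
  next
    case (Suc n)
    have "0 \<le> c * \<epsilon> (Suc n)" using e[of n] Suc D[of "Suc n"] by (simp add: less_imp_le)
    then show ?case using c by (simp add: zero_le_mult_iff)
  qed
  then have \<delta>: "0 \<le> \<delta> n" for n by (simp add: \<delta>_def)
  have d_rec: "d (Suc (Suc n)) = (d (Suc n) + \<sigma>\<^sup>2 * \<delta> n) / c" for n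
  proof -
    have "c * d (Suc (Suc n)) = (2 * real (n + 2) * D (Suc n) + 2 * \<sigma>\<^sup>2 * real (Suc n) * \<epsilon> n) / (2 ^ (n + 2) * fact (n + 2))"
      using D2[of n] by (simp add: d_def)
    also have "\<dots> = d (Suc n) + \<sigma>\<^sup>2 * \<delta> n"
      by (simp add: d_def \<delta>_def add_divide_distrib fact_reduce[of "n + 2"] del: of_nat_Suc) (simp add: field_simps)
    finally show ?thesis using c by (simp add: field_simps)
  qed
  have split: "2 * x * (A + B) / (2 * y * F) = x / y * (A / F + B / F)" for x y A B F :: real
    by (simp add: add_divide_distrib[symmetric])
  have \<delta>_rec: "\<delta> (Suc n) = real (n + 2) / real (n + 3) * ((\<delta> n + d (Suc n)) / c)" for n
  proof -
    have f: "2 ^ (Suc n + 2) * fact (Suc n + 2) = (2 * real (n + 3)) * (2 ^ (n + 2) * fact (n + 2) :: real)"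
      "2 ^ (n + 2) * fact (n + 2) = (2 * real (n + 2)) * (2 ^ (Suc n) * fact (Suc n) :: real)"
      by (simp_all add: algebra_simps)
    have "c * \<delta> (Suc n) = 2 * real (n + 2) * (2 * real (Suc n) * \<epsilon> n + 2 * real (n + 2) * D (Suc n)) / (2 ^ (Suc n + 2) * fact (Suc n + 2))"
      using e[of n] by (simp add: \<delta>_def mult.left_commute)
    also have "\<dots> = real (n + 2) / real (n + 3) * (2 * real (Suc n) * \<epsilon> n / (2 ^ (n + 2) * fact (n + 2))
        + 2 * real (n + 2) * D (Suc n) / (2 ^ (n + 2) * fact (n + 2)))"
      unfolding f(1) by (rule split)
    also have "2 * real (n + 2) * D (Suc n) / (2 ^ (n + 2) * fact (n + 2)) = d (Suc n)"
      unfolding f(2) d_def by (rule mult_divide_mult_cancel_left) simp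
    finally have 1: "c * \<delta> (Suc n) = real (n + 2) / real (n + 3) * (\<delta> n + d (Suc n))"
      unfolding \<delta>_def[of n] .
    have "\<delta> (Suc n) = c * \<delta> (Suc n) / c" using c by simp
    then show ?thesis unfolding 1 by (simp only: times_divide_eq_right)
  qed
  have V_pos: "0 < V n" for n using d[of "Suc n"] \<delta>[of n] \<sigma> by (simp add: V_def add_nonneg_pos)
  have V_eq: "\<rho> * V n = \<sigma> * ((\<delta> n + d (Suc n)) / c) + (d (Suc n) + \<sigma>\<^sup>2 * \<delta> n) / c" for n
    using c by (simp add: V_def \<rho>_def field_simps power2_eq_square)
  have V_rec: "V (Suc n) = real (n + 2) / real (n + 3) * (\<sigma> * ((\<delta> n + d (Suc n)) / c)) + (d (Suc n) + \<sigma>\<^sup>2 * \<delta> n) / c" for n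
    by (simp only: V_def[of "Suc n"] \<delta>_rec d_rec mult.left_commute)
  have nn: "0 \<le> \<sigma> * ((\<delta> n + d (Suc n)) / c)" "0 \<le> (d (Suc n) + \<sigma>\<^sup>2 * \<delta> n) / c" for n
    using \<sigma> c \<delta>[of n] d[of "Suc n"] by (auto intro!: mult_nonneg_nonneg divide_nonneg_pos add_nonneg_nonneg less_imp_le)
  have frac: "0 \<le> real (n + 2) / real (n + 3)" "real (n + 2) / real (n + 3) \<le> 1" for n by simp_all
  \<comment> \<open>The fraction multiplies one of two nonnegative summands of \<rho> V n. Dropping
    it bounds V (n + 1) above; applying it to both summands bounds it below.\<close>
  have V_upper: "V (Suc n) \<le> \<rho> * V n" for n
    unfolding V_eq V_rec using mult_right_mono[OF frac(2) nn(1), of n n] by simp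
  have V_lower: "real (n + 2) / real (n + 3) * (\<rho> * V n) \<le> V (Suc n)" for n
    unfolding V_eq V_rec distrib_left using mult_right_mono[OF frac(2) nn(2), of n n] by simp
  have up: "V n \<le> V 0 * \<rho> ^ n" for n
  proof (induction n)
    case (Suc n)
    have "V (Suc n) \<le> \<rho> * (V 0 * \<rho> ^ n)" using V_upper[of n] mult_left_mono[OF Suc, of \<rho>] \<rho> by linarith
    then show ?case by (simp add: ac_simps)
  qed simp
  \<comment> \<open>The product of the fractions (j + 2) / (j + 3) over j < n telescopes to 2 / (n +
    2).\<close>
  have low: "2 * V 0 * \<rho> ^ n / real (n + 2) \<le> V n" for n
  proof (induction n)
    case (Suc n)
    have "2 * V 0 * \<rho> ^ Suc n / real (Suc n + 2) = real (n + 2) / real (n + 3) * (\<rho> * (2 * V 0 * \<rho> ^ n / real (n + 2)))"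
    proof -
      have g: "a * (r * b) / y = x / y * (r * (a * b / x))" if "x \<noteq> 0" for a b r x y :: real
        using that by simp
      have "Suc n + 2 = n + 3" by simp
      then show ?thesis unfolding power_Suc by (simp only:) (rule g, simp)
    qed
    also have "\<dots> \<le> real (n + 2) / real (n + 3) * (\<rho> * V n)"
      by (rule mult_left_mono[OF mult_left_mono[OF Suc]]) (use \<rho> in simp_all)
    also have "\<dots> \<le> V (Suc n)" by (rule V_lower)
    finally show ?case .
  qed simp
  show thesis
  \<comment> \<open>In the generic case \<open>d (n + 2)\<close> is bounded below by \<sigma> V n,
    which is worthless for \<sigma> = 0; there V n is \<open>d (Suc n)\<close> itself.\<close>
  proof (cases "\<sigma> = 0")
    case True
    show thesis
    proof (rule that[of "2 * V 0" "V 0"])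
      show "D (n + 1) / (2 ^ (n + 1) * fact (n + 1)) \<le> V 0 * ((1 + \<sigma>) / c) ^ n" for n
        using up[of n] True unfolding V_def \<rho>_def d_def by simp
      have "d (Suc n) \<le> d (n + 2)" for n
        using c d[of "Suc n"] True by (simp add: d_rec field_simps)
      then show "2 * V 0 * ((1 + \<sigma>) / c) ^ n / real (n + 2) \<le> D (n + 2) / (2 ^ (n + 2) * fact (n + 2))" for n
        using low[of n] True order_trans unfolding V_def \<rho>_def d_def by fastforce
    qed (use V_pos in auto)
  next
    case False
    show thesis
    proof (rule that[of "\<sigma> * (2 * V 0)" "V 0"])
      show "0 < \<sigma> * (2 * V 0)" using False \<sigma> V_pos[of 0] by simp
      have "\<sigma> * V n \<le> d (n + 2)" for n
      proof -
        have "\<sigma> * V n \<le> d (Suc n) + \<sigma>\<^sup>2 * \<delta> n"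
          using \<sigma> d[of "Suc n"] mult_right_mono[of \<sigma> 1 "d (Suc n)"] by (simp add: V_def power2_eq_square algebra_simps)
        also have "\<dots> \<le> (d (Suc n) + \<sigma>\<^sup>2 * \<delta> n) / c"
          using c d[of "Suc n"] \<delta>[of n] by (simp add: pos_le_divide_eq mult_left_le)
        finally show ?thesis by (simp add: d_rec)
      qed
      then show "\<sigma> * (2 * V 0) * ((1 + \<sigma>) / c) ^ n / real (n + 2) \<le> D (n + 2) / (2 ^ (n + 2) * fact (n + 2))" for n
        using mult_left_mono[OF low[of n] \<sigma>(1)] order_trans
        unfolding d_def \<rho>_def[symmetric] by (fastforce simp: ac_simps)
      show "D (n + 1) / (2 ^ (n + 1) * fact (n + 1)) \<le> V 0 * ((1 + \<sigma>) / c) ^ n" for n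
      proof -
        have "d (Suc n) \<le> V n" using \<sigma> \<delta>[of n] by (simp add: V_def)
        then show ?thesis using up[of n] by (simp add: d_def \<rho>_def)
      qed
    qed (use V_pos in auto)
  qed
qed

lemma ln_growth_rate:
  fixes a :: "nat \<Rightarrow> real"
  assumes \<rho>: "0 < \<rho>" and C: "0 < C1" "0 < C2"
    and lo: "\<And>n. 2 \<le> n \<Longrightarrow> C1 * \<rho> ^ n / real n \<le> a n"
    and hi: "\<And>n. 2 \<le> n \<Longrightarrow> a n \<le> C2 * real n * \<rho> ^ n"
  shows "(\<lambda>n. ln (a n) / real n) \<longlonglongrightarrow> ln \<rho>"
proof (rule tendsto_sandwich)
  have pos: "0 < C1 * \<rho> ^ n / real n" if "2 \<le> n" for n using C \<rho> that by simp
  show "\<forall>\<^sub>F n in sequentially. ln C1 / real n + ln \<rho> - ln (real n) / real n \<le> ln (a n) / real n"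
  proof (rule eventually_sequentiallyI[of 2])
    fix n :: nat assume n: "2 \<le> n"
    have "ln (C1 * \<rho> ^ n / real n) \<le> ln (a n)"
      using lo[OF n] pos[OF n] by simp
    moreover have "ln (C1 * \<rho> ^ n / real n) = ln C1 + real n * ln \<rho> - ln (real n)"
      using C \<rho> n by (simp add: ln_div ln_mult ln_realpow)
    ultimately have "(ln C1 + real n * ln \<rho> - ln (real n)) / real n \<le> ln (a n) / real n"
      by (intro divide_right_mono) simp_all
    then show "ln C1 / real n + ln \<rho> - ln (real n) / real n \<le> ln (a n) / real n"
      using n by (simp add: add_divide_distrib diff_divide_distrib)
  qed
  show "\<forall>\<^sub>F n in sequentially. ln (a n) / real n \<le> ln C2 / real n + ln \<rho> + ln (real n) / real n"
  proof (rule eventually_sequentiallyI[of 2])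
    fix n :: nat assume n: "2 \<le> n"
    have "ln (a n) \<le> ln (C2 * real n * \<rho> ^ n)"
      using hi[OF n] lo[OF n] pos[OF n] by simp
    moreover have "ln (C2 * real n * \<rho> ^ n) = ln C2 + real n * ln \<rho> + ln (real n)"
      using C \<rho> n by (simp add: ln_mult ln_realpow)
    ultimately have "ln (a n) / real n \<le> (ln C2 + real n * ln \<rho> + ln (real n)) / real n"
      by (intro divide_right_mono) simp_all
    then show "ln (a n) / real n \<le> ln C2 / real n + ln \<rho> + ln (real n) / real n"
      using n by (simp add: add_divide_distrib)
  qed
  have n0: "(\<lambda>n. K / real n) \<longlonglongrightarrow> 0" for K by (rule lim_const_over_n)
  have ln0: "(\<lambda>n. ln (real n) / real n) \<longlonglongrightarrow> 0" by real_asymp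
  show "(\<lambda>n. ln C1 / real n + ln \<rho> - ln (real n) / real n) \<longlonglongrightarrow> ln \<rho>"
    using tendsto_diff[OF tendsto_add[OF n0 tendsto_const] ln0] by simp
  show "(\<lambda>n. ln C2 / real n + ln \<rho> + ln (real n) / real n) \<longlonglongrightarrow> ln \<rho>"
    using tendsto_add[OF tendsto_add[OF n0 tendsto_const] ln0] by simp
qed

context rotated
begin

lemma cos_sin_E: "complex_of_real (cos \<theta>) - \<i> * of_real (sin \<theta>) = E' * E'"
  "complex_of_real (cos \<theta>) + \<i> * of_real (sin \<theta>) = E * E"
  using Re_E_squared Im_E_squared by (auto simp: complex_eq_iff)

text \<open>Conjugation exchanges \<open>E\<close> and \<open>E'\<close>; the result is resolved
  into \<open>annihil\<close> and \<open>create\<close> of the conjugate vector. Transposing under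
  \<open>bil\<close> yields the Hilbert space adjoint.\<close>

lemma conj_annihil:
  assumes "u \<in> domain_D"
  shows "conj_l2 (annihil u) = of_real (cos \<theta>) *\<^sub>C annihil (conj_l2 u) - (\<i> * of_real (sin \<theta>)) *\<^sub>C create (conj_l2 u)"
proof -
  let ?x = "multiply_by_x (conj_l2 u)" and ?d = "weak_derivative (conj_l2 u)"
  have "of_real (cos \<theta>) *\<^sub>C annihil (conj_l2 u) - (\<i> * of_real (sin \<theta>)) *\<^sub>C create (conj_l2 u)
      = (E * (of_real (cos \<theta>) - \<i> * of_real (sin \<theta>))) *\<^sub>C ?x + (E' * (of_real (cos \<theta>) + \<i> * of_real (sin \<theta>))) *\<^sub>C ?d"
    by (simp add: annihil_def create_def scaleC_simps right_diff_distrib distrib_left mult.commute)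
  also have "E * (of_real (cos \<theta>) - \<i> * of_real (sin \<theta>)) = E'"
    unfolding cos_sin_E by (simp add: mult.assoc[symmetric] E_E')
  also have "E' * (of_real (cos \<theta>) + \<i> * of_real (sin \<theta>)) = E"
    unfolding cos_sin_E by (simp add: mult.assoc[symmetric] E_E')
  also have "E' *\<^sub>C ?x + E *\<^sub>C ?d = conj_l2 (annihil u)"
    using assms by (simp add: annihil_def conj_add conj_scaleC cnj_E domain_D_conj)
  finally show ?thesis by simp
qed

section \<open>Inner products of the eigenvectors\<close>

definition gram :: "nat \<Rightarrow> nat \<Rightarrow> complex" where "gram j k = bil (conj_l2 (phi j)) (phi k)"

lemma gram_self: "gram n n = of_real ((norm (phi n))\<^sup>2)"
  unfolding gram_def by (rule bil_conj_self)

lemma gram_swap: "gram k j = cnj (gram j k)"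
  unfolding gram_def by (metis bil_commute bil_conj conj_conj)

text \<open>Evaluates the inner product of \<open>annihil (phi j)\<close> with \<open>phi k\<close>
  in two ways: by the eigenvector relation and by the adjoint formula. Truncated indices carry the
  coefficient 0.\<close>

lemma gram_Suc: "of_real (cos \<theta>) * gram j (Suc k)
    = of_nat (2 * j) * gram (j - 1) k + \<i> * of_real (sin \<theta>) * (of_nat (2 * k) * gram j (k - 1))"
proof -
  note D = phi_in_domain domain_D_conj(1)[OF phi_in_domain]
  have "bil (conj_l2 (annihil (phi j))) (phi k)
      = of_real (cos \<theta>) * bil (conj_l2 (phi j)) (create (phi k)) - \<i> * of_real (sin \<theta>) * bil (conj_l2 (phi j)) (annihil (phi k))"
    by (simp add: conj_annihil D bil_simps bil_annihil bil_create)
  moreover have "bil (conj_l2 (annihil (phi j))) (phi k) = of_nat (2 * j) * gram (j - 1) k"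
    by (simp add: annihil_phi conj_scaleC bil_simps gram_def)
  moreover have "bil (conj_l2 (phi j)) (annihil (phi k)) = of_nat (2 * k) * gram j (k - 1)"
    by (simp add: annihil_phi bil_simps gram_def)
  ultimately show ?thesis by (simp add: gram_def algebra_simps)
qed

text \<open>The inner products of \<open>phi n\<close> and \<open>phi (n + 2)\<close> with the
  factor i sin \<theta> divided out. What remains is real and given by a recursion with positive
  coefficients, also at \<theta> = 0.\<close>

primrec off_gram :: "nat \<Rightarrow> real" where
  "off_gram 0 = 2 * (norm (phi 0))\<^sup>2 / cos \<theta>"
| "off_gram (Suc n) = (2 * real (Suc n) * off_gram n + 2 * real (n + 2) * (norm (phi (Suc n)))\<^sup>2) / cos \<theta>"

lemma gram_off: "gram n (n + 2) = \<i> * of_real (sin \<theta>) * of_real (off_gram n)"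
proof (induction n)
  case 0
  have "of_real (cos \<theta>) * gram 0 2 = \<i> * of_real (sin \<theta>) * (2 * gram 0 0)"
    using gram_Suc[of 0 1] by (simp add: numeral_2_eq_2)
  then show ?case using cos_theta_pos by (simp add: gram_self field_simps numeral_2_eq_2)
next
  case (Suc n)
  have "of_real (cos \<theta>) * gram (Suc n) (Suc n + 2)
      = of_nat (2 * Suc n) * gram n (n + 2) + \<i> * of_real (sin \<theta>) * (of_nat (2 * (n + 2)) * gram (Suc n) (Suc n))"
    using gram_Suc[of "Suc n" "n + 2"] by (simp del: of_nat_mult of_nat_Suc of_nat_add)
  also have "\<dots> = \<i> * of_real (sin \<theta>)
      * of_real (2 * real (Suc n) * off_gram n + 2 * real (n + 2) * (norm (phi (Suc n)))\<^sup>2)"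
    unfolding Suc gram_self by (simp add: algebra_simps)
  also have "2 * real (Suc n) * off_gram n + 2 * real (n + 2) * (norm (phi (Suc n)))\<^sup>2 = cos \<theta> * off_gram (Suc n)"
    using cos_theta_pos by simp
  also have "\<i> * of_real (sin \<theta>) * of_real (cos \<theta> * off_gram (Suc n))
      = of_real (cos \<theta>) * (\<i> * of_real (sin \<theta>) * of_real (off_gram (Suc n)))"
    by simp
  finally have 1: "of_real (cos \<theta>) * gram (Suc n) (Suc n + 2)
      = of_real (cos \<theta>) * (\<i> * of_real (sin \<theta>) * of_real (off_gram (Suc n)))" .
  have "complex_of_real (cos \<theta>) \<noteq> 0" using cos_theta_pos by simp
  then show ?case using 1 unfolding mult_cancel_left by blast
qed

text \<open>The off-diagonal entry returns conjugated, so i sin \<theta> meets its conjugate and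
  gives sin^2 \<theta> with a plus sign: no cancellation can occur.\<close>

lemma norm_phi_rec:
  "cos \<theta> * (norm (phi (n + 2)))\<^sup>2
    = 2 * real (n + 2) * (norm (phi (Suc n)))\<^sup>2 + 2 * \<bar>sin \<theta>\<bar>\<^sup>2 * real (Suc n) * off_gram n"
proof -
  have "of_real (cos \<theta>) * gram (n + 2) (n + 2)
      = of_nat (2 * (n + 2)) * gram (Suc n) (Suc n) + \<i> * of_real (sin \<theta>) * (of_nat (2 * Suc n) * cnj (gram n (n + 2)))"
    using gram_Suc[of "n + 2" "Suc n"] by (simp add: gram_swap[of "Suc (Suc n)" n] del: of_nat_mult of_nat_Suc of_nat_add)
  also have "\<dots> = of_real (2 * real (n + 2) * (norm (phi (Suc n)))\<^sup>2 + 2 * (sin \<theta>)\<^sup>2 * real (Suc n) * off_gram n)"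
    unfolding gram_off gram_self by (simp add: algebra_simps power2_eq_square)
  finally show ?thesis
    unfolding gram_self of_real_mult[symmetric] of_real_eq_iff by simp
qed

lemma phi_nonzero: "phi n \<noteq> 0"
  using bil_phi_phi[of n] kappa_nonzero[of n] by auto

definition q :: "nat \<Rightarrow> real" where "q n = (norm (phi n))\<^sup>2 / cmod (kappa n)"

lemma q_growth:
  obtains C1 C2 where "0 < C1" "0 < C2"
    "\<And>n. 2 \<le> n \<Longrightarrow> C1 * ((1 + \<bar>sin \<theta>\<bar>) / cos \<theta>) ^ n / real n \<le> q n"
    "\<And>n. 1 \<le> n \<Longrightarrow> q n \<le> C2 * ((1 + \<bar>sin \<theta>\<bar>) / cos \<theta>) ^ n"
proof -
  define \<rho> where "\<rho> = (1 + \<bar>sin \<theta>\<bar>) / cos \<theta>"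
  have s: "\<bar>sin \<theta>\<bar> < 1"
  proof -
    have "(sin \<theta>)\<^sup>2 < 1" using sin_cos_squared_add[of \<theta>] cos_theta_pos zero_less_power[OF cos_theta_pos, of 2] by linarith
    then show ?thesis by (simp add: abs_square_less_1)
  qed
  have "cos \<theta> \<le> 1 + \<bar>sin \<theta>\<bar>" using cos_le_one[of \<theta>] by linarith
  then have \<rho>: "1 \<le> \<rho>" using cos_theta_pos by (simp add: \<rho>_def pos_le_divide_eq)
  obtain C1 C2 where C: "0 < C1" "0 < C2"
    "\<And>n. C1 * \<rho> ^ n / real (n + 2) \<le> (norm (phi (n + 2)))\<^sup>2 / (2 ^ (n + 2) * fact (n + 2))"
    "\<And>n. (norm (phi (n + 1)))\<^sup>2 / (2 ^ (n + 1) * fact (n + 1)) \<le> C2 * \<rho> ^ n"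
  proof (rule positive_recursion_growth[of "cos \<theta>" "\<bar>sin \<theta>\<bar>" "\<lambda>n. (norm (phi n))\<^sup>2" off_gram, folded \<rho>_def])
    show "0 < (norm (phi n))\<^sup>2" for n using phi_nonzero by simp
    show "cos \<theta> * off_gram 0 = 2 * (norm (phi 0))\<^sup>2"
      "cos \<theta> * off_gram (Suc n) = 2 * real (Suc n) * off_gram n + 2 * real (n + 2) * (norm (phi (Suc n)))\<^sup>2" for n
      using cos_theta_pos by simp_all
  qed (use cos_theta_pos s norm_phi_rec in auto)
  define b where "b = cmod (bil phi0 phi0)"
  have b: "0 < b" using bil_phi0_phi0 by (simp add: b_def)
  have q: "q n = (norm (phi n))\<^sup>2 / (2 ^ n * fact n) / b" for n
    by (simp add: q_def kappa_def b_def norm_mult norm_power)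
  \<comment> \<open>The growth lemma speaks of n + 2 and n + 1. Shifting the index costs \<rho>^2 in
    the lower constant and uses \<rho> \<ge> 1 in the upper bound.\<close>
  show thesis
  proof (rule that[of "C1 / \<rho>\<^sup>2 / b" "C2 / b", folded \<rho>_def])
    show "0 < C1 / \<rho>\<^sup>2 / b" "0 < C2 / b" using C b \<rho> by simp_all
    fix n :: nat
    show "C1 / \<rho>\<^sup>2 / b * \<rho> ^ n / real n \<le> q n" if n: "2 \<le> n"
    proof -
      have e: "n - 2 + 2 = n" using n by simp
      have "C1 / \<rho>\<^sup>2 / b * \<rho> ^ n / real n = (C1 * \<rho> ^ (n - 2) / real n) / b"
        using n \<rho> by (simp add: power_diff)
      also have "\<dots> \<le> q n"
        unfolding q by (rule divide_right_mono[OF C(3)[of "n - 2", unfolded e] less_imp_le[OF b]])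
      finally show ?thesis .
    qed
    show "q n \<le> C2 / b * \<rho> ^ n" if n: "1 \<le> n"
    proof -
      have e: "n - 1 + 1 = n" using n by simp
      have "q n \<le> C2 * \<rho> ^ (n - 1) / b"
        unfolding q by (rule divide_right_mono[OF C(4)[of "n - 1", unfolded e] less_imp_le[OF b]])
      also have "\<dots> \<le> C2 * \<rho> ^ n / b"
        using C b \<rho> by (intro divide_right_mono mult_left_mono power_increasing) simp_all
      finally show ?thesis by simp
    qed
  qed
qed

section \<open>Comparison of the spectral projectors with the scalar projections\<close>

lemma norm_eigenprojection_ge:
  assumes "\<And>\<psi>. blinfun_apply B \<psi> = eigenprojection m \<mu> k \<psi>"
  shows "q (Suc k) / 2 \<le> norm B"
proof -
  define f where "f = phi (Suc k)"
  \<comment> \<open>The conjugate of \<open>phi (Suc k)\<close> gives equality in Cauchy-Schwarz.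
    Placed in the first component it leaves components 3 and 4 zero, so the term with H does not
    reach the first component of the image.\<close>
  define u :: "l2 ^ 4" where "u = vector [conj_l2 f, 0, 0, 0]"
  have u: "u $ 1 = conj_l2 f" "u $ 2 = 0" "u $ 3 = 0" "u $ 4 = 0" by (simp_all add: u_def)
  have p0: "p n 0 = 0" for n by (simp add: p_def)
  have "norm u = norm f" by (simp add: norm_vec_def L2_set_def sum_4 u)
  have "eigenprojection m \<mu> k u $ 1 = (1 / 2) *\<^sub>C p (Suc k) (conj_l2 f)"
    by (simp add: eigenprojection_def P_nth H_op_nth u p0)
  also have "p (Suc k) (conj_l2 f) = (of_real ((norm f)\<^sup>2) / kappa (Suc k)) *\<^sub>C f"
    unfolding p_def f_def[symmetric] using bil_conj_self[of f] by (simp only: bil_commute[of f])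
  also have "norm ((1 / 2) *\<^sub>C (of_real ((norm f)\<^sup>2) / kappa (Suc k)) *\<^sub>C f) = q (Suc k) / 2 * norm f"
    unfolding q_def f_def[symmetric] by (simp add: norm_scaleC norm_divide norm_power)
  finally have "q (Suc k) / 2 * norm f \<le> norm (blinfun_apply B u)"
    using Finite_Cartesian_Product.norm_nth_le[of "blinfun_apply B u" 1] by (simp add: assms)
  also have "\<dots> \<le> norm B * norm f" using norm_blinfun[of B u] \<open>norm u = norm f\<close> by simp
  finally show ?thesis using phi_nonzero[of "Suc k"] by (simp add: f_def)
qed

text \<open>Crude in the prefactor, which only has to be polynomial in k. The new terms are
  \<open>create\<close> and \<open>annihil\<close> applied to the scalar projections, and both are
  controlled by the same mixed quantity \<open>g\<close>.\<close>

lemma norm_eigenprojection_le: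
  assumes B: "\<And>\<psi>. blinfun_apply B \<psi> = eigenprojection m \<mu> k \<psi>" and \<mu>: "1 \<le> cmod \<mu>"
  shows "norm B \<le> (3 + 2 * \<bar>m\<bar> + 4 * real (k + 1)) * (q (Suc k) + q k)"
proof (rule norm_blinfun_bound)
  define S where "S = q (Suc k) + q k"
  have q0: "0 \<le> q n" for n by (simp add: q_def)
  have S: "0 \<le> S" by (simp add: S_def q0)
  then show "0 \<le> (3 + 2 * \<bar>m\<bar> + 4 * real (k + 1)) * (q (Suc k) + q k)"
    unfolding S_def[symmetric] by (intro mult_nonneg_nonneg) simp_all
  fix \<psi> :: "l2 ^ 4"
  let ?n = "norm \<psi>"
  have comp: "norm (\<psi> $ i) \<le> ?n" for i by (rule Finite_Cartesian_Product.norm_nth_le)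
  have p1: "norm (p (Suc k) (\<psi> $ i)) \<le> q (Suc k) * ?n" "norm (p k (\<psi> $ i)) \<le> q k * ?n" for i
    using norm_p_le[of "Suc k" "\<psi> $ i"] norm_p_le[of k "\<psi> $ i"]
      mult_left_mono[OF comp q0] unfolding q_def by (meson order_trans)+
  \<comment> \<open>It mixes two neighbouring levels; the inequality between the geometric and
    arithmetic means returns it to \<open>q k\<close> and \<open>q (Suc k)\<close>.\<close>
  define g where "g = norm (phi k) * norm (phi (Suc k)) / cmod (kappa k)"
  have k: "cmod (kappa (Suc k)) = 2 * real (Suc k) * cmod (kappa k)"
    unfolding kappa_Suc norm_mult norm_of_nat by simp
  have g: "0 \<le> g" "g \<le> 2 * real (k + 1) * S"
  proof -
    show "0 \<le> g" by (simp add: g_def)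
    have "norm (phi k) * norm (phi (Suc k)) \<le> (norm (phi k))\<^sup>2 + (norm (phi (Suc k)))\<^sup>2"
    proof -
      have "2 * (norm (phi k) * norm (phi (Suc k))) \<le> (norm (phi k))\<^sup>2 + (norm (phi (Suc k)))\<^sup>2"
        using sum_squares_bound[of "norm (phi k)" "norm (phi (Suc k))"] by (simp only: mult.assoc)
      moreover have "0 \<le> norm (phi k) * norm (phi (Suc k))" by simp
      ultimately show ?thesis by linarith
    qed
    then have "g \<le> ((norm (phi k))\<^sup>2 + (norm (phi (Suc k)))\<^sup>2) / cmod (kappa k)"
      unfolding g_def by (rule divide_right_mono) simp
    also have "\<dots> = q k + 2 * real (Suc k) * q (Suc k)"
      using kappa_nonzero[of k] by (simp add: q_def k add_divide_distrib)
    also have "\<dots> \<le> 2 * real (Suc k) * q k + 2 * real (Suc k) * q (Suc k)"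
      using mult_right_mono[of 1 "2 * real (Suc k)" "q k"] q0 by simp
    finally show "g \<le> 2 * real (k + 1) * S" by (simp add: S_def algebra_simps)
  qed
  have cp: "norm (create (p k (\<psi> $ i))) \<le> g * ?n" for i
  proof -
    have "norm (create (p k (\<psi> $ i))) = cmod (bil (phi k) (\<psi> $ i)) / cmod (kappa k) * norm (phi (Suc k))"
      by (simp add: p_def create_scaleC phi_in_domain norm_scaleC norm_divide)
    also have "\<dots> \<le> (norm (phi k) * ?n) / cmod (kappa k) * norm (phi (Suc k))"
      by (intro mult_right_mono divide_right_mono order_trans[OF norm_bil_le] mult_left_mono comp) simp_all
    finally show ?thesis by (simp add: g_def ac_simps)
  qed
  have ap: "norm (annihil (p (Suc k) (\<psi> $ i))) \<le> g * ?n" for i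
  proof -
    have "norm (annihil (p (Suc k) (\<psi> $ i))) = cmod (bil (phi (Suc k)) (\<psi> $ i)) / cmod (kappa (Suc k)) * (2 * real (Suc k) * norm (phi k))"
      unfolding p_def annihil_scaleC[OF phi_in_domain] annihil_phi norm_scaleC norm_divide norm_of_nat by simp
    also have "\<dots> = cmod (bil (phi (Suc k)) (\<psi> $ i)) * norm (phi k) / cmod (kappa k)"
      unfolding k by (simp del: of_nat_Suc)
    also have "\<dots> \<le> (norm (phi (Suc k)) * ?n) * norm (phi k) / cmod (kappa k)"
      by (intro mult_right_mono divide_right_mono order_trans[OF norm_bil_le] mult_left_mono comp) simp_all
    finally show ?thesis by (simp add: g_def ac_simps)
  qed
  have "norm (P k \<psi>) \<le> (\<Sum>i\<in>UNIV. norm (P k \<psi> $ i))" by (rule norm_vec_le_sum)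
  also have "\<dots> \<le> 2 * (S * ?n)" using p1[of 1] p1[of 2] p1[of 3] p1[of 4]
    by (simp add: sum_4 P_nth S_def algebra_simps)
  finally have P: "norm (P k \<psi>) \<le> 2 * (S * ?n)" .
  have mp: "norm (of_real m *\<^sub>C x) \<le> \<bar>m\<bar> * y" if "norm x \<le> y" for x :: l2 and y
    using that by (simp add: norm_scaleC mult_left_mono)
  have H1: "norm (H_op m \<theta> (P k \<psi>) $ 1) \<le> \<bar>m\<bar> * (q (Suc k) * ?n) + g * ?n"
    "norm (H_op m \<theta> (P k \<psi>) $ 3) \<le> \<bar>m\<bar> * (q (Suc k) * ?n) + g * ?n"
    unfolding H_op_nth P_nth using mp[OF p1(1)] cp
    by (auto intro!: order_trans[OF norm_triangle_ineq] add_mono simp: norm_scaleC)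
  have H2: "norm (H_op m \<theta> (P k \<psi>) $ 2) \<le> g * ?n + \<bar>m\<bar> * (q k * ?n)"
    "norm (H_op m \<theta> (P k \<psi>) $ 4) \<le> g * ?n + \<bar>m\<bar> * (q k * ?n)"
    unfolding H_op_nth P_nth using mp[OF p1(2)] ap
    by (auto intro!: order_trans[OF norm_triangle_ineq4] add_mono simp: norm_scaleC)
  have "norm (H_op m \<theta> (P k \<psi>)) \<le> (\<Sum>i\<in>UNIV. norm (H_op m \<theta> (P k \<psi>) $ i))" by (rule norm_vec_le_sum)
  also have "\<dots> \<le> 2 * (\<bar>m\<bar> * (S * ?n)) + 4 * (g * ?n)"
    using H1 H2 by (simp add: sum_4 S_def algebra_simps)
  also have "\<dots> \<le> 2 * (\<bar>m\<bar> * (S * ?n)) + 4 * (2 * real (k + 1) * S * ?n)"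
    using mult_right_mono[OF g(2) norm_ge_zero[of \<psi>]] by simp
  also have "4 * (2 * real (k + 1) * S * ?n) = 8 * (real (k + 1) * (S * ?n))" by (simp add: algebra_simps)
  finally have H: "norm (H_op m \<theta> (P k \<psi>)) \<le> 2 * (\<bar>m\<bar> * (S * ?n)) + 8 * (real (k + 1) * (S * ?n))" .
  have "norm (eigenprojection m \<mu> k \<psi>) \<le> norm (P k \<psi>) / 2 + norm (H_op m \<theta> (P k \<psi>)) / 2"
  proof -
    have "norm ((1 / (2 * \<mu>)) *\<^sub>C H_op m \<theta> (P k \<psi>)) \<le> norm (H_op m \<theta> (P k \<psi>)) / 2"
    proof -
      have "norm ((1 / (2 * \<mu>)) *\<^sub>C H_op m \<theta> (P k \<psi>)) = norm (H_op m \<theta> (P k \<psi>)) / (2 * cmod \<mu>)"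
        by (simp add: norm_scaleC norm_divide norm_mult)
      also have "\<dots> \<le> norm (H_op m \<theta> (P k \<psi>)) / 2"
        by (rule divide_left_mono) (use \<mu> in auto)
      finally show ?thesis .
    qed
    then show ?thesis
      unfolding eigenprojection_def by (intro order_trans[OF norm_triangle_ineq] add_mono) (simp_all add: norm_scaleC)
  qed
  also have "\<dots> \<le> S * ?n + \<bar>m\<bar> * (S * ?n) + 4 * (real (k + 1) * (S * ?n))"
    using P H by linarith
  also have "\<dots> \<le> (3 + 2 * \<bar>m\<bar> + 4 * real (k + 1)) * S * ?n"
  proof -
    have "0 \<le> S * ?n" "0 \<le> \<bar>m\<bar> * (S * ?n)" using S by (auto intro: mult_nonneg_nonneg)
    then show ?thesis by (simp add: algebra_simps)
  qed
  finally show "norm (blinfun_apply B \<psi>) \<le> (3 + 2 * \<bar>m\<bar> + 4 * real (k + 1)) * (q (Suc k) + q k) * ?n"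
    by (simp add: B S_def)
qed

lemma growth_rate_eq: "(1 + \<bar>sin \<theta>\<bar>) / cos \<theta> = sqrt ((1 + \<bar>sin \<theta>\<bar>) / (1 - \<bar>sin \<theta>\<bar>))"
proof -
  let ?s = "\<bar>sin \<theta>\<bar>"
  have c: "(cos \<theta>)\<^sup>2 = (1 + ?s) * (1 - ?s)"
    using sin_cos_squared_add[of \<theta>] by (simp add: algebra_simps power2_eq_square)
  then have "((1 + ?s) / cos \<theta>)\<^sup>2 = (1 + ?s) / (1 - ?s)"
    by (simp add: power_divide power2_eq_square)
  then show ?thesis using cos_theta_pos by (metis abs_ge_zero abs_of_nonneg add_nonneg_nonneg divide_nonneg_pos real_sqrt_abs zero_le_one)
qed

theorem spectral_projector_growth:
  assumes s: "s \<in> {1, - 1}"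
  shows "(\<lambda>n. ln (norm (spectral_projector m \<theta> s n)) / real n)
           \<longlonglongrightarrow> ln (sqrt ((1 + \<bar>sin \<theta>\<bar>) / (1 - \<bar>sin \<theta>\<bar>)))"
proof -
  define \<rho> where "\<rho> = (1 + \<bar>sin \<theta>\<bar>) / cos \<theta>"
  have "cos \<theta> \<le> 1 + \<bar>sin \<theta>\<bar>" using cos_le_one[of \<theta>] by linarith
  then have \<rho>: "1 \<le> \<rho>" using cos_theta_pos by (simp add: \<rho>_def pos_le_divide_eq)
  obtain C1 C2 where C: "0 < C1" "0 < C2"
    "\<And>n. 2 \<le> n \<Longrightarrow> C1 * \<rho> ^ n / real n \<le> q n" "\<And>n. 1 \<le> n \<Longrightarrow> q n \<le> C2 * \<rho> ^ n"
    using q_growth unfolding \<rho>_def by blast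
  have bounds: "q (Suc k) / 2 \<le> norm (spectral_projector m \<theta> s (Suc k)) \<and>
      norm (spectral_projector m \<theta> s (Suc k)) \<le> (3 + 2 * \<bar>m\<bar> + 4 * real (k + 1)) * (q (Suc k) + q k)" for k
  proof -
    define \<mu> where "\<mu> = H_eigenvalue m s (Suc k)"
    have "s\<^sup>2 = 1" using s by auto
    then have "(s * sqrt (2 * real (Suc k) + m\<^sup>2))\<^sup>2 = 2 * real (Suc k) + m\<^sup>2"
      by (simp add: power_mult_distrib)
    then have sq: "\<mu>\<^sup>2 = of_real (2 * real (Suc k) + m\<^sup>2)"
      unfolding \<mu>_def H_eigenvalue_def of_real_power[symmetric] by simp
    then have ev: "\<mu>\<^sup>2 = of_real (m\<^sup>2) + of_nat (2 * Suc k)" by simp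
    have "1 \<le> (cmod \<mu>)\<^sup>2"
    proof -
      have "(cmod \<mu>)\<^sup>2 = 2 * real (Suc k) + m\<^sup>2"
        unfolding norm_power[symmetric] sq norm_of_real by simp
      then show ?thesis by simp
    qed
    then have 1: "1 \<le> cmod \<mu>" using power2_le_imp_le[of 1 "cmod \<mu>"] by simp
    then have nz: "\<mu> \<noteq> 0" by auto
    have B: "blinfun_apply (spectral_projector m \<theta> s (Suc k)) \<psi> = eigenprojection m \<mu> k \<psi>" for \<psi>
      unfolding spectral_projector_def \<mu>_def[symmetric] by (rule riesz_projection_H[OF ev nz])
    show ?thesis using norm_eigenprojection_ge[OF B] norm_eigenprojection_le[OF B 1] by blast
  qed
  have "(\<lambda>n. ln (norm (spectral_projector m \<theta> s n)) / real n) \<longlonglongrightarrow> ln \<rho>"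
  proof (rule ln_growth_rate)
    show "0 < \<rho>" using \<rho> by simp
    show "0 < C1 / 2" using C by simp
    show "0 < (7 + 2 * \<bar>m\<bar>) * (2 * C2)" using C by (intro mult_pos_pos) auto
    fix n :: nat assume n: "2 \<le> n"
    \<comment> \<open>Taking n \<ge> 2 keeps k \<ge> 1, so the upper bound for \<open>q\<close> is
      available at both neighbouring levels.\<close>
    obtain k where k: "n = Suc k" "1 \<le> k" using n by (cases n) auto
    show "C1 / 2 * \<rho> ^ n / real n \<le> norm (spectral_projector m \<theta> s n)"
    proof -
      have "C1 / 2 * \<rho> ^ n / real n = (C1 * \<rho> ^ n / real n) / 2" by simp
      then show ?thesis using bounds[of k, folded k(1)] C(3)[OF n] by linarith
    qed
    have "norm (spectral_projector m \<theta> s n) \<le> (3 + 2 * \<bar>m\<bar> + 4 * real n) * (q n + q k)"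
      using bounds[of k] by (simp add: k(1) add.commute)
    also have "\<dots> \<le> ((7 + 2 * \<bar>m\<bar>) * real n) * (2 * C2 * \<rho> ^ n)"
    proof (rule mult_mono)
      have "3 + 2 * \<bar>m\<bar> \<le> (3 + 2 * \<bar>m\<bar>) * real n"
        using n mult_left_mono[of 1 "real n" "3 + 2 * \<bar>m\<bar>"] by simp
      then show "3 + 2 * \<bar>m\<bar> + 4 * real n \<le> (7 + 2 * \<bar>m\<bar>) * real n" by (simp add: algebra_simps)
      have "C2 * \<rho> ^ k \<le> C2 * \<rho> ^ n" using C \<rho> k by (intro mult_left_mono power_increasing) auto
      then show "q n + q k \<le> 2 * C2 * \<rho> ^ n" using C(4)[of n] C(4)[of k] k n by simp
      show "0 \<le> q n + q k" by (simp add: q_def)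
    qed (simp add: add_nonneg_nonneg)
    finally show "norm (spectral_projector m \<theta> s n) \<le> (7 + 2 * \<bar>m\<bar>) * (2 * C2) * real n * \<rho> ^ n"
      by (simp only: mult_ac)
  qed
  then show ?thesis unfolding \<rho>_def growth_rate_eq .
qed

end

theorem theorem1p1:
  fixes m \<theta> s :: real
  assumes "0 \<le> m" and "- (pi / 2) < \<theta>" and "\<theta> < pi / 2" and "s \<in> {1, - 1}"
  shows "(\<lambda>n. ln (norm (spectral_projector m \<theta> s n)) / real n)
           \<longlonglongrightarrow> ln (sqrt ((1 + \<bar>sin \<theta>\<bar>) / (1 - \<bar>sin \<theta>\<bar>)))"
proof -
  interpret rotated \<theta> using assms by unfold_locales
  show ?thesis using assms(4) by (rule spectral_projector_growth)
qed

end
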